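(* Let $n$ be a positive integer, $p>2$, $f\in L^{p,2}(\mathbb{C}_+)$, $h_0\in\mathcal{H}_{tg}$, $h_k\in\mathcal{H}_{tg,0}\cap L^{p,2}(\mathbb{C}_+)$ for $1\le k\le n-1$, and $c\in\mathbb{R}$. Then the Schwarz boundary value problem $$\frac{\partial^nw}{\partial\bar z^n}=f\ \text{ in }\mathbb{C}_+,\qquad \operatorname{Re}\left\{\left(\frac{\partial^kw}{\partial\bar z^k}\right)_b\right\}=\operatorname{Re}\{(h_k)_b\}\ \ (0\le k\le n-1),$$ $$\operatorname{Im}w(i)=c,\qquad \operatorname{Im}\frac{\partial^kw}{\partial\bar z^k}(i)=0\ \ (1\le k\le n-1)$$ is solved by the function given, for $z=x+iy\in\mathbb{C}_+$, by $$w(z)=ic+\frac1\pi\langle(h_0)_b,P(x-\cdot,y)\rangle-\frac i\pi\langle\operatorname{Im}(h_0)_b,P(\cdot,1)\rangle+\sum_{k=1}^{n-1}\mathcal{T}_{\mathbb{C}_+}^k\left(\frac1\pi\langle(h_k)_b,P(x-\cdot,y)\rangle\right)(z)+\mathcal{T}_{\mathbb{C}_+}^n(f)(z),$$ where $P(x,y)=\frac y{x^2+y^2}$, and in the $k$-th term of the sum $\mathcal{T}_{\mathbb{C}_+}^k$ is applied to the function $x+iy\mapsto\frac1\pi\langle(h_k)_b,P(x-\cdot,y)\rangle$ on $\mathbb{C}_+$.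
   Context: $\mathbb{C}_+$ and $\mathbb{C}_-$ are the open upper and lower half-planes, $D$ is the open unit disk, $H(\mathbb{C}_+)$ is the space of holomorphic functions on $\mathbb{C}_+$, and $\mathcal{D}'(\mathbb{R})$ is the space of distributions on $\mathbb{R}$. Derivatives $\partial^k/\partial\bar z^k$ are understood in the weak (distributional) sense. $L^{p,\nu}(\mathbb{C}_+)$ is the space of functions $f:\mathbb{C}_+\to\mathbb{C}$ such that $f\in L^p(D\cap\mathbb{C}_+)$ and $f_\nu\in L^p(D\cap\mathbb{C}_-)$, where $f_\nu(z):=\frac1{|z|^\nu}f\left(\frac1z\right)$. The operator $\mathcal{T}_{\mathbb{C}_+}$ is $$\mathcal{T}_{\mathbb{C}_+}(f)(z)=-\frac1\pi\iint_{\mathbb{C}_+}\left(f(\zeta)\left(\frac1{\zeta-z}-\frac\zeta{\zeta^2+1}\right)-\overline{f(\zeta)}\left(\frac1{\overline\zeta-z}-\frac{\overline\zeta}{\overline\zeta^2+1}\right)\right)d\xi\,d\eta\qquad(\zeta=\xi+i\eta),$$ whenever the integral is defined, and $\mathcal{T}_{\mathbb{C}_+}^m$ denotes its $m$-fold composition. A function $g$ on $\mathbb{C}_+$ has a boundary value in the sense of distributions, denoted $g_b\in\mathcal{D}'(\mathbb{R})$, if for every $\varphi\in C_c^\infty(\mathbb{R})$ the limit $$\langle g_b,\varphi\rangle:=\lim_{s\searrow0}\int_{-\infty}^\infty g(t+is)\,\varphi(t)\,dt$$ exists. For a distribution $u$, $\operatorname{Re}u$ and $\operatorname{Im}u$ are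 the real-valued distributions with $u=\operatorname{Re}u+i\operatorname{Im}u$, i.e. $\langle\operatorname{Re}u,\varphi\rangle=\operatorname{Re}\langle u,\varphi\rangle$ and $\langle\operatorname{Im}u,\varphi\rangle=\operatorname{Im}\langle u,\varphi\rangle$ for real-valued $\varphi$. $\mathcal{H}_{tg}$ is the set of $f\in H(\mathbb{C}_+)$ with tempered growth at the boundary: there exist a constant $C$ and a positive integer $N$ such that $|f(x+iy)|\le C/y^N$ for all $x+iy\in\mathbb{C}_+$. $\mathcal{H}_{tg,0}$ is the set of $f\in\mathcal{H}_{tg}$ with $\operatorname{Im}\{f(i)\}=0$. Every $h\in\mathcal{H}_{tg}$ has a boundary value in the sense of distributions. The pairings of $h_b$ and $\operatorname{Im}h_b$ with Poisson kernels are understood through the same limit: $\langle h_b,P(x-\cdot,y)\rangle=\lim_{s\searrow0}\int_{-\infty}^\infty h(t+is)P(x-t,y)\,dt$ and $\langle\operatorname{Im}h_b,P(\cdot,1)\rangle=\lim_{s\searrow0}\int_{-\infty}^\infty\operatorname{Im}h(t+is)P(t,1)\,dt$.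
   Formalization: It is additionally assumed that the (Lebesgue) integrals defining the second and later applications of T in T^n(f) and in T^k applied to the Poisson integrals of h_k exist at every point of C_+; for general f in L^{p,2} they can diverge already for T^2(f). *)

theory Defs
  imports "HOL-Analysis.Analysis"
begin

text \<open>Functions on the open upper half-plane are total functions on \<^typ>\<open>complex\<close> whose values
  outside \<open>upper_hp\<close> are irrelevant. The area measure is Lebesgue measure on \<^typ>\<open>complex\<close>.\<close>

definition upper_hp :: "complex set" where
  "upper_hp = {z. Im z > 0}"

definition lower_hp :: "complex set" where
  "lower_hp = {z. Im z < 0}"


subsection \<open>Function spaces\<close>

definition Lp_on :: "real \<Rightarrow> complex set \<Rightarrow> (complex \<Rightarrow> complex) set" where
  "Lp_on p A = {f. set_borel_measurable lebesgue A f \<and>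
                   set_integrable lebesgue A (\<lambda>z. norm (f z) powr p)}"

definition Lp_nu :: "real \<Rightarrow> real \<Rightarrow> (complex \<Rightarrow> complex) set" where
  "Lp_nu p \<nu> = {f. f \<in> Lp_on p (ball 0 1 \<inter> upper_hp) \<and>
                   (\<lambda>z. of_real (1 / norm z powr \<nu>) * f (1 / z)) \<in> Lp_on p (ball 0 1 \<inter> lower_hp)}"

definition H_tg :: "(complex \<Rightarrow> complex) set" where
  "H_tg = {f. f holomorphic_on upper_hp \<and>
              (\<exists>(C::real) (N::nat). N > 0 \<and> (\<forall>z\<in>upper_hp. norm (f z) \<le> C / Im z ^ N))}"

definition H_tg0 :: "(complex \<Rightarrow> complex) set" where
  "H_tg0 = {f \<in> H_tg. Im (f \<i>) = 0}"


subsection \<open>Test functions\<close>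

primrec times_differentiable :: "nat \<Rightarrow> ('a::real_normed_vector \<Rightarrow> 'b::real_normed_vector) \<Rightarrow> bool"
where
  "times_differentiable 0 f = continuous_on UNIV f"
| "times_differentiable (Suc k) f =
     ((\<forall>x. f differentiable (at x)) \<and>
      (\<forall>v. times_differentiable k (\<lambda>x. frechet_derivative f (at x) v)))"

definition test_functions :: "'a::real_normed_vector set \<Rightarrow> ('a \<Rightarrow> 'b::real_normed_vector) set" where
  "test_functions U = {\<phi>. (\<forall>k. times_differentiable k \<phi>) \<and>
                          (\<exists>K. compact K \<and> K \<subseteq> U \<and> (\<forall>x. x \<notin> K \<longrightarrow> \<phi> x = 0))}"


subsection \<open>Weak derivatives with respect to the conjugate variable\<close>

definition dbar :: "(complex \<Rightarrow> complex) \<Rightarrow> complex \<Rightarrow> complex" where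
  "dbar \<phi> z = (frechet_derivative \<phi> (at z) 1 + \<i> * frechet_derivative \<phi> (at z) \<i>) / 2"

definition locally_integrable_on :: "complex set \<Rightarrow> (complex \<Rightarrow> complex) \<Rightarrow> bool" where
  "locally_integrable_on U f \<longleftrightarrow> (\<forall>K. compact K \<and> K \<subseteq> U \<longrightarrow> set_integrable lebesgue K f)"

definition has_weak_dbar :: "nat \<Rightarrow> (complex \<Rightarrow> complex) \<Rightarrow> (complex \<Rightarrow> complex) \<Rightarrow> bool" where
  "has_weak_dbar k w g \<longleftrightarrow>
     locally_integrable_on upper_hp w \<and> locally_integrable_on upper_hp g \<and>
     (\<forall>\<phi>\<in>test_functions upper_hp.
        (LINT z:upper_hp|lebesgue. w z * (dbar ^^ k) \<phi> z) =
        (-1) ^ k * (LINT z:upper_hp|lebesgue. g z * \<phi> z))"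


subsection \<open>Distributional boundary values\<close>

text \<open>\<open>boundary_pairing g\<close> is \<open>\<phi> \<mapsto> \<langle>g\<^sub>b, \<phi>\<rangle>\<close>, for test functions as well as for
  Poisson kernels. Its value is meaningful only if \<open>boundary_pairing_exists g \<phi>\<close>.\<close>

definition boundary_pairing :: "(complex \<Rightarrow> complex) \<Rightarrow> (real \<Rightarrow> complex) \<Rightarrow> complex" where
  "boundary_pairing g \<phi> = Lim (at_right 0) (\<lambda>s. LINT t|lebesgue. g (Complex t s) * \<phi> t)"

definition boundary_pairing_exists :: "(complex \<Rightarrow> complex) \<Rightarrow> (real \<Rightarrow> complex) \<Rightarrow> bool" where
  "boundary_pairing_exists g \<phi> \<longleftrightarrow>
     (\<forall>\<^sub>F s in at_right 0. integrable lebesgue (\<lambda>t. g (Complex t s) * \<phi> t)) \<and>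
     (\<exists>L. ((\<lambda>s. LINT t|lebesgue. g (Complex t s) * \<phi> t) \<longlongrightarrow> L) (at_right 0))"

definition has_boundary_value :: "(complex \<Rightarrow> complex) \<Rightarrow> bool" where
  "has_boundary_value g \<longleftrightarrow> (\<forall>\<phi>\<in>test_functions UNIV. boundary_pairing_exists g \<phi>)"

text \<open>The real part of a distribution is determined by its values on real-valued test
  functions.\<close>

definition Re_distr :: "((real \<Rightarrow> complex) \<Rightarrow> complex) \<Rightarrow> (real \<Rightarrow> real) \<Rightarrow> real" where
  "Re_distr u \<phi> = Re (u (\<lambda>t. of_real (\<phi> t)))"

definition poisson_P :: "real \<Rightarrow> real \<Rightarrow> real" where
  "poisson_P x y = y / (x\<^sup>2 + y\<^sup>2)"

definition poisson_at :: "complex \<Rightarrow> real \<Rightarrow> complex" where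
  "poisson_at z t = of_real (poisson_P (Re z - t) (Im z))"

definition poisson_ext :: "(complex \<Rightarrow> complex) \<Rightarrow> complex \<Rightarrow> complex" where
  "poisson_ext h z = of_real (1 / pi) * boundary_pairing h (poisson_at z)"


subsection \<open>The integral operator\<close>

definition T_integrand :: "(complex \<Rightarrow> complex) \<Rightarrow> complex \<Rightarrow> complex \<Rightarrow> complex" where
  "T_integrand f z \<zeta> =
     f \<zeta> * (1 / (\<zeta> - z) - \<zeta> / (\<zeta>\<^sup>2 + 1)) -
     cnj (f \<zeta>) * (1 / (cnj \<zeta> - z) - cnj \<zeta> / ((cnj \<zeta>)\<^sup>2 + 1))"

definition T_op :: "(complex \<Rightarrow> complex) \<Rightarrow> complex \<Rightarrow> complex" where
  "T_op f z = - of_real (1 / pi) * (LINT \<zeta>:upper_hp|lebesgue. T_integrand f z \<zeta>)"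

text \<open>The integral in \<open>T_op f z\<close> is defined in the sense of Lebesgue; when it is not, the library's
  integral returns 0 and \<open>T_op f z\<close> has no meaning.\<close>

definition T_defined :: "(complex \<Rightarrow> complex) \<Rightarrow> complex \<Rightarrow> bool" where
  "T_defined f z \<longleftrightarrow> set_integrable lebesgue upper_hp (T_integrand f z)"


subsection \<open>The Schwarz boundary value problem\<close>

text \<open>A weak derivative is determined only almost everywhere, so the pointwise conditions at
  \<open>\<i>\<close> refer to its (unique) continuous representative \<open>W k\<close> on the half-plane.\<close>

definition solves_schwarz ::
  "nat \<Rightarrow> (complex \<Rightarrow> complex) \<Rightarrow> (nat \<Rightarrow> complex \<Rightarrow> complex) \<Rightarrow> real \<Rightarrow> (complex \<Rightarrow> complex) \<Rightarrow> bool"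
where
  "solves_schwarz n f h c w \<longleftrightarrow>
     has_weak_dbar n w f \<and>
     (\<exists>W. W 0 = w \<and>
          (\<forall>k<n. continuous_on upper_hp (W k) \<and> has_weak_dbar k w (W k) \<and>
                 has_boundary_value (W k) \<and> has_boundary_value (h k) \<and>
                 (\<forall>\<phi>\<in>test_functions UNIV.
                    Re_distr (boundary_pairing (W k)) \<phi> = Re_distr (boundary_pairing (h k)) \<phi>)) \<and>
          Im (w \<i>) = c \<and>
          (\<forall>k\<in>{1..n - 1}. Im (W k \<i>) = 0))"

definition schwarz_formula ::
  "nat \<Rightarrow> (complex \<Rightarrow> complex) \<Rightarrow> (nat \<Rightarrow> complex \<Rightarrow> complex) \<Rightarrow> real \<Rightarrow> complex \<Rightarrow> complex"
where
  "schwarz_formula n f h c z =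
     \<i> * of_real c
     + of_real (1 / pi) * boundary_pairing (h 0) (poisson_at z)
     - \<i> / of_real pi * boundary_pairing (\<lambda>\<zeta>. of_real (Im (h 0 \<zeta>))) (\<lambda>t. of_real (poisson_P t 1))
     + (\<Sum>k=1..n - 1. (T_op ^^ k) (poisson_ext (h k)) z)
     + (T_op ^^ n) f z"

text \<open>All limits and integrals occurring in \<open>schwarz_formula\<close> exist.\<close>

definition schwarz_formula_defined ::
  "nat \<Rightarrow> (complex \<Rightarrow> complex) \<Rightarrow> (nat \<Rightarrow> complex \<Rightarrow> complex) \<Rightarrow> bool"
where
  "schwarz_formula_defined n f h \<longleftrightarrow>
     (\<forall>k<n. \<forall>z\<in>upper_hp. boundary_pairing_exists (h k) (poisson_at z)) \<and>
     boundary_pairing_exists (\<lambda>\<zeta>. of_real (Im (h 0 \<zeta>))) (\<lambda>t. of_real (poisson_P t 1)) \<and>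
     (\<forall>k\<in>{1..n - 1}. \<forall>j<k. \<forall>z\<in>upper_hp. T_defined ((T_op ^^ j) (poisson_ext (h k))) z) \<and>
     (\<forall>j<n. \<forall>z\<in>upper_hp. T_defined ((T_op ^^ j) f) z)"

end

theory Submission
  imports Defs "HOL-Complex_Analysis.Complex_Analysis" "HOL-Probability.Sinc_Integral"
begin

text \<open>The Poisson pairings reproduce \<open>h\<close>, so that \<open>w\<close> is, up to an imaginary constant, the sum of \<open>h 0\<close>, of the
  \<open>T\<^sup>k (h k)\<close> and of \<open>T\<^sup>n f\<close>. It therefore suffices to know three things about \<open>T F\<close>: it is a weak
  primitive of \<open>F\<close> for \<open>dbar\<close> (Fubini and Cauchy-Pompeiu), it extends continuously to the real line
  with real part 0 there, and it is real at \<open>\<i>\<close>. The last two hold because the integrand is the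
  difference of a quantity and its conjugate for real \<open>z\<close>, and \<open>\<i>\<close> times such a difference at \<open>\<i>\<close>.
  These facts persist under iteration because only two properties of \<open>F\<close> are needed: local \<open>p\<close>-integrability
  up to the boundary, which continuous functions have, and existence of \<open>T F\<close>, which by itself controls
  \<open>F\<close> at infinity. The distributional boundary value of \<open>h k\<close> exists because each derivative moved
  to the test function gains one power of the distance to the boundary.\<close>

subsection \<open>Test functions and integrals of derivatives\<close>

text \<open>The obstacle is that the operator leaves the space of data. Nonzero constants are not in
  \<open>Lp_nu p 2\<close>, because \<open>|z|\<close> to the power \<open>-2\<close> is not
  p-integrable near 0, whereas for a compactly supported density \<open>T_op F\<close> tends at
  infinity to an imaginary constant that is in general not zero. An induction on
  \<open>T_op ^^ k\<close> therefore cannot ask for decay. It asks for existence of the integrals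
  instead, and this is enough: absolute convergence at the two points \<open>\<i>\<close> and
  \<open>2 * \<i>\<close> dominates the far part of the integrand locally uniformly in
  \<open>z\<close>, real \<open>z\<close> included. The near part is built from Cauchy transforms,
  and \<open>p > 2\<close> makes these continuous: the conjugate exponent is below 2, so
  \<open>1 / |\<zeta>|\<close>, and even a slightly higher power of it, is locally integrable to
  that exponent. Continuity up to the real line turns the boundary pairings of the
  \<open>T_op\<close> terms into plain integrals over the line, so that distributional limits have
  to be studied for the holomorphic data only.\<close>

lemma times_differentiable_bounded_linear:
  assumes "bounded_linear L" "times_differentiable k f"
  shows "times_differentiable k (\<lambda>x. L (f x))"
  using assms(2)
proof (induction k arbitrary: f)
  case 0
  then show ?case
    using assms(1) by (auto intro!: bounded_linear.continuous_on[of L])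
next
  case (Suc k)
  have d: "((\<lambda>x. L (f x)) has_derivative (\<lambda>v. L (frechet_derivative f (at x) v))) (at x)" for x
    using Suc.prems by (intro bounded_linear.has_derivative[OF assms(1)]) (auto simp: frechet_derivative_works[symmetric])
  then have "frechet_derivative (\<lambda>x. L (f x)) (at x) = (\<lambda>v. L (frechet_derivative f (at x) v))" for x
    using frechet_derivative_at by metis
  then show ?case
    using Suc d by (auto simp: differentiable_def)
qed

lemma times_differentiable_add:
  assumes "times_differentiable k f" "times_differentiable k g"
  shows "times_differentiable k (\<lambda>x. f x + g x)"
  using assms
proof (induction k arbitrary: f g)
  case 0
  then show ?case by (auto intro!: continuous_intros)
next
  case (Suc k)
  have d: "((\<lambda>x. f x + g x) has_derivative
      (\<lambda>v. frechet_derivative f (at x) v + frechet_derivative g (at x) v)) (at x)" for x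
    using Suc.prems by (intro has_derivative_add) (auto simp: frechet_derivative_works[symmetric])
  then have "frechet_derivative (\<lambda>x. f x + g x) (at x)
      = (\<lambda>v. frechet_derivative f (at x) v + frechet_derivative g (at x) v)" for x
    using frechet_derivative_at by metis
  moreover have "(\<lambda>x. f x + g x) differentiable (at x)" for x
    using d unfolding differentiable_def by blast
  ultimately show ?case
    using Suc by simp
qed

lemma test_functions_has_derivative:
  assumes "\<phi> \<in> test_functions U"
  shows "(\<phi> has_derivative frechet_derivative \<phi> (at x)) (at x)"
proof -
  have "times_differentiable (Suc 0) \<phi>"
    using assms unfolding test_functions_def by blast
  then show ?thesis
    using frechet_derivative_works by auto
qed

lemma test_functions_continuous_on:
  assumes "\<phi> \<in> test_functions U"
  shows "continuous_on S \<phi>"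
  by (rule has_derivative_continuous_on[OF has_derivative_at_withinI[OF test_functions_has_derivative[OF assms]]])

lemma has_derivative_eq_0_outside_support:
  assumes "(\<psi> has_derivative D) (at x)" "compact K" "\<And>y. y \<notin> K \<Longrightarrow> \<psi> y = 0" "x \<notin> K"
  shows "D = (\<lambda>_. 0)"
proof -
  have "(\<psi> has_derivative (\<lambda>_. 0)) (at x)"
    by (rule has_derivative_transform_within_open[of "\<lambda>_. 0" _ _ _ "- K"])
      (use assms compact_imp_closed in auto)
  then show ?thesis
    using assms(1) has_derivative_unique by blast
qed

lemma test_functions_frechet_derivative:
  assumes "\<phi> \<in> test_functions U"
  shows "(\<lambda>x. frechet_derivative \<phi> (at x) v) \<in> test_functions U"
proof -
  obtain K where K: "compact K" "K \<subseteq> U" "\<And>x. x \<notin> K \<Longrightarrow> \<phi> x = 0"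
    using assms unfolding test_functions_def by blast
  have "times_differentiable (Suc k) \<phi>" for k
    using assms unfolding test_functions_def by blast
  moreover have "frechet_derivative \<phi> (at x) v = 0" if "x \<notin> K" for x
    using has_derivative_eq_0_outside_support[OF test_functions_has_derivative[OF assms] K(1,3) that] by simp
  ultimately show ?thesis
    using K(1,2) unfolding test_functions_def by auto
qed

lemma test_functions_bounded_linear:
  assumes "bounded_linear L" "\<phi> \<in> test_functions U"
  shows "(\<lambda>x. L (\<phi> x)) \<in> test_functions U"
proof -
  have "L 0 = 0"
    using assms(1) linear_0 bounded_linear.linear by blast
  then show ?thesis
    using assms(2) times_differentiable_bounded_linear[OF assms(1)] unfolding test_functions_def
    by clarsimp (intro conjI allI exI, auto)
qed

lemma test_functions_add:
  assumes "\<phi> \<in> test_functions U" "\<psi> \<in> test_functions U"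
  shows "(\<lambda>x. \<phi> x + \<psi> x) \<in> test_functions U"
proof -
  obtain K L where "compact K" "K \<subseteq> U" "\<And>x. x \<notin> K \<Longrightarrow> \<phi> x = 0"
    "compact L" "L \<subseteq> U" "\<And>x. x \<notin> L \<Longrightarrow> \<psi> x = 0"
    using assms unfolding test_functions_def by blast
  then have "compact (K \<union> L) \<and> K \<union> L \<subseteq> U \<and> (\<forall>x. x \<notin> K \<union> L \<longrightarrow> \<phi> x + \<psi> x = 0)"
    by auto
  then show ?thesis
    using assms times_differentiable_add unfolding test_functions_def by blast
qed

lemma test_functions_dbar:
  assumes "\<phi> \<in> test_functions U"
  shows "dbar \<phi> \<in> test_functions U"
proof -
  have "(\<lambda>z. (1/2) * frechet_derivative \<phi> (at z) 1 + (\<i>/2) * frechet_derivative \<phi> (at z) \<i>)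
      \<in> test_functions U"
    by (intro test_functions_add test_functions_bounded_linear[OF bounded_linear_mult_right]
        test_functions_frechet_derivative assms)
  also have "(\<lambda>z. (1/2) * frechet_derivative \<phi> (at z) 1 + (\<i>/2) * frechet_derivative \<phi> (at z) \<i>)
      = dbar \<phi>"
    by (auto simp: dbar_def fun_eq_iff field_simps)
  finally show ?thesis .
qed

lemma test_functions_support:
  assumes "\<phi> \<in> test_functions U"
  obtains K where "compact K" "K \<subseteq> U" "\<And>x. x \<notin> K \<Longrightarrow> \<phi> x = 0"
  using assms unfolding test_functions_def by blast

lemma integrable_lebesgue_compact_support:
  fixes f :: "'a::euclidean_space \<Rightarrow> 'b::euclidean_space"
  assumes "continuous_on UNIV f" "compact K" "\<And>x. x \<notin> K \<Longrightarrow> f x = 0"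
  shows "integrable lebesgue f"
proof -
  obtain a where a: "K \<subseteq> cbox (-a) a"
    using bounded_subset_cbox_symmetric[OF compact_imp_bounded[OF assms(2)]] by blast
  have "f absolutely_integrable_on cbox (-a) a"
    by (rule absolutely_integrable_continuous) (use assms(1) continuous_on_subset in blast)
  moreover have "(\<lambda>x. indicat_real (cbox (-a) a) x *\<^sub>R f x) = f"
    using assms(3) a by (auto simp: indicator_def fun_eq_iff)
  ultimately show ?thesis
    unfolding set_integrable_def by simp
qed

lemma bounded_compact_support:
  fixes f :: "'a::topological_space \<Rightarrow> 'b::real_normed_vector"
  assumes "continuous_on UNIV f" "compact K" "\<And>x. x \<notin> K \<Longrightarrow> f x = 0"
  obtains B where "B > 0" "\<And>x. norm (f x) \<le> B"
proof -
  have "compact (f ` K)"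
    by (intro compact_continuous_image continuous_on_subset[OF assms(1)] assms(2)) auto
  then obtain B where "B > 0" "\<And>x. x \<in> K \<Longrightarrow> norm (f x) \<le> B"
    using compact_imp_bounded bounded_pos by (metis imageI)
  then show ?thesis
    using that[of B] assms(3) by (metis norm_zero order_less_imp_le)
qed

lemma lebesgue_integral_translation:
  fixes f :: "'a::euclidean_space \<Rightarrow> 'b::euclidean_space"
  assumes "f \<in> borel_measurable borel"
  shows "(LINT x|lebesgue. f (c + x)) = (LINT x|lebesgue. f x)"
proof -
  have "(LINT x|lebesgue. f (c + x)) = (LINT x|lborel. f (c + x))"
    using measurable_compose[of "(+) c" borel borel f borel] assms by (intro integral_completion) simp
  also have "\<dots> = (LINT x|distr lborel borel ((+) c). f x)"
    using assms by (subst integral_distr) auto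
  also have "\<dots> = (LINT x|lebesgue. f x)"
    using assms by (subst lborel_distr_plus) (auto simp: integral_completion)
  finally show ?thesis .
qed

text \<open>The integral of a translate does not depend on the translation; differentiate it under the
  integral sign.\<close>

lemma integral_directional_derivative_eq_0:
  fixes \<psi> :: "'a::euclidean_space \<Rightarrow> 'b::euclidean_space"
  assumes der: "\<And>x. (\<psi> has_derivative D x) (at x)"
    and cont: "continuous_on UNIV (\<lambda>x. D x v)"
    and K: "compact K" "\<And>x. x \<notin> K \<Longrightarrow> \<psi> x = 0"
  shows "(LINT x|lebesgue. D x v) = 0"
proof -
  have c\<psi>: "continuous_on UNIV \<psi>"
    using der has_derivative_continuous_on has_derivative_at_withinI by blast
  have D0: "D x v = 0" if "x \<notin> K" for x
    using has_derivative_eq_0_outside_support[OF der K that] by simp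
  define U where "U = {-1..1::real}"
  \<comment> \<open>\<open>K'\<close> contains the supports of all translates with \<open>t\<close>
    in \<open>U\<close>, so that a single box serves for every \<open>t\<close> and the Leibniz rule
    applies.\<close>
  define K' where "K' = (\<lambda>(t, x). x - t *\<^sub>R v) ` (U \<times> K)"
  have K': "compact K'"
    unfolding K'_def U_def split_beta by (intro compact_continuous_image compact_Times K(1) continuous_intros) auto
  have out: "x + t *\<^sub>R v \<notin> K" if "t \<in> U" "x \<notin> K'" for x t
  proof
    assume "x + t *\<^sub>R v \<in> K"
    then have "(\<lambda>(t, x). x - t *\<^sub>R v) (t, x + t *\<^sub>R v) \<in> K'"
      unfolding K'_def using that(1) by (intro imageI) auto
    with that(2) show False by simp
  qed
  obtain a where a: "K' \<subseteq> cbox (-a) a"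
    using bounded_subset_cbox_symmetric[OF compact_imp_bounded[OF K']] by blast
  have cg: "continuous_on S (\<lambda>x. g (x + t *\<^sub>R v))"
    if "continuous_on UNIV g" for g :: "'a \<Rightarrow> 'b" and t S
    by (intro continuous_intros continuous_on_compose2[OF that]) auto
  have to_HK: "(LINT x|lebesgue. g (x + t *\<^sub>R v)) = integral (cbox (-a) a) (\<lambda>x. g (x + t *\<^sub>R v))"
    if "t \<in> U" "continuous_on UNIV g" "\<And>x. x \<notin> K \<Longrightarrow> g x = 0" for t and g :: "'a \<Rightarrow> 'b"
  proof -
    have "(\<lambda>x. indicat_real (cbox (-a) a) x *\<^sub>R g (x + t *\<^sub>R v)) = (\<lambda>x. g (x + t *\<^sub>R v))"
      using out[OF that(1)] that(3) a by (auto simp: indicator_def fun_eq_iff)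
    with set_lebesgue_integral_eq_integral(2)[OF absolutely_integrable_continuous[OF cg[OF that(2), of _ t]]]
    show ?thesis
      unfolding set_lebesgue_integral_def by metis
  qed
  have deriv: "((\<lambda>t. integral (cbox (-a) a) (\<lambda>x. \<psi> (x + t *\<^sub>R v))) has_vector_derivative
      integral (cbox (-a) a) (\<lambda>x. D (x + 0 *\<^sub>R v) v)) (at 0 within U)"
  proof (rule leibniz_rule_vector_derivative)
    fix t x
    have "((\<lambda>t. \<psi> (x + t *\<^sub>R v)) has_derivative (\<lambda>s. D (x + t *\<^sub>R v) (s *\<^sub>R v))) (at t within U)"
      by (rule has_derivative_compose[of "\<lambda>t. x + t *\<^sub>R v", OF _ der])
        (auto intro!: derivative_eq_intros)
    then show "((\<lambda>t. \<psi> (x + t *\<^sub>R v)) has_vector_derivative D (x + t *\<^sub>R v) v) (at t within U)"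
      by (simp add: has_vector_derivative_def linear_scale[OF has_derivative_linear[OF der]])
  next
    show "continuous_on (U \<times> cbox (-a) a) (\<lambda>(t, x). D (x + t *\<^sub>R v) v)"
      unfolding split_beta by (rule continuous_on_compose2[OF cont]) (auto intro!: continuous_intros)
  qed (auto simp: U_def intro!: integrable_continuous cg c\<psi>)
  have const: "(LINT x|lebesgue. \<psi> x) = integral (cbox (-a) a) (\<lambda>x. \<psi> (x + t *\<^sub>R v))" if "t \<in> U" for t
    using to_HK[OF that c\<psi> K(2)] lebesgue_integral_translation[OF borel_measurable_continuous_onI[OF c\<psi>], of "t *\<^sub>R v"]
    by (simp add: add.commute)
  have "((\<lambda>t. (LINT x|lebesgue. \<psi> x)) has_vector_derivative
      integral (cbox (-a) a) (\<lambda>x. D (x + 0 *\<^sub>R v) v)) (at 0 within U)"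
    by (rule has_vector_derivative_transform[OF _ const deriv]) (simp_all add: U_def)
  then have "((\<lambda>t. (LINT x|lebesgue. \<psi> x)) has_vector_derivative
      integral (cbox (-a) a) (\<lambda>x. D (x + 0 *\<^sub>R v) v)) (at 0)"
    unfolding U_def by (subst (asm) at_within_Icc_at) auto
  then have "integral (cbox (-a) a) (\<lambda>x. D (x + 0 *\<^sub>R v) v) = 0"
    using has_vector_derivative_const by (rule vector_derivative_unique_at)
  then show ?thesis
    using to_HK[OF _ cont D0, of 0] by (simp add: U_def)
qed

subsection \<open>Area integrals and the Cauchy-Pompeiu formula\<close>

lemma dbar_eq_has_derivative:
  assumes "(\<psi> has_derivative D) (at z)"
  shows "dbar \<psi> z = (D 1 + \<i> * D \<i>) / 2"
  using frechet_derivative_at[OF assms] by (simp add: dbar_def)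

text \<open>\<open>dbar\<close> combines the derivatives in the directions \<open>1\<close> and
  \<open>\<i>\<close>, each of integral zero. Only a continuous first derivative is asked, since the
  lemma is applied to a test function times a regularised kernel and to a holomorphic function cut
  off by a test function.\<close>

lemma integral_dbar_eq_0:
  assumes der: "\<And>z. (\<psi> has_derivative D z) (at z)"
    and cont: "continuous_on UNIV (\<lambda>z. D z 1)" "continuous_on UNIV (\<lambda>z. D z \<i>)"
    and K: "compact K" "\<And>z. z \<notin> K \<Longrightarrow> \<psi> z = 0"
  shows "integrable lebesgue (dbar \<psi>)" "(LINT z|lebesgue. dbar \<psi> z) = 0"
proof -
  have eq: "dbar \<psi> = (\<lambda>z. (D z 1 + \<i> * D z \<i>) / 2)"
    using dbar_eq_has_derivative[OF der] by auto
  have D0: "D z v = 0" if "z \<notin> K" for z v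
    using has_derivative_eq_0_outside_support[OF der K that] by simp
  have i: "integrable lebesgue (\<lambda>z. D z 1)" "integrable lebesgue (\<lambda>z. D z \<i>)"
    using cont D0 by (auto intro!: integrable_lebesgue_compact_support[OF _ K(1)])
  then show "integrable lebesgue (dbar \<psi>)"
    unfolding eq by auto
  show "(LINT z|lebesgue. dbar \<psi> z) = 0"
    unfolding eq using i integral_directional_derivative_eq_0[OF der cont(1) K]
      integral_directional_derivative_eq_0[OF der cont(2) K] by simp
qed

section \<open>Radial integrals and power singularities in the plane\<close>

lemma borel_measurable_nn_integral_radial:
  fixes k :: "real \<Rightarrow> ennreal"
  assumes [measurable]: "k \<in> borel_measurable borel"
  shows "(\<lambda>u. \<integral>\<^sup>+r. k r * indicator {norm (u::complex)<..} r \<partial>lborel) \<in> borel_measurable borel"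
proof -
  have "(\<lambda>u. \<integral>\<^sup>+r. k r * indicator {norm (u::complex)<..} r \<partial>lborel)
      = (\<lambda>u. \<integral>\<^sup>+r. (if norm u < r then k r else 0) \<partial>lborel)"
    by (intro ext nn_integral_cong) (auto simp: indicator_def)
  then show ?thesis by simp
qed

text \<open>Layer-cake substitute for polar coordinates: by Tonelli the inner integral becomes the
  area \<open>pi * r\<^sup>2\<close> of a disk. A radial function enters as the tail integral of
  minus its derivative \<open>k\<close>.\<close>

lemma nn_integral_radial:
  fixes k :: "real \<Rightarrow> ennreal"
  assumes [measurable]: "k \<in> borel_measurable borel"
  shows "(\<integral>\<^sup>+u. (\<integral>\<^sup>+r. k r * indicator {norm (u::complex)<..} r \<partial>lborel) \<partial>lborel) =
         (\<integral>\<^sup>+r. k r * ennreal (pi * r\<^sup>2) * indicator {0<..} r \<partial>lborel)"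
proof -
  have "(\<integral>\<^sup>+u. (\<integral>\<^sup>+r. k r * indicator {norm (u::complex)<..} r \<partial>lborel) \<partial>lborel) =
      (\<integral>\<^sup>+u. (\<integral>\<^sup>+r. (if norm u < r then k r else 0) \<partial>lborel) \<partial>(lborel::complex measure))"
    by (intro nn_integral_cong) (auto simp: indicator_def)
  also have "\<dots> = (\<integral>\<^sup>+r. (\<integral>\<^sup>+u. (if norm (u::complex) < r then k r else 0) \<partial>lborel) \<partial>lborel)"
    by (rule lborel_pair.Fubini') measurable
  also have "\<dots> = (\<integral>\<^sup>+r. k r * ennreal (pi * r\<^sup>2) * indicator {0<..} r \<partial>lborel)"
  proof (rule nn_integral_cong)
    fix r :: real
    have "(\<integral>\<^sup>+u. (if norm (u::complex) < r then k r else 0) \<partial>lborel)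
        = (\<integral>\<^sup>+u. k r * indicator (ball 0 r) (u::complex) \<partial>lborel)"
      by (intro nn_integral_cong) (auto simp: indicator_def)
    also have "\<dots> = k r * emeasure lborel (ball (0::complex) r)"
      by (rule nn_integral_cmult_indicator) auto
    also have "\<dots> = k r * ennreal (pi * r\<^sup>2) * indicator {0<..} r"
    proof (cases "r > 0")
      case True
      then have "emeasure lborel (ball (0::complex) r) = ennreal (pi * r\<^sup>2)"
        by (subst emeasure_ball) (auto simp: unit_ball_vol_2)
      with True show ?thesis by simp
    qed (auto simp: ball_empty)
    finally show "(\<integral>\<^sup>+u. (if norm (u::complex) < r then k r else 0) \<partial>lborel) = \<dots>" .
  qed
  finally show ?thesis .
qed

text \<open>The profile of the approximate identity that \<open>dbar\<close> of a regularised Cauchy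
  kernel produces, and its mass.\<close>

lemma integrable_area_kernel:
  shows "integrable lborel (\<lambda>u::complex. 1 / ((norm u)\<^sup>2 + 1)\<^sup>2)"
    and "(LINT u|lborel. 1 / ((norm (u::complex))\<^sup>2 + 1)\<^sup>2) = pi"
proof -
  \<comment> \<open>Minus the derivative of \<open>1 / (r\<^sup>2 + 1)\<^sup>2\<close>, so the tail
    integral from \<open>\<rho>\<close> recovers that function. Weighted with the disk area it has
    the primitive \<open>pi * r ^ 4 / (r\<^sup>2 + 1)\<^sup>2\<close>, which tends to
    \<open>pi\<close>.\<close>
  define k where "k r = ennreal (if r > 0 then 4 * r / (r\<^sup>2 + 1)^3 else 0)" for r :: real
  have pos: "(r::real)\<^sup>2 + 1 > 0" for r
    by (smt (verit) zero_le_power2)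
  have [measurable]: "k \<in> borel_measurable borel"
    unfolding k_def by measurable
  have inner: "(\<integral>\<^sup>+r. k r * indicator {\<rho><..} r \<partial>lborel) = ennreal (1 / (\<rho>\<^sup>2 + 1)\<^sup>2)" if "\<rho> \<ge> 0" for \<rho> :: real
  proof -
    have "(\<integral>\<^sup>+r. k r * indicator {\<rho><..} r \<partial>lborel) =
      (\<integral>\<^sup>+r. ennreal (4 * r / (r\<^sup>2 + 1)^3) * indicator {\<rho>..} r \<partial>lborel)"
      by (intro nn_integral_cong_AE, use AE_lborel_singleton[of \<rho>] in eventually_elim)
        (use that in \<open>auto simp: indicator_def k_def\<close>)
    also have "\<dots> = ennreal (0 - (- (1 / (\<rho>\<^sup>2 + 1)\<^sup>2)))"
    proof (rule nn_integral_FTC_atLeast)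
      show "((\<lambda>r. - (1 / (r\<^sup>2 + 1)\<^sup>2)) has_real_derivative 4 * r / (r\<^sup>2 + 1) ^ 3) (at r)" for r :: real
        using pos[of r]
        by (auto intro!: derivative_eq_intros simp: frac_eq_eq simp del: power_one_right) algebra
      show "((\<lambda>r::real. - (1 / (r\<^sup>2 + 1)\<^sup>2)) \<longlongrightarrow> 0) at_top"
        by real_asymp
    qed (use that in auto)
    finally show ?thesis by simp
  qed
  have "(\<integral>\<^sup>+u. ennreal (1 / ((norm (u::complex))\<^sup>2 + 1)\<^sup>2) \<partial>lborel)
      = (\<integral>\<^sup>+u. (\<integral>\<^sup>+r. k r * indicator {norm (u::complex)<..} r \<partial>lborel) \<partial>lborel)"
    by (intro nn_integral_cong) (simp add: inner)
  also have "\<dots> = (\<integral>\<^sup>+r. k r * ennreal (pi * r\<^sup>2) * indicator {0<..} r \<partial>lborel)"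
    by (rule nn_integral_radial) measurable
  also have "\<dots> = (\<integral>\<^sup>+r. ennreal (4 * pi * r ^ 3 / (r\<^sup>2 + 1)^3) * indicator {0..} r \<partial>lborel)"
    by (intro nn_integral_cong)
      (auto simp: indicator_def k_def ennreal_mult[symmetric] power2_eq_square power3_eq_cube algebra_simps)
  also have "\<dots> = ennreal (pi - pi * 0 ^ 4 / (0\<^sup>2 + 1)\<^sup>2)"
  proof (rule nn_integral_FTC_atLeast)
    show "((\<lambda>r. pi * r ^ 4 / (r\<^sup>2 + 1)\<^sup>2) has_real_derivative 4 * pi * r ^ 3 / (r\<^sup>2 + 1) ^ 3) (at r)" for r :: real
      using pos[of r] by (auto intro!: derivative_eq_intros simp: divide_simps)
        algebra
    show "((\<lambda>r::real. pi * r ^ 4 / (r\<^sup>2 + 1)\<^sup>2) \<longlongrightarrow> pi) at_top"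
      by real_asymp
  qed auto
  finally have *: "(\<integral>\<^sup>+u. ennreal (1 / ((norm (u::complex))\<^sup>2 + 1)\<^sup>2) \<partial>lborel) = ennreal pi"
    by simp
  show "integrable lborel (\<lambda>u::complex. 1 / ((norm u)\<^sup>2 + 1)\<^sup>2)"
    by (rule integrableI_nonneg) (auto simp: *)
  show "(LINT u|lborel. 1 / ((norm (u::complex))\<^sup>2 + 1)\<^sup>2) = pi"
    by (subst integral_eq_nn_integral) (auto simp: *)
qed

lemma nn_integral_norm_powr_ball:
  assumes "0 < s" "s < 2"
  shows "(\<integral>\<^sup>+u. ennreal (norm u powr (- s)) * indicator (ball 0 1) (u::complex) \<partial>lborel) < \<infinity>"
proof -
  \<comment> \<open>Minus the derivative of \<open>r powr (- s)\<close>, cut off at 1. Its tail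
    integral is \<open>\<rho> powr (- s) - 1\<close>, and the missing 1 is supplied by the indicator
    of the disk. After weighting with the disk area, \<open>r powr (1 - s)\<close> remains up to a
    constant, integrable at 0 because \<open>s < 2\<close>.\<close>
  define k where "k r = ennreal (if 0 < r \<and> r < 1 then s * r powr (- s - 1) else 0)" for r :: real
  have [measurable]: "k \<in> borel_measurable borel"
    unfolding k_def by measurable
  have inner: "(\<integral>\<^sup>+r. k r * indicator {\<rho><..} r \<partial>lborel) = ennreal (\<rho> powr (- s) - 1)" if "0 < \<rho>" "\<rho> < 1" for \<rho> :: real
  proof -
    have "(\<integral>\<^sup>+r. k r * indicator {\<rho><..} r \<partial>lborel) =
      (\<integral>\<^sup>+r. ennreal (s * r powr (- s - 1)) * indicator {\<rho>..1} r \<partial>lborel)"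
      by (intro nn_integral_cong_AE, use AE_lborel_singleton[of \<rho>] AE_lborel_singleton[of 1] in eventually_elim)
        (use that in \<open>auto simp: indicator_def k_def\<close>)
    also have "\<dots> = ennreal ((- (1 powr (- s))) - (- (\<rho> powr (- s))))"
      by (rule nn_integral_FTC_Icc)
       (use that assms in \<open>auto intro!: derivative_eq_intros simp: divide_simps powr_diff\<close>)
    finally show ?thesis by simp
  qed
  have "(\<integral>\<^sup>+u. ennreal (norm u powr (- s)) * indicator (ball 0 1) (u::complex) \<partial>lborel)
      = (\<integral>\<^sup>+u. (indicator (ball 0 1) u + (\<integral>\<^sup>+r. k r * indicator {norm (u::complex)<..} r \<partial>lborel)) \<partial>lborel)"
  proof (intro nn_integral_cong_AE, use AE_lborel_singleton[of "0::complex"] in eventually_elim)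
    fix u :: complex assume "u \<noteq> 0"
    show "ennreal (norm u powr (- s)) * indicator (ball 0 1) u
      = indicator (ball 0 1) u + (\<integral>\<^sup>+r. k r * indicator {norm u<..} r \<partial>lborel)"
    proof (cases "norm u < 1")
      case True
      have "norm u powr (- s) \<ge> 1"
        using True \<open>u \<noteq> 0\<close> assms powr_mono2'[of "-s" "norm u" 1] by simp
      then have "1 + ennreal (norm u powr (- s) - 1) = ennreal (norm u powr (- s))"
        using ennreal_plus[of 1 "norm u powr (- s) - 1"] by simp
      then show ?thesis
        using True \<open>u \<noteq> 0\<close> inner[of "norm u"] by simp
    next
      case False
      then have "(\<lambda>r. k r * indicator {norm u<..} r) = (\<lambda>_. 0)"
        by (auto simp: indicator_def k_def)
      with False show ?thesis by simp
    qed
  qed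
  also have "\<dots> = (\<integral>\<^sup>+u. indicator (ball 0 1) (u::complex) \<partial>lborel)
     + (\<integral>\<^sup>+u. (\<integral>\<^sup>+r. k r * indicator {norm (u::complex)<..} r \<partial>lborel) \<partial>lborel)"
    by (rule nn_integral_add) (auto intro!: borel_measurable_nn_integral_radial borel_measurable_indicator)
  also have "\<dots> < \<infinity>"
  proof -
    have "(\<integral>\<^sup>+u. (\<integral>\<^sup>+r. k r * indicator {norm (u::complex)<..} r \<partial>lborel) \<partial>lborel)
      = (\<integral>\<^sup>+r. k r * ennreal (pi * r\<^sup>2) * indicator {0<..} r \<partial>lborel)"
      by (rule nn_integral_radial) measurable
    also have "\<dots> \<le> (\<integral>\<^sup>+r. ennreal (pi * s) * ennreal (r powr (1 - s) * indicator {0..1} r) \<partial>lborel)"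
    proof (rule nn_integral_mono)
      fix r :: real
      have "s * r powr (- s - 1) * (pi * r\<^sup>2) = pi * s * r powr (1 - s)" if "r > 0"
        using that by (simp add: powr_diff powr_minus field_simps power2_eq_square)
      then show "k r * ennreal (pi * r\<^sup>2) * indicator {0<..} r
        \<le> ennreal (pi * s) * ennreal (r powr (1 - s) * indicator {0..1} r)"
        using assms by (auto simp: indicator_def k_def ennreal_mult[symmetric])
    qed
    also have "\<dots> = ennreal (pi * s) * (\<integral>\<^sup>+r. ennreal (r powr (1 - s) * indicator {0..1} r) \<partial>lborel)"
      by (rule nn_integral_cmult) measurable
    also have "(\<integral>\<^sup>+r. ennreal (r powr (1 - s) * indicator {0..1} r) \<partial>lborel) = ennreal (1 powr (1 - s + 1) / (1 - s + 1))"
      using nn_integral_has_integral_lebesgue[OF _ has_integral_powr_from_0[of "1 - s" 1]] assms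
      by (simp add: mult.commute)
    finally show ?thesis
      by (auto simp: ennreal_mult_less_top less_top[symmetric] top_unique ennreal_mult_eq_top_iff emeasure_ball)
  qed
  finally show ?thesis .
qed

lemma nn_integral_lborel_translation:
  fixes f :: "'a::euclidean_space \<Rightarrow> ennreal"
  assumes "f \<in> borel_measurable borel"
  shows "(\<integral>\<^sup>+x. f (c + x) \<partial>lborel) = (\<integral>\<^sup>+x. f x \<partial>lborel)"
  using nn_integral_distr[of "(+) c" lborel borel f] assms by (simp add: lborel_distr_plus)

text \<open>Within distance 1 of \<open>z\<close> the kernel is a translate of the singularity at 0,
  elsewhere it is at most 1 on a disk of finite area. Both bounds are independent of
  \<open>z\<close>, and this uniformity is what the later estimates use.\<close>

lemma integral_norm_powr_bound:
  fixes R s :: real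
  assumes "0 < s" "s < 2"
  obtains C where "\<And>z::complex. set_integrable lebesgue (cball 0 R) (\<lambda>\<zeta>. norm (\<zeta> - z) powr (- s))"
    "\<And>z::complex. (LINT \<zeta>:cball 0 R|lebesgue. norm (\<zeta> - z) powr (- s)) \<le> C"
proof -
  define A where "A = emeasure lborel (cball (0::complex) R)
    + (\<integral>\<^sup>+u. ennreal (norm u powr (- s)) * indicator (ball 0 1) (u::complex) \<partial>lborel)"
  have "A < \<infinity>"
    using nn_integral_norm_powr_ball[OF assms] emeasure_bounded_finite[OF bounded_cball, of "0::complex" R]
    unfolding A_def by simp
  let ?f = "\<lambda>z \<zeta>. indicat_real (cball 0 R) \<zeta> *\<^sub>R (norm (\<zeta> - (z::complex)) powr (- s))"
  have fm: "?f z \<in> borel_measurable lborel" for z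
    unfolding measurable_lborel2 by (intro borel_measurable_scaleR borel_measurable_indicator powr_real_measurable) auto
  have bound: "(\<integral>\<^sup>+\<zeta>. ennreal (?f z \<zeta>) \<partial>lborel) \<le> A" for z
  proof -
    let ?g = "\<lambda>u. ennreal (norm u powr (- s)) * indicator (ball 0 1) (u::complex)"
    have g: "?g \<in> borel_measurable borel"
      by (intro borel_measurable_times_ennreal borel_measurable_indicator) auto
    have g': "(\<lambda>\<zeta>. ?g (- z + \<zeta>)) \<in> borel_measurable lborel"
      using measurable_compose[OF _ g, of "(+) (- z)" lborel] by simp
    have "ennreal (?f z \<zeta>) \<le> indicator (cball 0 R) \<zeta> + ?g (- z + \<zeta>)" for \<zeta>
    proof (cases "norm (\<zeta> - z) < 1")
      case True
      then show ?thesis by (auto simp: indicator_def)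
    next
      case False
      then have "norm (\<zeta> - z) powr (- s) \<le> 1"
        using powr_mono2'[of "-s" 1 "norm (\<zeta> - z)"] assms by simp
      then show ?thesis by (auto simp: indicator_def add_increasing2)
    qed
    then have "(\<integral>\<^sup>+\<zeta>. ennreal (?f z \<zeta>) \<partial>lborel)
        \<le> (\<integral>\<^sup>+\<zeta>. indicator (cball 0 R) \<zeta> + ?g (- z + \<zeta>) \<partial>lborel)"
      by (intro nn_integral_mono)
    also have "\<dots> = (\<integral>\<^sup>+\<zeta>. indicator (cball 0 R) (\<zeta>::complex) \<partial>lborel) + (\<integral>\<^sup>+\<zeta>. ?g (- z + \<zeta>) \<partial>lborel)"
      by (rule nn_integral_add[OF _ g']) (auto intro!: borel_measurable_indicator)
    also have "(\<integral>\<^sup>+\<zeta>. ?g (- z + \<zeta>) \<partial>lborel) = (\<integral>\<^sup>+\<zeta>. ?g \<zeta> \<partial>lborel)"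
      by (rule nn_integral_lborel_translation[OF g])
    finally show ?thesis
      unfolding A_def by simp
  qed
  have int: "integrable lborel (?f z)" for z
    by (rule integrableI_nonneg[OF fm]) (use bound[of z] \<open>A < \<infinity>\<close> in \<open>auto intro: le_less_trans\<close>)
  show ?thesis
  proof (rule that[of "enn2real A"])
    show "set_integrable lebesgue (cball 0 R) (\<lambda>\<zeta>. norm (\<zeta> - z) powr (- s))" for z :: complex
      unfolding set_integrable_def integrable_completion[OF fm] by (rule int)
    have "ennreal (LINT \<zeta>|lborel. ?f z \<zeta>) = (\<integral>\<^sup>+\<zeta>. ennreal (?f z \<zeta>) \<partial>lborel)" for z
      using int[of z] by (intro nn_integral_eq_integral[symmetric]) auto
    then have "(LINT \<zeta>|lborel. ?f z \<zeta>) = enn2real (\<integral>\<^sup>+\<zeta>. ennreal (?f z \<zeta>) \<partial>lborel)" for z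
      by (metis (no_types, lifting) Bochner_Integration.integral_nonneg enn2real_ennreal
          indicator_pos_le mult_nonneg_nonneg powr_ge_zero real_scaleR_def)
    then have "(LINT \<zeta>|lborel. ?f z \<zeta>) \<le> enn2real A" for z
      using bound[of z] \<open>A < \<infinity>\<close> by (simp add: enn2real_mono)
    then show "(LINT \<zeta>:cball 0 R|lebesgue. norm (\<zeta> - z) powr (- s)) \<le> enn2real A" for z :: complex
      unfolding set_lebesgue_integral_def integral_completion[OF fm] .
  qed
qed

section \<open>Approximate identity and the Cauchy-Pompeiu formula\<close>

lemma lborel_integral_affine:
  fixes f :: "'a::euclidean_space \<Rightarrow> 'b::euclidean_space"
  assumes [measurable]: "f \<in> borel_measurable borel" and "c \<noteq> 0"
  shows "(LINT x|lborel. f x) = (LINT x|lborel. \<bar>c\<bar> ^ DIM('a) *\<^sub>R f (t + c *\<^sub>R x))"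
proof -
  have "(LINT x|lborel. f x) = (LINT x|density (distr lborel borel (\<lambda>x. t + c *\<^sub>R x)) (\<lambda>_. \<bar>c\<bar> ^ DIM('a)). f x)"
    using lborel_affine[OF assms(2), of t] by simp
  also have "\<dots> = (LINT x|distr lborel borel (\<lambda>x. t + c *\<^sub>R x). \<bar>c\<bar> ^ DIM('a) *\<^sub>R f x)"
    by (rule integral_density) auto
  also have "\<dots> = (LINT x|lborel. \<bar>c\<bar> ^ DIM('a) *\<^sub>R f (t + c *\<^sub>R x))"
    by (rule integral_distr) auto
  finally show ?thesis .
qed

text \<open>The substitution \<open>z = \<zeta> + d n *\<^sub>R v\<close> turns the kernel into the
  fixed profile \<open>?k\<close> of mass \<open>pi\<close>, the Jacobian
  \<open>(d n)\<^sup>2\<close> cancelling the scaling. Boundedness of \<open>\<phi>\<close> then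
  gives the majorant \<open>B * ?k\<close> for dominated convergence.\<close>

lemma area_kernel_approximate_identity:
  fixes \<phi> :: "complex \<Rightarrow> complex"
  assumes cont: "continuous_on UNIV \<phi>" and bd: "\<And>z. norm (\<phi> z) \<le> B"
    and d: "d \<longlonglongrightarrow> 0" "\<And>n. d n > (0::real)"
  shows "(\<lambda>n. LINT z|lebesgue. \<phi> z * of_real ((d n)\<^sup>2 / ((norm (z - \<zeta>))\<^sup>2 + (d n)\<^sup>2)\<^sup>2))
           \<longlonglongrightarrow> of_real pi * \<phi> \<zeta>"
proof -
  have [measurable]: "\<phi> \<in> borel_measurable borel"
    using borel_measurable_continuous_onI[OF cont] .
  have B: "B \<ge> 0"
    using bd[of 0] norm_ge_zero order_trans by blast
  let ?k = "\<lambda>v::complex. 1 / ((norm v)\<^sup>2 + 1)\<^sup>2"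
  have "(LINT z|lebesgue. \<phi> z * of_real ((d n)\<^sup>2 / ((norm (z - \<zeta>))\<^sup>2 + (d n)\<^sup>2)\<^sup>2))
     = (LINT v|lborel. \<phi> (\<zeta> + d n *\<^sub>R v) * of_real (?k v))" for n
  proof -
    have "(LINT z|lebesgue. \<phi> z * of_real ((d n)\<^sup>2 / ((norm (z - \<zeta>))\<^sup>2 + (d n)\<^sup>2)\<^sup>2))
      = (LINT z|lborel. \<phi> z * of_real ((d n)\<^sup>2 / ((norm (z - \<zeta>))\<^sup>2 + (d n)\<^sup>2)\<^sup>2))"
      by (rule integral_completion) measurable
    also have "\<dots> = (LINT v|lborel. \<bar>d n\<bar> ^ DIM(complex) *\<^sub>R (\<phi> (\<zeta> + d n *\<^sub>R v)
        * of_real ((d n)\<^sup>2 / ((norm (\<zeta> + d n *\<^sub>R v - \<zeta>))\<^sup>2 + (d n)\<^sup>2)\<^sup>2)))"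
      by (rule lborel_integral_affine) (use d(2)[of n] in auto)
    also have "\<dots> = (LINT v|lborel. \<phi> (\<zeta> + d n *\<^sub>R v) * of_real (?k v))"
    proof (rule Bochner_Integration.integral_cong[OF refl])
      fix v :: complex
      have "(d n)\<^sup>2 * ((d n)\<^sup>2 / ((norm (\<zeta> + d n *\<^sub>R v - \<zeta>))\<^sup>2 + (d n)\<^sup>2)\<^sup>2) = ?k v"
      proof -
        have "(norm (\<zeta> + d n *\<^sub>R v - \<zeta>))\<^sup>2 + (d n)\<^sup>2 = (d n)\<^sup>2 * ((norm v)\<^sup>2 + 1)"
          by (simp add: power_mult_distrib algebra_simps)
        then show ?thesis
          using d(2)[of n] by (simp add: power_mult_distrib power2_eq_square)
      qed
      then show "\<bar>d n\<bar> ^ DIM(complex) *\<^sub>R (\<phi> (\<zeta> + d n *\<^sub>R v)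
        * of_real ((d n)\<^sup>2 / ((norm (\<zeta> + d n *\<^sub>R v - \<zeta>))\<^sup>2 + (d n)\<^sup>2)\<^sup>2)) = \<phi> (\<zeta> + d n *\<^sub>R v) * of_real (?k v)"
        unfolding DIM_complex power2_abs scaleR_conv_of_real
        by (subst mult.left_commute) (simp only: of_real_mult[symmetric])
    qed
    finally show ?thesis .
  qed
  moreover have "(\<lambda>n. LINT v|lborel. \<phi> (\<zeta> + d n *\<^sub>R v) * of_real (?k v))
      \<longlonglongrightarrow> (LINT v|lborel. \<phi> \<zeta> * of_real (?k v))"
  proof (rule integral_dominated_convergence[where w="\<lambda>v. B * ?k v"])
    show "integrable lborel (\<lambda>v. B * ?k v)"
      using integrable_area_kernel(1) by (rule integrable_mult_right)
    have "(\<lambda>n. \<phi> (\<zeta> + d n *\<^sub>R v)) \<longlonglongrightarrow> \<phi> \<zeta>" for v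
    proof -
      have "(\<lambda>n. \<zeta> + d n *\<^sub>R v) \<longlonglongrightarrow> \<zeta> + 0 *\<^sub>R v"
        by (intro tendsto_intros d)
      then show ?thesis
        using cont by (intro isCont_tendsto_compose[of _ \<phi>]) (auto simp: continuous_on_eq_continuous_at)
    qed
    then show "AE v in lborel. (\<lambda>n. \<phi> (\<zeta> + d n *\<^sub>R v) * of_real (?k v)) \<longlonglongrightarrow> \<phi> \<zeta> * of_real (?k v)"
      by (intro AE_I2 tendsto_mult tendsto_const)
    show "AE v in lborel. norm (\<phi> (\<zeta> + d n *\<^sub>R v) * of_real (?k v)) \<le> B * ?k v" for n
    proof (rule AE_I2)
      fix v
      show "norm (\<phi> (\<zeta> + d n *\<^sub>R v) * of_real (?k v)) \<le> B * ?k v"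
        unfolding norm_mult using bd by (intro mult_mono) (auto simp: B norm_of_real simp del: of_real_divide)
    qed
  qed measurable
  moreover have "(LINT v|lborel. \<phi> \<zeta> * complex_of_real (?k v)) = of_real pi * \<phi> \<zeta>"
    using integrable_area_kernel by (simp add: mult.commute integral_complex_of_real del: of_real_divide)
  ultimately show ?thesis
    by simp
qed

text \<open>The Cauchy kernel \<open>1/u\<close> is approximated by the smooth kernels \<open>cnj u / (|u|\<^sup>2 + d\<^sup>2)\<close>, whose
  derivatives \<open>dbar\<close> form an approximate identity of mass \<open>pi\<close>.\<close>

lemma Cauchy_Pompeiu_test_function:
  assumes \<phi>: "\<phi> \<in> test_functions (UNIV :: complex set)"
  shows "integrable lebesgue (\<lambda>z. dbar \<phi> z / (\<zeta> - z))"
    and "(LINT z|lebesgue. dbar \<phi> z / (\<zeta> - z)) = of_real pi * \<phi> \<zeta>"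
proof -
  obtain K where K: "compact K" "\<And>x. x \<notin> K \<Longrightarrow> \<phi> x = 0"
    using \<phi> by (auto simp: test_functions_def)
  have d\<phi>: "dbar \<phi> \<in> test_functions UNIV"
    by (rule test_functions_dbar[OF \<phi>])
  obtain K' where K': "compact K'" "\<And>x. x \<notin> K' \<Longrightarrow> dbar \<phi> x = 0"
    using d\<phi> by (auto simp: test_functions_def)
  obtain B where B: "B > 0" "\<And>x. norm (\<phi> x) \<le> B"
    using bounded_compact_support[OF test_functions_continuous_on[OF \<phi>] K] by blast
  obtain B' where B': "B' > 0" "\<And>x. norm (dbar \<phi> x) \<le> B'"
    using bounded_compact_support[OF test_functions_continuous_on[OF d\<phi>] K'] by blast
  obtain R where R: "K' \<subseteq> cball 0 R"
    using bounded_subset_ballD[OF compact_imp_bounded[OF K'(1)], of 0] ball_subset_cball by blast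
  have [measurable]: "dbar \<phi> \<in> borel_measurable borel" "\<phi> \<in> borel_measurable borel"
    using borel_measurable_continuous_onI test_functions_continuous_on \<phi> d\<phi> by blast+
  \<comment> \<open>One majorant for all regularised kernels, since each of them is bounded by the
    Cauchy kernel in modulus.\<close>
  define w where "w z = B' * (indicat_real (cball 0 R) z *\<^sub>R norm (z - \<zeta>) powr (- 1))" for z
  have w: "integrable lebesgue w"
    using integral_norm_powr_bound[of 1 R] unfolding w_def set_integrable_def
    by (metis integrable_mult_right one_less_numeral_iff semiring_norm(76) zero_less_one)
  have dom: "norm (dbar \<phi> z / (\<zeta> - z)) \<le> w z" for z
  proof (cases "z \<in> K'")
    case True
    then have "z \<in> cball 0 R" using R by blast
    then have "w z = B' * norm (z - \<zeta>) powr (- 1)"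
      unfolding w_def by simp
    also have "\<dots> = B' / norm (\<zeta> - z)"
      by (cases "z = \<zeta>") (auto simp: powr_minus divide_inverse norm_minus_commute)
    finally show ?thesis
      using B' by (simp add: norm_divide divide_right_mono)
  next
    case False
    then show ?thesis using K' B' by (simp add: w_def)
  qed
  show "integrable lebesgue (\<lambda>z. dbar \<phi> z / (\<zeta> - z))"
    by (rule Bochner_Integration.integrable_bound[OF w])
      (use dom in \<open>auto intro!: measurable_completion order_trans[OF _ abs_ge_self]\<close>)
  define d where "d n = 1 / real (Suc n)" for n
  have d: "d \<longlonglongrightarrow> 0" "\<And>n. d n > 0"
    unfolding d_def using LIMSEQ_Suc[OF lim_1_over_n] by auto
  define k where "k n z = cnj (z - \<zeta>) / of_real ((norm (z - \<zeta>))\<^sup>2 + (d n)\<^sup>2)" for n z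
  define m where "m n z = (d n)\<^sup>2 / ((norm (z - \<zeta>))\<^sup>2 + (d n)\<^sup>2)\<^sup>2" for n z
  have pos: "(norm (z - \<zeta>))\<^sup>2 + (d n)\<^sup>2 > 0" for n z
    using d(2)[of n] by (smt (verit) zero_le_power2 zero_less_power)
  \<comment> \<open>Integration by parts: \<open>\<phi> * k n\<close> is continuously differentiable
    with compact support, so its \<open>dbar\<close> has integral zero, and the product rule splits
    this into two terms.\<close>
  have green: "integrable lebesgue (\<lambda>z. dbar \<phi> z * k n z)"
    "integrable lebesgue (\<lambda>z. \<phi> z * of_real (m n z))"
    "(LINT z|lebesgue. dbar \<phi> z * k n z) = - (LINT z|lebesgue. \<phi> z * of_real (m n z))" for n
  proof -
    \<comment> \<open>The denominator of \<open>k n\<close>, written as a polynomial in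
      \<open>z\<close> and \<open>cnj z\<close> so that the derivative rules apply.\<close>
    let ?N = "\<lambda>z. (z - \<zeta>) * cnj (z - \<zeta>) + of_real ((d n)\<^sup>2)"
    have N: "?N z = of_real ((norm (z - \<zeta>))\<^sup>2 + (d n)\<^sup>2)" for z
      using complex_norm_square[of "z - \<zeta>"] by simp
    have N0: "?N z \<noteq> 0" for z
      unfolding N of_real_eq_0_iff using pos[of z n] d(2)[of n] by simp
    have keq: "k n = (\<lambda>z. cnj (z - \<zeta>) / ?N z)"
      unfolding k_def N by simp
    define E where "E z v = (cnj v * ?N z - cnj (z - \<zeta>) * (v * cnj (z - \<zeta>) + (z - \<zeta>) * cnj v)) / (?N z * ?N z)" for z v
    have kd: "(k n has_derivative E z) (at z)" for z
    proof -
      have "((\<lambda>z. cnj (z - \<zeta>)) has_derivative (\<lambda>v. cnj v)) (at z)"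
        by (auto intro!: derivative_eq_intros)
      moreover have "(?N has_derivative (\<lambda>v. v * cnj (z - \<zeta>) + (z - \<zeta>) * cnj v)) (at z)"
        by (auto intro!: derivative_eq_intros simp: fun_eq_iff algebra_simps)
      ultimately show ?thesis
        unfolding keq E_def using N0[of z] by (rule has_derivative_divide')
    qed
    define D where "D z v = \<phi> z * E z v + frechet_derivative \<phi> (at z) v * k n z" for z v
    have der: "((\<lambda>z. \<phi> z * k n z) has_derivative D z) (at z)" for z
      unfolding D_def by (rule has_derivative_mult[OF test_functions_has_derivative[OF \<phi>] kd])
    have ck: "continuous_on UNIV (k n)"
      unfolding keq by (intro continuous_intros ballI N0)
    have cD: "continuous_on UNIV (\<lambda>z. D z v)" for v
      unfolding D_def E_def
      by (intro continuous_intros ck test_functions_continuous_on[OF \<phi>]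
          test_functions_continuous_on[OF test_functions_frechet_derivative[OF \<phi>]] ballI no_zero_divisors N0)
    have db: "dbar (\<lambda>z. \<phi> z * k n z) z = dbar \<phi> z * k n z + \<phi> z * of_real (m n z)" for z
    proof -
      \<comment> \<open>\<open>dbar\<close> annihilates \<open>z\<close> and sends
        \<open>cnj z\<close> to 1. So for \<open>u = z - \<zeta>\<close> the quotient rule leaves
        the numerator \<open>?N z - u * cnj u\<close>, which is
        \<open>(d n)\<^sup>2\<close>.\<close>
      have "(E z 1 + \<i> * E z \<i>) / 2 = (?N z - (z - \<zeta>) * cnj (z - \<zeta>)) / (?N z * ?N z)"
        unfolding E_def using N0[of z] by (simp add: divide_simps) (simp add: algebra_simps)
      also have "\<dots> = of_real (m n z)"
      proof -
        have "of_real (m n z) = of_real ((d n)\<^sup>2) / (?N z)\<^sup>2"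
          unfolding m_def N by simp
        then show ?thesis
          by (simp only: add_diff_cancel_left' power2_eq_square[of "?N z"])
      qed
      finally have E: "(E z 1 + \<i> * E z \<i>) / 2 = of_real (m n z)" .
      have "dbar (\<lambda>z. \<phi> z * k n z) z = dbar \<phi> z * k n z + \<phi> z * ((E z 1 + \<i> * E z \<i>) / 2)"
        unfolding dbar_eq_has_derivative[OF der] D_def dbar_def by (simp add: algebra_simps add_divide_distrib)
      then show ?thesis unfolding E .
    qed
    have cm: "continuous_on UNIV (\<lambda>z. m n z)"
      unfolding m_def by (intro continuous_intros) (use pos d(2)[of n] in \<open>auto simp: less_imp_neq[THEN not_sym]\<close>)
    show 1: "integrable lebesgue (\<lambda>z. dbar \<phi> z * k n z)"
      by (rule integrable_lebesgue_compact_support[OF _ K'(1)])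
        (use K' ck test_functions_continuous_on[OF d\<phi>] in \<open>auto intro!: continuous_intros\<close>)
    show 2: "integrable lebesgue (\<lambda>z. \<phi> z * of_real (m n z))"
      by (rule integrable_lebesgue_compact_support[OF _ K(1)])
        (use K cm test_functions_continuous_on[OF \<phi>] in \<open>auto intro!: continuous_intros\<close>)
    have "(LINT z|lebesgue. dbar (\<lambda>z. \<phi> z * k n z) z) = 0"
      by (rule integral_dbar_eq_0(2)[OF der cD cD K(1)]) (simp add: K)
    then show "(LINT z|lebesgue. dbar \<phi> z * k n z) = - (LINT z|lebesgue. \<phi> z * of_real (m n z))"
      unfolding db using 1 2 by (simp add: eq_neg_iff_add_eq_0)
  qed
  \<comment> \<open>\<open>k n\<close> approximates \<open>1 / (z - \<zeta>)\<close>, the negative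
    of the kernel in the claim; this minus sign cancels the one from the integration by
    parts.\<close>
  have "(\<lambda>n. LINT z|lebesgue. dbar \<phi> z * k n z) \<longlonglongrightarrow> - (of_real pi * \<phi> \<zeta>)"
    unfolding green(3) m_def
    using area_kernel_approximate_identity[OF test_functions_continuous_on[OF \<phi>] B(2) d, of \<zeta>]
    by (rule tendsto_minus)
  moreover have "(\<lambda>n. LINT z|lebesgue. dbar \<phi> z * k n z) \<longlonglongrightarrow> (LINT z|lebesgue. - (dbar \<phi> z / (\<zeta> - z)))"
  proof (rule integral_dominated_convergence[where w=w])
    show "(\<lambda>z. - (dbar \<phi> z / (\<zeta> - z))) \<in> borel_measurable lebesgue"
      by (rule measurable_completion) measurable
    show "(\<lambda>z. dbar \<phi> z * k n z) \<in> borel_measurable lebesgue" for n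
      using green(1)[of n] by (rule borel_measurable_integrable)
    show "AE z in lebesgue. norm (dbar \<phi> z * k n z) \<le> w z" for n
    proof (rule AE_I2)
      fix z
      have "norm (k n z) \<le> 1 / norm (\<zeta> - z)" if "z \<noteq> \<zeta>"
      proof -
        have "norm (k n z) = norm (z - \<zeta>) / ((norm (z - \<zeta>))\<^sup>2 + (d n)\<^sup>2)"
          unfolding k_def norm_divide norm_of_real complex_mod_cnj using pos[of z n] by (simp only: abs_of_pos)
        also have "\<dots> \<le> norm (z - \<zeta>) / (norm (z - \<zeta>))\<^sup>2"
          by (rule divide_left_mono) (use that pos[of z n] in auto)
        finally show ?thesis using that[symmetric] by (simp add: power2_eq_square norm_minus_commute)
      qed
      moreover have "k n \<zeta> = 0"
        by (simp add: k_def)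
      ultimately have "norm (k n z) \<le> 1 / norm (\<zeta> - z)"
        by (cases "z = \<zeta>") auto
      then have "norm (dbar \<phi> z * k n z) \<le> norm (dbar \<phi> z / (\<zeta> - z))"
        unfolding norm_mult norm_divide using mult_left_mono[of "norm (k n z)" _ "norm (dbar \<phi> z)"] by fastforce
      then show "norm (dbar \<phi> z * k n z) \<le> w z"
        using dom order_trans by blast
    qed
    have "(\<lambda>n. dbar \<phi> z * k n z) \<longlonglongrightarrow> - (dbar \<phi> z / (\<zeta> - z))" if "z \<noteq> \<zeta>" for z
    proof -
      have "(\<lambda>n. k n z) \<longlonglongrightarrow> cnj (z - \<zeta>) / of_real ((norm (z - \<zeta>))\<^sup>2 + 0\<^sup>2)"
        unfolding k_def by (intro tendsto_intros d) (use that in auto)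
      also have "cnj (z - \<zeta>) / of_real ((norm (z - \<zeta>))\<^sup>2 + 0\<^sup>2) = - (1 / (\<zeta> - z))"
        using that complex_norm_square[of "z - \<zeta>"] by (simp add: field_simps)
      finally have "(\<lambda>n. dbar \<phi> z * k n z) \<longlonglongrightarrow> dbar \<phi> z * - (1 / (\<zeta> - z))"
        by (intro tendsto_mult tendsto_const)
      then show ?thesis by simp
    qed
    moreover have "AE z in lebesgue. z \<noteq> \<zeta>"
      using AE_lborel_singleton[of \<zeta>] by (rule AE_completion)
    ultimately show "AE z in lebesgue. (\<lambda>n. dbar \<phi> z * k n z) \<longlonglongrightarrow> - (dbar \<phi> z / (\<zeta> - z))"
      by (auto elim: eventually_mono)
  qed (rule w)
  ultimately show "(LINT z|lebesgue. dbar \<phi> z / (\<zeta> - z)) = of_real pi * \<phi> \<zeta>"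
    using LIMSEQ_unique by force
qed

subsection \<open>Poisson integrals of holomorphic functions\<close>

lemma poisson_kernel_integral:
  assumes "Im z > 0"
  shows "integrable lebesgue (\<lambda>t. poisson_P (Re z - t) (Im z))"
    and "(LINT t|lebesgue. poisson_P (Re z - t) (Im z)) = pi"
proof -
  let ?y = "Im z" and ?P = "\<lambda>t. poisson_P (Re z - t) (Im z)"
  have i: "integrable lborel (\<lambda>v::real. inverse (1 + v\<^sup>2))" "(LINT v|lborel. inverse (1 + v\<^sup>2)) = pi"
    using integrable_inverse_1_plus_square LBINT_inverse_1_plus_square
    by (simp_all add: set_integrable_def interval_lebesgue_integral_def set_lebesgue_integral_def)
  have m: "?P \<in> borel_measurable lborel"
    unfolding poisson_P_def by measurable
  have eq: "?y * ?P (Re z + ?y * v) = inverse (1 + v\<^sup>2)" for v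
  proof -
    have "(Re z - (Re z + ?y * v))\<^sup>2 + ?y\<^sup>2 = ?y * (?y * (1 + v\<^sup>2))"
      by (simp add: power2_eq_square algebra_simps)
    then show ?thesis
      using assms by (simp add: poisson_P_def inverse_eq_divide)
  qed
  have "integrable lborel (\<lambda>v. ?y * ?P (Re z + ?y * v))"
    unfolding eq by (rule i)
  then have "integrable lborel (\<lambda>v. ?P (Re z + ?y * v))"
    using assms by (simp add: integrable_mult_left_iff)
  then have j: "integrable lborel ?P"
    using lborel_integrable_real_affine_iff[of ?y ?P "Re z"] assms by simp
  then show "integrable lebesgue ?P"
    using integrable_completion[OF m] by simp
  have "(LINT t|lborel. ?P t) = (LINT v|lborel. ?y * ?P (Re z + ?y * v))"
    using lborel_integral_affine[of ?P ?y "Re z"] assms m by simp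
  also have "\<dots> = pi"
    unfolding eq by (rule i)
  finally show "(LINT t|lebesgue. ?P t) = pi"
    using integral_completion[OF m] by simp
qed

text \<open>Factoring the denominator exhibits the kernel as the restriction to the real line of a
  rational function whose only pole in the upper half-plane is \<open>z\<close>.\<close>

lemma poisson_at_of_real:
  "poisson_at z t = of_real (Im z) / ((of_real t - z) * (of_real t - cnj z))"
proof -
  have "(of_real t - z) * (of_real t - cnj z) = of_real ((Re z - t)\<^sup>2 + (Im z)\<^sup>2)"
    by (simp add: complex_eq_iff power2_eq_square algebra_simps)
  then show ?thesis
    unfolding poisson_at_def poisson_P_def by simp
qed

text \<open>Subtracting the value at \<open>z\<close> removes the pole, so that the integral over the real line is the
  limit of integrals over the other two sides of a growing triangle, where the integrand decays
  quadratically.\<close>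

lemma poisson_integral_bounded_holomorphic:
  assumes hol: "g holomorphic_on {\<zeta>. Im \<zeta> > - a}" and a: "a > 0"
    and bd: "\<And>\<zeta>. Im \<zeta> \<ge> 0 \<Longrightarrow> norm (g \<zeta>) \<le> M" and z: "Im z > 0"
  shows "integrable lebesgue (\<lambda>t. g (of_real t) * poisson_at z t)"
    and "(LINT t|lebesgue. g (of_real t) * poisson_at z t) = of_real pi * g z"
proof -
  let ?P = "\<lambda>t. poisson_P (Re z - t) (Im z)"
  have M: "M \<ge> 0"
    using order_trans[OF norm_ge_zero bd[of 0]] by simp
  have cg: "continuous_on UNIV (\<lambda>t. g (of_real t))"
    by (rule continuous_on_compose2[OF holomorphic_on_imp_continuous_on[OF hol]])
      (use a in \<open>auto intro!: continuous_intros\<close>)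
  have [measurable]: "(\<lambda>t. g (of_real t)) \<in> borel_measurable lebesgue"
    using borel_measurable_continuous_onI[OF cg] by (simp add: measurable_completion)
  have P0: "?P t \<ge> 0" for t
    using z by (simp add: poisson_P_def)
  have Pi: "integrable lebesgue (poisson_at z)"
    using poisson_kernel_integral(1)[OF z] unfolding poisson_at_def[abs_def] by simp
  have [measurable]: "poisson_at z \<in> borel_measurable lebesgue"
    using Pi by (rule borel_measurable_integrable)
  show int: "integrable lebesgue (\<lambda>t. g (of_real t) * poisson_at z t)"
  proof (rule Bochner_Integration.integrable_bound)
    show "integrable lebesgue (\<lambda>t. M * ?P t)"
      using poisson_kernel_integral(1)[OF z] by simp
    show "AE t in lebesgue. norm (g (of_real t) * poisson_at z t) \<le> norm (M * ?P t)"
    proof (rule AE_I2)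
      fix t :: real
      show "norm (g (of_real t) * poisson_at z t) \<le> norm (M * ?P t)"
        unfolding norm_mult poisson_at_def norm_of_real real_norm_def
        using bd[of "of_real t"] M by (simp add: abs_mult mult_right_mono)
    qed
  qed measurable
  \<comment> \<open>Below the real line the half-plane \<open>S\<close> must stay inside the domain
    of \<open>g\<close> and above the second pole \<open>cnj z\<close>.\<close>
  define b where "b = min a (Im z)"
  define S where "S = {\<zeta>. Im \<zeta> > - b}"
  have b: "b > 0" "S \<subseteq> {\<zeta>. Im \<zeta> > - a}"
    using a z unfolding b_def S_def by auto
  have S: "open S" "convex S"
    unfolding S_def using open_halfspace_Im_gt convex_halfspace_Im_gt by auto
  define r where "r \<zeta> = (if \<zeta> = z then deriv g z else (g \<zeta> - g z) / (\<zeta> - z))" for \<zeta>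
  define q where "q \<zeta> = r \<zeta> * (of_real (Im z) / (\<zeta> - cnj z))" for \<zeta>
  have "r holomorphic_on S"
    unfolding r_def
    by (rule pole_lemma) (use holomorphic_on_subset[OF hol b(2)] S z b in \<open>auto simp: interior_open S_def\<close>)
  moreover have "\<zeta> - cnj z \<noteq> 0" if "\<zeta> \<in> S" for \<zeta>
    using that unfolding S_def b_def by auto
  ultimately have qhol: "q holomorphic_on S"
    unfolding q_def by (intro holomorphic_intros) auto
  \<comment> \<open>A primitive on the convex set \<open>S\<close> turns the integrals along the
    three sides of a triangle into differences of values of \<open>G\<close>, which sum to
    zero.\<close>
  then obtain G where G: "\<And>\<zeta>. \<zeta> \<in> S \<Longrightarrow> (G has_field_derivative q \<zeta>) (at \<zeta> within S)"
    using holomorphic_convex_primitive'[OF S(2) S(1) qhol] by blast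
  have path: "(q has_contour_integral (G w - G v)) (linepath v w)" if "v \<in> S" "w \<in> S" for v w
    using contour_integral_primitive[of S G q "linepath v w"] G that S(2)
    by (auto simp: closed_segment_subset)
  have q_real: "q (of_real t) = g (of_real t) * poisson_at z t - g z * poisson_at z t" for t
  proof -
    have "of_real t \<noteq> z" using z by (auto simp: complex_eq_iff)
    then show ?thesis
      unfolding q_def r_def poisson_at_of_real by (simp add: left_diff_distrib diff_divide_distrib)
  qed
  have q_int: "integrable lebesgue (\<lambda>t. q (of_real t))"
    unfolding q_real using int Pi by simp
  have q_bound: "norm (q \<zeta>) \<le> 2 * M * Im z / (R / 2 - norm z)\<^sup>2"
    if R: "R > 2 * norm z + 1" and \<zeta>: "norm \<zeta> \<ge> R / 2" "Im \<zeta> \<ge> 0" for R \<zeta>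
  proof -
    have R2: "R / 2 - norm z > 0"
      using R by simp
    have 1: "norm (\<zeta> - z) \<ge> R / 2 - norm z"
      using norm_triangle_ineq2[of \<zeta> z] \<zeta> by linarith
    have 2: "norm (\<zeta> - cnj z) \<ge> R / 2 - norm z"
      using norm_triangle_ineq2[of \<zeta> "cnj z"] \<zeta> by simp
    have "\<zeta> \<noteq> z"
      using 1 R2 by auto
    then have "norm (q \<zeta>) = norm (g \<zeta> - g z) / norm (\<zeta> - z) * (Im z / norm (\<zeta> - cnj z))"
      unfolding q_def r_def using z by (simp add: norm_mult norm_divide)
    also have "\<dots> \<le> (2 * M) / (R / 2 - norm z) * (Im z / (R / 2 - norm z))"
    proof (intro mult_mono frac_le)
      show "norm (g \<zeta> - g z) \<le> 2 * M"
        using bd[OF \<zeta>(2)] bd[of z] z norm_triangle_ineq4[of "g \<zeta>" "g z"] by simp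
    qed (use 1 2 R2 M z in auto)
    finally show ?thesis
      by (simp add: power2_eq_square)
  qed
  have tri: "norm (integral {-R..R} (\<lambda>t. q (of_real t))) \<le> 2 * (2 * M * Im z / (R / 2 - norm z)\<^sup>2 * (2 * R))"
    if R: "R > 2 * norm z + 1" for R
  proof -
    have R0: "R > 0"
      using R by (smt (verit) norm_ge_zero)
    \<comment> \<open>The base is the interval from \<open>-R\<close> to \<open>R\<close>, the apex
      \<open>\<i> * R\<close>. On the slanted sides \<open>|Re \<zeta>| + |Im \<zeta>| = R\<close>,
      hence the radius \<open>R / 2\<close> in \<open>q_bound\<close>.\<close>
    define A B C where "A = complex_of_real (-R)" and "B = complex_of_real R" and "C = Complex 0 R"
    have mem: "A \<in> S" "B \<in> S" "C \<in> S"
      using R0 b by (auto simp: A_def B_def C_def S_def)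
    have seg: "norm \<zeta> \<ge> R / 2 \<and> Im \<zeta> \<ge> 0" if mem_seg: "\<zeta> \<in> closed_segment B C \<or> \<zeta> \<in> closed_segment C A" for \<zeta>
    proof -
      have "\<bar>Re \<zeta>\<bar> + \<bar>Im \<zeta>\<bar> = R \<and> Im \<zeta> \<ge> 0"
      proof -
        obtain u where u: "0 \<le> u" "u \<le> 1"
          "\<zeta> = (1 - u) *\<^sub>R B + u *\<^sub>R C \<or> \<zeta> = (1 - u) *\<^sub>R C + u *\<^sub>R A"
          using mem_seg unfolding closed_segment_def by blast
        have e: "\<bar>(1 - u) * R\<bar> = (1 - u) * R" "\<bar>u * R\<bar> = u * R"
          using u R0 by (auto simp: abs_mult)
        have "\<zeta> = Complex ((1 - u) * R) (u * R) \<or> \<zeta> = Complex (- (u * R)) ((1 - u) * R)"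
          using u(3) by (simp add: A_def B_def C_def complex_eq_iff)
        moreover have "(1 - u) * R + u * R = R"
          by (simp add: algebra_simps)
        moreover have "(1 - u) * R \<ge> 0" "u * R \<ge> 0"
          using u R0 by auto
        ultimately show ?thesis
          using e by (elim disjE) auto
      qed
      then show ?thesis
        using abs_Re_le_cmod[of \<zeta>] abs_Im_le_cmod[of \<zeta>] by linarith
    qed
    let ?K = "2 * M * Im z / (R / 2 - norm z)\<^sup>2"
    have K0: "?K \<ge> 0"
      using M z by simp
    have "norm (G C - G B) \<le> ?K * norm (C - B)" "norm (G A - G C) \<le> ?K * norm (A - C)"
      using has_contour_integral_bound_linepath[OF path K0] q_bound[OF R] seg mem by blast+
    moreover have "norm (C - B) \<le> 2 * R" "norm (A - C) \<le> 2 * R"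
      using R0 norm_triangle_ineq4[of C B] norm_triangle_ineq4[of A C]
      by (auto simp: A_def B_def C_def cmod_def)
    ultimately have "norm (G C - G B) \<le> ?K * (2 * R)" "norm (G A - G C) \<le> ?K * (2 * R)"
      using K0 mult_left_mono order_trans by metis+
    moreover have "norm (G B - G A) \<le> norm (G C - G B) + norm (G A - G C)"
      by (metis add.commute norm_minus_commute norm_triangle_ineq diff_add_cancel add_diff_eq)
    moreover have "((\<lambda>t. q (of_real t)) has_integral (G B - G A)) {-R..R}"
      using path[OF mem(1,2)] R0 by (subst (asm) has_contour_integral_linepath_Reals_iff) (auto simp: A_def B_def)
    ultimately show ?thesis
      using integral_unique by (smt (verit))
  qed
  have "(\<lambda>n. integral {- real n..real n} (\<lambda>t. q (of_real t))) \<longlonglongrightarrow> 0"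
  proof (rule Lim_null_comparison)
    have "\<forall>\<^sub>F n in sequentially. real n > 2 * norm z + 1"
      using filterlim_real_sequentially by (rule filterlim_at_top_dense[THEN iffD1, rule_format])
    then show "\<forall>\<^sub>F n in sequentially. norm (integral {- real n..real n} (\<lambda>t. q (of_real t)))
        \<le> 2 * (2 * M * Im z / (real n / 2 - norm z)\<^sup>2 * (2 * real n))"
      by eventually_elim (rule tri)
    show "(\<lambda>n. 2 * (2 * M * Im z / (real n / 2 - norm z)\<^sup>2 * (2 * real n))) \<longlonglongrightarrow> 0"
      by real_asymp
  qed
  moreover have "integral {- real n..real n} (\<lambda>t. q (of_real t))
      = (LINT t|lebesgue. indicat_real {- real n..real n} t *\<^sub>R q (of_real t))" for n
  proof -
    have "set_integrable lebesgue {- real n..real n} (\<lambda>t. q (of_real t))"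
      using q_int unfolding set_integrable_def by (intro integrable_mult_indicator) auto
    from set_lebesgue_integral_eq_integral(2)[OF this] show ?thesis
      unfolding set_lebesgue_integral_def by simp
  qed
  moreover have "(\<lambda>n. LINT t|lebesgue. indicat_real {- real n..real n} t *\<^sub>R q (of_real t))
      \<longlonglongrightarrow> (LINT t|lebesgue. q (of_real t))"
  proof (rule integral_dominated_convergence[where w="\<lambda>t. norm (q (of_real t))"])
    show "AE t in lebesgue. (\<lambda>n. indicat_real {- real n..real n} t *\<^sub>R q (of_real t)) \<longlonglongrightarrow> q (of_real t)"
    proof (rule AE_I2, rule tendsto_eventually)
      fix t :: real
      have "\<forall>\<^sub>F n in sequentially. real n > \<bar>t\<bar>"
        using filterlim_real_sequentially by (rule filterlim_at_top_dense[THEN iffD1, rule_format])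
      then show "\<forall>\<^sub>F n in sequentially. indicat_real {- real n..real n} t *\<^sub>R q (of_real t) = q (of_real t)"
        by eventually_elim (auto simp: indicator_def)
    qed
    show "(\<lambda>t. q (of_real t)) \<in> borel_measurable lebesgue"
      using q_int by (rule borel_measurable_integrable)
    show "(\<lambda>t. indicat_real {- real n..real n} t *\<^sub>R q (of_real t)) \<in> borel_measurable lebesgue" for n
      using borel_measurable_integrable[OF q_int] by (intro borel_measurable_scaleR borel_measurable_indicator) auto
  qed (use q_int in \<open>auto simp: indicator_def\<close>)
  ultimately have "(LINT t|lebesgue. q (of_real t)) = 0"
    using LIMSEQ_unique by force
  then have "(LINT t|lebesgue. g (of_real t) * poisson_at z t) = g z * (LINT t|lebesgue. poisson_at z t)"
    unfolding q_real using int Pi by simp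
  also have "(LINT t|lebesgue. poisson_at z t) = of_real pi"
    unfolding poisson_at_def using poisson_kernel_integral[OF z] by (simp add: integral_complex_of_real)
  finally show "(LINT t|lebesgue. g (of_real t) * poisson_at z t) = of_real pi * g z"
    by (simp add: mult.commute)
qed

section \<open>Poisson pairings of functions of tempered growth\<close>

lemma H_tg_bound:
  assumes "h \<in> H_tg"
  obtains C N where "C \<ge> 0" "N > 0" "\<And>z. Im z > 0 \<Longrightarrow> norm (h z) \<le> C / Im z ^ N"
proof -
  obtain C :: real and N where CN: "N > 0" "\<forall>z\<in>upper_hp. norm (h z) \<le> C / Im z ^ N"
    using assms unfolding H_tg_def by blast
  moreover have "\<i> \<in> upper_hp"
    by (simp add: upper_hp_def)
  ultimately have "norm (h \<i>) \<le> C"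
    by fastforce
  then have "C \<ge> 0"
    using norm_ge_zero order_trans by blast
  with that[of C N] CN show ?thesis
    by (auto simp: upper_hp_def)
qed

lemma H_tg_holomorphic: "h \<in> H_tg \<Longrightarrow> h holomorphic_on upper_hp"
  by (simp add: H_tg_def)

lemma open_upper_hp: "open upper_hp"
  unfolding upper_hp_def by (rule open_halfspace_Im_gt)

text \<open>The shift by \<open>\<i> * s\<close> makes \<open>h\<close> holomorphic beyond the real
  line and bounded by \<open>C / s ^ N\<close> on the closed half-plane, which is what the
  reproducing formula asks for.\<close>

lemma H_tg_shifted_poisson_integral:
  assumes h: "h \<in> H_tg" and z: "z \<in> upper_hp" and s: "s > 0"
  shows "integrable lebesgue (\<lambda>t. h (Complex t s) * poisson_at z t)"
    and "(LINT t|lebesgue. h (Complex t s) * poisson_at z t) = of_real pi * h (z + \<i> * of_real s)"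
proof -
  obtain C N where C: "C \<ge> 0" "N > 0" "\<And>z. Im z > 0 \<Longrightarrow> norm (h z) \<le> C / Im z ^ N"
    using H_tg_bound[OF h] by metis
  let ?g = "\<lambda>\<zeta>. h (\<zeta> + \<i> * of_real s)"
  have "?g holomorphic_on {\<zeta>. Im \<zeta> > - s}"
    by (rule holomorphic_on_compose_gen[OF _ H_tg_holomorphic[OF h], unfolded o_def])
      (auto intro!: holomorphic_intros simp: upper_hp_def)
  moreover have "norm (?g \<zeta>) \<le> C / s ^ N" if "Im \<zeta> \<ge> 0" for \<zeta>
  proof -
    have "norm (?g \<zeta>) \<le> C / (Im \<zeta> + s) ^ N"
      using C(3)[of "\<zeta> + \<i> * of_real s"] that s by simp
    also have "\<dots> \<le> C / s ^ N"
      using C(1) that s by (intro divide_left_mono power_mono mult_pos_pos zero_less_power) auto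
    finally show ?thesis .
  qed
  moreover have "?g (of_real t) = h (Complex t s)" for t
    by (simp add: Complex_eq)
  ultimately show "integrable lebesgue (\<lambda>t. h (Complex t s) * poisson_at z t)"
    "(LINT t|lebesgue. h (Complex t s) * poisson_at z t) = of_real pi * ?g z"
    using poisson_integral_bounded_holomorphic[of ?g s "C / s ^ N" z] s z
    by (auto simp: upper_hp_def)
qed

lemma tendsto_upper_hp_shift:
  assumes "continuous_on upper_hp h" "z \<in> upper_hp"
  shows "((\<lambda>s. h (z + \<i> * of_real s)) \<longlongrightarrow> h z) (at_right 0)"
proof -
  have "isCont h z"
    using assms open_upper_hp continuous_on_eq_continuous_at by blast
  moreover have "((\<lambda>s. z + \<i> * of_real s) \<longlongrightarrow> z + \<i> * of_real 0) (at_right 0)"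
    by (intro tendsto_intros)
  ultimately show ?thesis
    using isCont_tendsto_compose by fastforce
qed

text \<open>For every \<open>s > 0\<close> the integral is exactly
  \<open>pi * h (z + \<i> * s)\<close>, so the limit is continuity of \<open>h\<close> at the
  interior point \<open>z\<close>.\<close>

lemma H_tg_poisson_tendsto:
  assumes h: "h \<in> H_tg" and z: "z \<in> upper_hp"
  shows "((\<lambda>s. LINT t|lebesgue. h (Complex t s) * poisson_at z t) \<longlongrightarrow> of_real pi * h z) (at_right 0)"
proof (rule Lim_transform_eventually)
  show "((\<lambda>s. of_real pi * h (z + \<i> * of_real s)) \<longlongrightarrow> of_real pi * h z) (at_right 0)"
    by (intro tendsto_mult tendsto_const tendsto_upper_hp_shift z
        holomorphic_on_imp_continuous_on H_tg_holomorphic h)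
  show "\<forall>\<^sub>F s in at_right 0. of_real pi * h (z + \<i> * of_real s)
      = (LINT t|lebesgue. h (Complex t s) * poisson_at z t)"
    unfolding eventually_at_filter using H_tg_shifted_poisson_integral(2)[OF h z] by auto
qed

lemma boundary_pairing_poisson:
  assumes h: "h \<in> H_tg" and z: "z \<in> upper_hp"
  shows "boundary_pairing_exists h (poisson_at z)"
    and "boundary_pairing h (poisson_at z) = of_real pi * h z"
proof -
  show "boundary_pairing_exists h (poisson_at z)"
    unfolding boundary_pairing_exists_def
    using H_tg_poisson_tendsto[OF h z] H_tg_shifted_poisson_integral(1)[OF h z]
    by (auto simp: eventually_at_filter)
  show "boundary_pairing h (poisson_at z) = of_real pi * h z"
    unfolding boundary_pairing_def using H_tg_poisson_tendsto[OF h z]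
    by (intro tendsto_Lim) auto
qed

text \<open>The kernel \<open>poisson_P t 1\<close> is real and, being even in \<open>t\<close>,
  equals \<open>poisson_at \<i> t\<close>; so the pairing is the imaginary part of the one
  reproduced at \<open>\<i>\<close>.\<close>

lemma boundary_pairing_Im_poisson:
  assumes h: "h \<in> H_tg"
  shows "boundary_pairing_exists (\<lambda>\<zeta>. of_real (Im (h \<zeta>))) (\<lambda>t. of_real (poisson_P t 1))"
    and "boundary_pairing (\<lambda>\<zeta>. of_real (Im (h \<zeta>))) (\<lambda>t. of_real (poisson_P t 1)) = of_real (pi * Im (h \<i>))"
proof -
  have i: "\<i> \<in> upper_hp"
    by (simp add: upper_hp_def)
  have eq: "of_real (Im (h (Complex t s))) * of_real (poisson_P t 1)
      = complex_of_real (Im (h (Complex t s) * poisson_at \<i> t))" for t s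
    by (simp add: poisson_at_def poisson_P_def)
  have int: "integrable lebesgue (\<lambda>t. complex_of_real (Im (h (Complex t s) * poisson_at \<i> t)))" if "s > 0" for s
    by (intro integrable_of_real integrable_Im H_tg_shifted_poisson_integral(1)[OF h i that])
  have "(LINT t|lebesgue. complex_of_real (Im (h (Complex t s) * poisson_at \<i> t)))
      = of_real (Im (LINT t|lebesgue. h (Complex t s) * poisson_at \<i> t))" if "s > 0" for s
    by (simp only: integral_complex_of_real integral_Im[OF H_tg_shifted_poisson_integral(1)[OF h i that]])
  then have "\<forall>\<^sub>F s in at_right 0. complex_of_real (Im (LINT t|lebesgue. h (Complex t s) * poisson_at \<i> t))
      = (LINT t|lebesgue. complex_of_real (Im (h (Complex t s) * poisson_at \<i> t)))"
    by (auto simp: eventually_at_filter)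
  moreover have "((\<lambda>s. complex_of_real (Im (LINT t|lebesgue. h (Complex t s) * poisson_at \<i> t)))
      \<longlongrightarrow> of_real (Im (of_real pi * h \<i>))) (at_right 0)"
    by (intro tendsto_of_real tendsto_Im H_tg_poisson_tendsto[OF h i])
  ultimately have lim: "((\<lambda>s. LINT t|lebesgue. complex_of_real (Im (h (Complex t s) * poisson_at \<i> t)))
      \<longlongrightarrow> of_real (pi * Im (h \<i>))) (at_right 0)"
    using Lim_transform_eventually by fastforce
  show "boundary_pairing_exists (\<lambda>\<zeta>. of_real (Im (h \<zeta>))) (\<lambda>t. of_real (poisson_P t 1))"
    unfolding boundary_pairing_exists_def eq using lim int by (auto simp: eventually_at_filter)
  show "boundary_pairing (\<lambda>\<zeta>. of_real (Im (h \<zeta>))) (\<lambda>t. of_real (poisson_P t 1)) = of_real (pi * Im (h \<i>))"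
    unfolding boundary_pairing_def eq using lim by (intro tendsto_Lim) auto
qed

subsection \<open>Boundary values of holomorphic functions of tempered growth\<close>

lemma integrable_slice:
  fixes \<phi> :: "real \<Rightarrow> complex"
  assumes h: "continuous_on upper_hp h" and \<phi>: "\<phi> \<in> test_functions UNIV" and s: "s > 0"
  shows "integrable lebesgue (\<lambda>t. h (Complex t s) * \<phi> t)"
proof -
  obtain K where K: "compact K" "\<And>t. t \<notin> K \<Longrightarrow> \<phi> t = 0"
    using \<phi> by (auto simp: test_functions_def)
  have "continuous_on UNIV (\<lambda>t. h (Complex t s))"
    by (rule continuous_on_compose2[OF h])
      (use s in \<open>auto intro!: continuous_intros simp: upper_hp_def Complex_eq\<close>)
  then show ?thesis
    by (intro integrable_lebesgue_compact_support[OF _ K(1)] continuous_intros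
        test_functions_continuous_on[OF \<phi>]) (auto simp: K)
qed

text \<open>By the Cauchy-Riemann equations and integration by parts, differentiating the pairing with
  respect to the height moves one derivative to the test function.\<close>

lemma slice_pairing_has_vector_derivative:
  fixes \<phi> :: "real \<Rightarrow> complex"
  assumes h: "h holomorphic_on upper_hp" and \<phi>: "\<phi> \<in> test_functions UNIV" and s: "s > 0"
  shows "((\<lambda>s. LINT t|lebesgue. h (Complex t s) * \<phi> t) has_vector_derivative
           - \<i> * (LINT t|lebesgue. h (Complex t s) * frechet_derivative \<phi> (at t) 1)) (at s)"
proof -
  let ?\<phi>' = "\<lambda>t. frechet_derivative \<phi> (at t) 1"
  have \<phi>': "?\<phi>' \<in> test_functions UNIV"
    by (rule test_functions_frechet_derivative[OF \<phi>])
  have ch: "continuous_on upper_hp h"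
    by (rule holomorphic_on_imp_continuous_on[OF h])
  have dh: "deriv h holomorphic_on upper_hp"
    by (rule holomorphic_deriv[OF h open_upper_hp])
  obtain K where K: "compact K" "\<And>t. t \<notin> K \<Longrightarrow> \<phi> t = 0"
    using \<phi> by (auto simp: test_functions_def)
  obtain K' where K': "compact K'" "\<And>t. t \<notin> K' \<Longrightarrow> ?\<phi>' t = 0"
    using \<phi>' by (auto simp: test_functions_def)
  have "bounded (K \<union> K')"
    using K K' compact_imp_bounded by blast
  then obtain R where R: "R > 0" "K \<union> K' \<subseteq> ball 0 R"
    using bounded_subset_ballD by metis
  have out: "\<phi> t = 0" "?\<phi>' t = 0" if "\<bar>t\<bar> \<ge> R" for t
    using that R(2) K(2) K'(2) by (force simp: dist_norm)+
  have to_HK: "(LINT t|lebesgue. h (Complex t r) * \<psi> t) = integral (cbox (-R) R) (\<lambda>t. h (Complex t r) * \<psi> t)"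
    if "\<psi> \<in> test_functions UNIV" "\<And>t. \<bar>t\<bar> \<ge> R \<Longrightarrow> \<psi> t = 0" "r > 0" for \<psi> r
  proof -
    have i: "integrable lebesgue (\<lambda>t. h (Complex t r) * \<psi> t)"
      by (rule integrable_slice[OF ch that(1,3)])
    have eq: "(\<lambda>t. indicat_real (cbox (-R) R) t *\<^sub>R (h (Complex t r) * \<psi> t)) = (\<lambda>t. h (Complex t r) * \<psi> t)"
      using that(2) by (auto simp: indicator_def fun_eq_iff)
    have "set_integrable lebesgue (cbox (-R) R) (\<lambda>t. h (Complex t r) * \<psi> t)"
      unfolding set_integrable_def eq by (rule i)
    from set_lebesgue_integral_eq_integral(2)[OF this] show ?thesis
      unfolding set_lebesgue_integral_def eq .
  qed
  have chain: "((\<lambda>r. h (\<gamma> r)) has_vector_derivative v * deriv h (\<gamma> r)) (at r within U)"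
    if "Im (\<gamma> r) > 0" "(\<gamma> has_vector_derivative v) (at r within U)" for \<gamma> v r U
  proof -
    have "(h has_field_derivative deriv h (\<gamma> r)) (at (\<gamma> r))"
      by (rule holomorphic_derivI[OF h open_upper_hp]) (use that in \<open>simp add: upper_hp_def\<close>)
    then show ?thesis
      using field_vector_diff_chain_within[OF that(2) DERIV_subset[OF _ subset_UNIV]] by (simp add: o_def)
  qed
  have ds: "((\<lambda>s. h (Complex t s)) has_vector_derivative \<i> * deriv h (Complex t s)) (at s within U)"
    if "s > 0" for t s U
    by (rule chain) (use that in \<open>auto simp: Complex_eq intro!: derivative_eq_intros\<close>)
  have dt: "((\<lambda>t. h (Complex t s)) has_vector_derivative 1 * deriv h (Complex t s)) (at t within U)"
    if "s > 0" for t s U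
    by (rule chain) (use that in \<open>auto simp: Complex_eq intro!: derivative_eq_intros\<close>)
  \<comment> \<open>The heights between \<open>s / 2\<close> and \<open>2 * s\<close> form a compact
    neighbourhood of \<open>s\<close> away from the boundary, where the derivative of the integrand
    is jointly continuous, as the Leibniz rule asks.\<close>
  have cdt: "continuous_on ({s / 2..2 * s} \<times> cbox (-R) R) (\<lambda>(r, t). \<i> * deriv h (Complex t r) * \<phi> t)"
  proof -
    have "continuous_on ({s / 2..2 * s} \<times> cbox (-R) R) (\<lambda>p. deriv h (Complex (snd p) (fst p)))"
      by (rule continuous_on_compose2[OF holomorphic_on_imp_continuous_on[OF dh]])
        (use s in \<open>auto intro!: continuous_intros simp: upper_hp_def Complex_eq\<close>)
    moreover have "continuous_on ({s / 2..2 * s} \<times> cbox (-R) R) (\<lambda>p. \<phi> (snd p))"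
      by (rule continuous_on_compose2[OF test_functions_continuous_on[OF \<phi>, of UNIV]])
        (auto intro!: continuous_intros)
    ultimately show ?thesis
      unfolding split_beta by (intro continuous_intros)
  qed
  have "((\<lambda>r. integral (cbox (-R) R) (\<lambda>t. h (Complex t r) * \<phi> t)) has_vector_derivative
      integral (cbox (-R) R) (\<lambda>t. \<i> * deriv h (Complex t s) * \<phi> t)) (at s within {s / 2..2 * s})"
  proof (rule leibniz_rule_vector_derivative[OF _ _ cdt])
    show "((\<lambda>r. h (Complex t r) * \<phi> t) has_vector_derivative \<i> * deriv h (Complex t r) * \<phi> t) (at r within {s / 2..2 * s})"
      if "r \<in> {s / 2..2 * s}" for r t
      by (rule has_vector_derivative_mult_left[OF ds]) (use that s in auto)
    show "(\<lambda>t. h (Complex t r) * \<phi> t) integrable_on cbox (-R) R" if "r \<in> {s / 2..2 * s}" for r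
    proof -
      have "integrable lebesgue (\<lambda>t. h (Complex t r) * \<phi> t)"
        using that s by (intro integrable_slice[OF ch \<phi>]) auto
      then have "(\<lambda>t. h (Complex t r) * \<phi> t) integrable_on UNIV"
        using integrable_on_lebesgue by blast
      then show ?thesis
        using integrable_on_subcbox by blast
    qed
  qed (use s in auto)
  then have "((\<lambda>r. integral (cbox (-R) R) (\<lambda>t. h (Complex t r) * \<phi> t)) has_vector_derivative
      integral (cbox (-R) R) (\<lambda>t. \<i> * deriv h (Complex t s) * \<phi> t)) (at s)"
    using at_within_Icc_at[of "s / 2" s "2 * s"] s by simp
  moreover have "integral (cbox (-R) R) (\<lambda>t. \<i> * deriv h (Complex t s) * \<phi> t)
      = - \<i> * (LINT t|lebesgue. h (Complex t s) * ?\<phi>' t)"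
  proof -
    \<comment> \<open>Integration by parts; the boundary terms vanish because the supports lie in
      the open ball of radius \<open>R\<close>, so \<open>\<phi>\<close> is zero at \<open>R\<close>
      and \<open>-R\<close> themselves.\<close>
    have "((\<lambda>t. h (Complex t s) * ?\<phi>' t + deriv h (Complex t s) * \<phi> t) has_integral
        h (Complex R s) * \<phi> R - h (Complex (-R) s) * \<phi> (-R)) {-R..R}"
    proof (rule fundamental_theorem_of_calculus)
      show "((\<lambda>t. h (Complex t s) * \<phi> t) has_vector_derivative
          h (Complex t s) * ?\<phi>' t + deriv h (Complex t s) * \<phi> t) (at t within {-R..R})" for t
      proof (rule has_vector_derivative_mult[OF dt[OF s, unfolded mult_1]])
        show "(\<phi> has_vector_derivative ?\<phi>' t) (at t within {-R..R})"
        proof -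
          have d: "(\<phi> has_derivative frechet_derivative \<phi> (at t)) (at t)"
            by (rule test_functions_has_derivative[OF \<phi>])
          have "frechet_derivative \<phi> (at t) (u *\<^sub>R 1) = u *\<^sub>R ?\<phi>' t" for u
            by (rule linear_scale[OF has_derivative_linear[OF d]])
          then have "frechet_derivative \<phi> (at t) = (\<lambda>u. u *\<^sub>R ?\<phi>' t)"
            unfolding real_scaleR_def mult_1_right by (rule ext)
          then show ?thesis
            unfolding has_vector_derivative_def using has_derivative_at_withinI[OF d] by metis
        qed
      qed
    qed (use R in auto)
    then have "((\<lambda>t. h (Complex t s) * ?\<phi>' t + deriv h (Complex t s) * \<phi> t) has_integral 0) (cbox (-R) R)"
      using out by simp
    moreover have "((\<lambda>t. h (Complex t s) * ?\<phi>' t) has_integral (LINT t|lebesgue. h (Complex t s) * ?\<phi>' t)) (cbox (-R) R)"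
    proof -
      have "(\<lambda>t. h (Complex t s) * ?\<phi>' t) integrable_on cbox (-R) R"
        using integrable_on_lebesgue[OF integrable_slice[OF ch \<phi>' s]] integrable_on_subcbox by blast
      then show ?thesis
        using to_HK[OF \<phi>' out(2) s] by (simp add: has_integral_integral)
    qed
    ultimately have "((\<lambda>t. (h (Complex t s) * ?\<phi>' t + deriv h (Complex t s) * \<phi> t) - h (Complex t s) * ?\<phi>' t)
        has_integral 0 - (LINT t|lebesgue. h (Complex t s) * ?\<phi>' t)) (cbox (-R) R)"
      by (rule has_integral_diff)
    then have "((\<lambda>t. deriv h (Complex t s) * \<phi> t) has_integral - (LINT t|lebesgue. h (Complex t s) * ?\<phi>' t)) (cbox (-R) R)"
      by simp
    from integral_unique[OF has_integral_mult_right[OF this, of \<i>]] show ?thesis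
      by (simp only: mult.assoc mult_minus_left mult_minus_right)
  qed
  ultimately have "((\<lambda>r. integral (cbox (-R) R) (\<lambda>t. h (Complex t r) * \<phi> t)) has_vector_derivative
      - \<i> * (LINT t|lebesgue. h (Complex t s) * ?\<phi>' t)) (at s)"
    by simp
  then show ?thesis
    by (rule has_vector_derivative_transform_within_open[of _ _ _ "{0<..}"])
      (use s to_HK[OF \<phi> out(1)] in auto)
qed

text \<open>The derivative in \<open>s\<close> is, up to a factor \<open>- \<i>\<close>, a pairing
  with the derivative of \<open>\<phi>\<close>, for which the weaker bound holds too; integrating it
  from \<open>s\<close> to 1 lowers the exponent by one. This is why the bound is assumed for all
  test functions at once.\<close>

lemma slice_pairing_growth_improve:
  fixes \<alpha> :: real
  assumes h: "h holomorphic_on upper_hp" and \<alpha>: "\<alpha> > 0"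
    and growth: "\<And>\<phi>::real \<Rightarrow> complex. \<phi> \<in> test_functions UNIV \<Longrightarrow>
      \<exists>C. \<forall>s. 0 < s \<and> s \<le> 1 \<longrightarrow> norm (LINT t|lebesgue. h (Complex t s) * \<phi> t) \<le> C * s powr (- \<alpha> - 1)"
    and \<phi>: "\<phi> \<in> test_functions UNIV"
  shows "\<exists>C. \<forall>s. 0 < s \<and> s \<le> 1 \<longrightarrow> norm (LINT t|lebesgue. h (Complex t s) * \<phi> t) \<le> C * s powr (- \<alpha>)"
proof -
  let ?I = "\<lambda>\<phi> s. LINT t|lebesgue. h (Complex t s) * \<phi> t"
  let ?\<phi>' = "\<lambda>t. frechet_derivative \<phi> (at t) 1"
  obtain C where C: "\<And>s. 0 < s \<and> s \<le> 1 \<Longrightarrow> norm (?I ?\<phi>' s) \<le> C * s powr (- \<alpha> - 1)"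
    using growth[OF test_functions_frechet_derivative[OF \<phi>]] by blast
  have C0: "C \<ge> 0"
    using order_trans[OF norm_ge_zero C[of 1]] by simp
  have deriv: "(?I \<phi> has_vector_derivative - \<i> * ?I ?\<phi>' s) (at s)" if "s > 0" for s
    by (rule slice_pairing_has_vector_derivative[OF h \<phi> that])
  have "norm (?I \<phi> s) \<le> (norm (?I \<phi> 1) + C / \<alpha>) * s powr (- \<alpha>)" if s: "0 < s" "s \<le> 1" for s
  proof -
    have p1: "s powr (- \<alpha>) \<ge> 1"
      using s \<alpha> powr_mono2'[of "-\<alpha>" s 1] by simp
    \<comment> \<open>The right-hand side is the increment of the primitive
      \<open>- C / \<alpha> * s powr (- \<alpha>)\<close> of
      \<open>C * s powr (- \<alpha> - 1)\<close>; positivity of \<open>\<alpha>\<close> keeps out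
      the logarithm.\<close>
    have "norm (?I \<phi> 1 - ?I \<phi> s) \<le> - C / \<alpha> * 1 powr (- \<alpha>) - (- C / \<alpha> * s powr (- \<alpha>))"
    proof (cases "s = 1")
      case False
      show ?thesis
      proof (rule differentiable_bound_general[where f'="\<lambda>s. - \<i> * ?I ?\<phi>' s" and \<phi>="\<lambda>s. - C / \<alpha> * s powr (- \<alpha>)" and \<phi>'="\<lambda>s. C * s powr (- \<alpha> - 1)"])
        show "continuous_on {s..1} (?I \<phi>)"
          by (rule continuous_on_vector_derivative[where f'="\<lambda>r. - \<i> * ?I ?\<phi>' r"])
            (use deriv s in \<open>auto intro: has_vector_derivative_at_within\<close>)
        show "continuous_on {s..1} (\<lambda>s. - C / \<alpha> * s powr (- \<alpha>))"
          using s by (intro continuous_intros) auto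
        show "((\<lambda>s. - C / \<alpha> * s powr (- \<alpha>)) has_vector_derivative C * x powr (- \<alpha> - 1)) (at x)" if "s < x" for x
          using that s \<alpha> unfolding has_real_derivative_iff_has_vector_derivative[symmetric]
          by (auto intro!: derivative_eq_intros)
      qed (use False s deriv C in \<open>auto simp: norm_mult\<close>)
    qed simp
    then have "norm (?I \<phi> s) \<le> norm (?I \<phi> 1) + C / \<alpha> * s powr (- \<alpha>)"
      using norm_triangle_ineq2[of "?I \<phi> s" "?I \<phi> 1"] C0 \<alpha> by (simp add: norm_minus_commute)
        (smt (verit) divide_nonneg_pos)
    also have "\<dots> \<le> norm (?I \<phi> 1) * s powr (- \<alpha>) + C / \<alpha> * s powr (- \<alpha>)"
      using mult_left_mono[OF p1, of "norm (?I \<phi> 1)"] by simp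
    finally show ?thesis
      by (simp add: distrib_right)
  qed
  then show ?thesis by blast
qed

text \<open>Starting from exponent \<open>1/2 + N\<close> instead of \<open>N\<close>, the descent
  by unit steps never meets exponent 0, where integration would give a logarithm, and it ends at
  \<open>1/2\<close>, which is integrable at 0.\<close>

lemma H_tg_slice_pairing_growth:
  fixes \<phi> :: "real \<Rightarrow> complex"
  assumes h: "h \<in> H_tg" and \<phi>: "\<phi> \<in> test_functions UNIV"
  shows "\<exists>C. \<forall>s. 0 < s \<and> s \<le> 1 \<longrightarrow> norm (LINT t|lebesgue. h (Complex t s) * \<phi> t) \<le> C * s powr (- (1/2))"
proof -
  let ?I = "\<lambda>\<phi> s. LINT t|lebesgue. h (Complex t s) * \<phi> t"
  let ?Q = "\<lambda>\<alpha>. \<forall>\<phi>::real \<Rightarrow> complex. \<phi> \<in> test_functions UNIV \<longrightarrow>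
    (\<exists>C. \<forall>s. 0 < s \<and> s \<le> 1 \<longrightarrow> norm (?I \<phi> s) \<le> C * s powr (- \<alpha>))"
  have hol: "h holomorphic_on upper_hp"
    by (rule H_tg_holomorphic[OF h])
  obtain C N where C: "C \<ge> 0" "N > 0" "\<And>z. Im z > 0 \<Longrightarrow> norm (h z) \<le> C / Im z ^ N"
    using H_tg_bound[OF h] by metis
  have start: "?Q (1/2 + real N)"
  proof (intro allI impI)
    fix \<phi> :: "real \<Rightarrow> complex" assume \<phi>: "\<phi> \<in> test_functions UNIV"
    obtain K where K: "compact K" "\<And>t. t \<notin> K \<Longrightarrow> \<phi> t = 0"
      using \<phi> by (auto simp: test_functions_def)
    have \<phi>i: "integrable lebesgue \<phi>"
      by (rule integrable_lebesgue_compact_support[OF test_functions_continuous_on[OF \<phi>] K])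
    have "norm (?I \<phi> s) \<le> (C * (LINT t|lebesgue. norm (\<phi> t))) * s powr (- (1/2 + real N))"
      if s: "0 < s" "s \<le> 1" for s
    proof -
      have "norm (?I \<phi> s) \<le> (LINT t|lebesgue. norm (h (Complex t s) * \<phi> t))"
        by (rule integral_norm_bound)
      also have "\<dots> \<le> (LINT t|lebesgue. C / s ^ N * norm (\<phi> t))"
        by (rule integral_mono)
          (use integrable_norm[OF integrable_slice[OF holomorphic_on_imp_continuous_on[OF hol] \<phi> s(1)]]
            \<phi>i C(3)[of "Complex _ s"] s in \<open>auto simp: norm_mult simp del: times_divide_eq_left intro!: mult_right_mono\<close>)
      also have "\<dots> = C * (LINT t|lebesgue. norm (\<phi> t)) * s powr (- real N)"
        using s by (simp add: powr_minus powr_realpow divide_inverse)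
      also have "\<dots> \<le> C * (LINT t|lebesgue. norm (\<phi> t)) * s powr (- (1/2 + real N))"
        using s C(1) by (intro mult_left_mono powr_mono') auto
      finally show ?thesis .
    qed
    then show "\<exists>C. \<forall>s. 0 < s \<and> s \<le> 1 \<longrightarrow> norm (?I \<phi> s) \<le> C * s powr (- (1/2 + real N))"
      by blast
  qed
  have "?Q (1/2 + real (N - k))" if "k \<le> N" for k
    using that
  proof (induction k)
    case 0
    then show ?case using start by simp
  next
    case (Suc k)
    have e: "- (1/2 + real (N - k)) = - (1/2 + real (N - Suc k)) - 1"
      using Suc.prems by (simp add: of_nat_diff)
    show ?case
      using Suc slice_pairing_growth_improve[OF hol, of "1/2 + real (N - Suc k)"] unfolding e
      by (simp add: add_pos_nonneg)
  qed
  from this[of N] \<phi> show ?thesis by simp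
qed

lemma H_tg_has_boundary_value:
  assumes h: "h \<in> H_tg"
  shows "has_boundary_value h"
  unfolding has_boundary_value_def
proof
  fix \<phi> :: "real \<Rightarrow> complex" assume \<phi>: "\<phi> \<in> test_functions UNIV"
  let ?I = "\<lambda>\<phi> s. LINT t|lebesgue. h (Complex t s) * \<phi> t"
  let ?\<phi>' = "\<lambda>t. frechet_derivative \<phi> (at t) 1"
  have hol: "h holomorphic_on upper_hp"
    by (rule H_tg_holomorphic[OF h])
  obtain C where C: "\<And>s. 0 < s \<and> s \<le> 1 \<Longrightarrow> norm (?I ?\<phi>' s) \<le> C * s powr (- (1/2))"
    using H_tg_slice_pairing_growth[OF h test_functions_frechet_derivative[OF \<phi>]] by blast
  have C0: "C \<ge> 0"
    using order_trans[OF norm_ge_zero C[of 1]] by simp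
  have deriv: "(?I \<phi> has_vector_derivative - \<i> * ?I ?\<phi>' s) (at s)" if "s > 0" for s
    by (rule slice_pairing_has_vector_derivative[OF hol \<phi> that])
  have lip: "norm (?I \<phi> b - ?I \<phi> a) \<le> 2 * C * sqrt b - 2 * C * sqrt a" if ab: "0 < a" "a < b" "b \<le> 1" for a b
  proof (rule differentiable_bound_general[where f'="\<lambda>s. - \<i> * ?I ?\<phi>' s" and \<phi>="\<lambda>s. 2 * C * sqrt s" and \<phi>'="\<lambda>s. C * s powr (- (1/2))"])
    show "continuous_on {a..b} (?I \<phi>)"
      by (rule continuous_on_vector_derivative[where f'="\<lambda>r. - \<i> * ?I ?\<phi>' r"])
        (use deriv ab in \<open>auto intro: has_vector_derivative_at_within\<close>)
    show "continuous_on {a..b} (\<lambda>s. 2 * C * sqrt s)"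
      by (intro continuous_intros)
    show "((\<lambda>s. 2 * C * sqrt s) has_vector_derivative C * x powr (- (1/2))) (at x)" if "a < x" for x
      using that ab unfolding has_real_derivative_iff_has_vector_derivative[symmetric]
      by (auto intro!: derivative_eq_intros simp: powr_minus powr_half_sqrt divide_simps)
  qed (use ab deriv C in \<open>auto simp: norm_mult\<close>)
  \<comment> \<open>In the variable \<open>u = sqrt s\<close> the bound \<open>lip\<close> becomes a
    Lipschitz estimate, so the pairing extends continuously to \<open>u = 0\<close>, and the value
    of the extension is the limit.\<close>
  have "(2 * C)-lipschitz_on {0<..1} (\<lambda>u. ?I \<phi> (u\<^sup>2))"
  proof (rule lipschitz_onI)
    have ab: "norm (?I \<phi> (b\<^sup>2) - ?I \<phi> (a\<^sup>2)) \<le> 2 * C * \<bar>b - a\<bar>" if "0 < a" "a < b" "b \<le> 1" for a b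
      using lip[of "a\<^sup>2" "b\<^sup>2"] that by (simp add: power_strict_mono power_le_one right_diff_distrib)
    show "dist (?I \<phi> (a\<^sup>2)) (?I \<phi> (b\<^sup>2)) \<le> 2 * C * dist a b" if "a \<in> {0<..1}" "b \<in> {0<..1}" for a b
      using that ab[of a b] ab[of b a] by (cases a b rule: linorder_cases) (auto simp: dist_norm norm_minus_commute)
  qed (use C0 in simp)
  then have "uniformly_continuous_on {0<..1} (\<lambda>u. ?I \<phi> (u\<^sup>2))"
    by (rule lipschitz_on_uniformly_continuous)
  moreover have "(0::real) \<in> closure {0<..1}"
    by simp
  ultimately obtain L where "((\<lambda>u. ?I \<phi> (u\<^sup>2)) \<longlongrightarrow> L) (at 0 within {0<..1})"
    using uniformly_continuous_on_extension_at_closure by blast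
  then have "((\<lambda>u. ?I \<phi> (u\<^sup>2)) \<longlongrightarrow> L) (at_right 0)"
    by (subst at_within_nhd[of 0 "{..<1}" "{0<..}" "{0<..1}"]) auto
  moreover have "filterlim sqrt (at_right 0) (at_right 0)"
    by real_asymp
  ultimately have "((\<lambda>s. ?I \<phi> ((sqrt s)\<^sup>2)) \<longlongrightarrow> L) (at_right 0)"
    by (rule filterlim_compose)
  then have "(?I \<phi> \<longlongrightarrow> L) (at_right 0)"
    by (rule Lim_transform_eventually) (auto simp: eventually_at_filter)
  moreover have "\<forall>\<^sub>F s in at_right 0. integrable lebesgue (\<lambda>t. h (Complex t s) * \<phi> t)"
    using integrable_slice[OF holomorphic_on_imp_continuous_on[OF hol] \<phi>]
    by (auto simp: eventually_at_filter)
  ultimately show "boundary_pairing_exists h \<phi>"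
    unfolding boundary_pairing_exists_def by blast
qed

subsection \<open>The Cauchy kernel on \<open>L\<^sup>p\<close> densities\<close>

text \<open>Interpolation: with \<open>x\<close> the smaller distance, \<open>d\<close> is split as
  \<open>d powr a * d powr (1 - a)\<close> and only the second factor is estimated, using
  \<open>d \<le> 2 * y\<close>. The intended use is \<open>x = |u|\<close>, \<open>y = |v|\<close>,
  \<open>d = |u - v|\<close>.\<close>

lemma kernel_difference_bound:
  fixes x y d a :: real
  assumes "x > 0" "y > 0" "0 \<le> d" "d \<le> x + y" "0 < a" "a < 1"
  shows "d / (x * y) \<le> 2 * d powr a * (x powr (- (1 + a)) + y powr (- (1 + a)))"
proof -
  have *: "d / (x * y) \<le> 2 * d powr a * x powr (- (1 + a))"
    if "x > 0" "y > 0" "d \<le> x + y" "x \<le> y" for x y :: real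
  proof (cases "d = 0")
    case False
    then have d: "d > 0" using assms by simp
    have "d = d powr a * d powr (1 - a)"
      using d by (simp flip: powr_add)
    also have "d powr (1 - a) \<le> (2 * y) powr (1 - a)"
      using that d assms by (intro powr_mono2) auto
    also have "(2 * y) powr (1 - a) = 2 powr (1 - a) * y powr (1 - a)"
      using that by (simp add: powr_mult)
    also have "2 powr (1 - a) \<le> (2::real)"
      using powr_mono[of "1 - a" 1 "2::real"] assms by simp
    finally have "d \<le> d powr a * (2 * y powr (1 - a))"
      using d by (simp add: mult_left_mono mult_right_mono)
    then have "d / (x * y) \<le> d powr a * (2 * y powr (1 - a)) / (x * y)"
      using that by (intro divide_right_mono) auto
    also have "\<dots> = 2 * d powr a * (y powr (- a) / x)"
      using that by (simp add: powr_diff powr_minus field_simps)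
    also have "y powr (- a) \<le> x powr (- a)"
      using that assms by (intro powr_mono2') auto
    also have "x powr (- a) / x = x powr (- (1 + a))"
    proof -
      have e: "- (1 + a) = - a + - 1"
        by simp
      show ?thesis
        unfolding e powr_add using that by (simp add: powr_minus_divide)
    qed
    finally show ?thesis
      using that by (simp add: mult_left_mono divide_right_mono)
  qed simp
  have "2 * d powr a * x powr (- (1 + a)) \<ge> 0" "2 * d powr a * y powr (- (1 + a)) \<ge> 0"
    by auto
  moreover have "d / (x * y) \<le> 2 * d powr a * x powr (- (1 + a)) \<or> d / (x * y) \<le> 2 * d powr a * y powr (- (1 + a))"
    using *[of x y] *[of y x] assms by (cases "x \<le> y") (simp_all only: mult.commute[of y x] add.commute[of y x], auto)
  ultimately show ?thesis
    unfolding distrib_left by linarith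
qed

lemma norm_inverse_diff_bound:
  fixes u v :: complex and a :: real
  assumes "u \<noteq> 0" "v \<noteq> 0" "0 < a" "a < 1"
  shows "norm (1 / u - 1 / v)
    \<le> 2 * norm (u - v) powr a * (norm u powr (- (1 + a)) + norm v powr (- (1 + a)))"
proof -
  have "norm (1 / u - 1 / v) = norm (u - v) / (norm u * norm v)"
    using assms by (simp add: diff_frac_eq norm_divide norm_mult norm_minus_commute)
  also have "\<dots> \<le> 2 * norm (u - v) powr a * (norm u powr (- (1 + a)) + norm v powr (- (1 + a)))"
    using assms norm_triangle_ineq4[of u v] by (intro kernel_difference_bound) auto
  finally show ?thesis .
qed

section \<open>The integrand of the operator and its size at infinity\<close>

lemma T_integrand_eq:
  "T_integrand f z \<zeta> = f \<zeta> * (1 / (\<zeta> - z) - \<zeta> / (\<zeta>\<^sup>2 + 1))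
     - cnj (f \<zeta> * (1 / (\<zeta> - cnj z) - \<zeta> / (\<zeta>\<^sup>2 + 1)))"
  by (simp add: T_integrand_def)

lemma square_plus_1_eq_0_iff: "(\<zeta>::complex)\<^sup>2 + 1 = 0 \<longleftrightarrow> \<zeta> = \<i> \<or> \<zeta> = - \<i>"
proof -
  have "\<zeta>\<^sup>2 + 1 = (\<zeta> - \<i>) * (\<zeta> + \<i>)"
    by (simp add: power2_eq_square algebra_simps)
  then show ?thesis
    by (auto simp: eq_neg_iff_add_eq_0)
qed

text \<open>In terms of \<open>g = f \<zeta> / (\<zeta>\<^sup>2 + 1)\<close>, the integrand for \<open>z = \<i>\<close> controls \<open>Im g\<close>. Any further
  value of \<open>z\<close> then controls \<open>cnj g * Im \<zeta> / |\<zeta>|\<^sup>2\<close> at infinity, and these two quantities control the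
  integrand for every \<open>z\<close>.\<close>

lemma T_integrand_decomposition:
  fixes f :: "complex \<Rightarrow> complex"
  assumes "\<zeta>\<^sup>2 + 1 \<noteq> 0" "\<zeta> \<noteq> z" "\<zeta> \<noteq> cnj z"
  defines "g \<equiv> f \<zeta> / (\<zeta>\<^sup>2 + 1)"
  shows "T_integrand f z \<zeta> = z * (g - cnj g)
    + (1 + z\<^sup>2) * ((g - cnj g) / (\<zeta> - z) + cnj g * (cnj \<zeta> - \<zeta>) / ((\<zeta> - z) * (cnj \<zeta> - z)))"
proof -
  have nz: "\<zeta> - z \<noteq> 0" "cnj \<zeta> - z \<noteq> 0"
    using assms(2,3) by auto
  have nz': "(cnj \<zeta>)\<^sup>2 + 1 \<noteq> 0"
    using assms(1) complex_cnj_zero_iff[of "\<zeta>\<^sup>2 + 1"] by simp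
  \<comment> \<open>The numerator over the common denominator is \<open>1 + \<zeta> * z\<close>,
    regrouped as \<open>z * (\<zeta> - z) + (1 + z\<^sup>2)\<close>.\<close>
  have k: "1 / (\<zeta> - z) - \<zeta> / (\<zeta>\<^sup>2 + 1) = (z + (1 + z\<^sup>2) / (\<zeta> - z)) / (\<zeta>\<^sup>2 + 1)" if "\<zeta> - z \<noteq> 0" "\<zeta>\<^sup>2 + 1 \<noteq> 0" for \<zeta>
  proof -
    have "(1 / A - c / B) * (A * B) = B - c * A" if "A \<noteq> 0" "B \<noteq> 0" for A B c :: complex
      using that by (simp add: field_simps)
    from this[OF that] have "(1 / (\<zeta> - z) - \<zeta> / (\<zeta>\<^sup>2 + 1)) * ((\<zeta> - z) * (\<zeta>\<^sup>2 + 1)) = (\<zeta>\<^sup>2 + 1) - \<zeta> * (\<zeta> - z)" .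
    also have "\<dots> = z * (\<zeta> - z) + (1 + z\<^sup>2)"
      by (simp add: power2_eq_square algebra_simps)
    also have "\<dots> = (z + (1 + z\<^sup>2) / (\<zeta> - z)) / (\<zeta>\<^sup>2 + 1) * ((\<zeta> - z) * (\<zeta>\<^sup>2 + 1))"
    proof -
      have "w * A + c = (w + c / A) / B * (A * B)" if "A \<noteq> 0" "B \<noteq> 0" for A B c w :: complex
        using that by (simp add: field_simps)
      from this[OF that] show ?thesis .
    qed
    finally show ?thesis
      using that by (simp only: mult_cancel_right) simp
  qed
  have "T_integrand f z \<zeta> = g * (z + (1 + z\<^sup>2) / (\<zeta> - z)) - cnj g * (z + (1 + z\<^sup>2) / (cnj \<zeta> - z))"
    unfolding T_integrand_def k[OF nz(1) assms(1)] k[OF nz(2) nz'] g_def by simp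
  also have "\<dots> = z * (g - cnj g) + (1 + z\<^sup>2) * (g / (\<zeta> - z) - cnj g / (cnj \<zeta> - z))"
    by (simp add: algebra_simps add_divide_distrib)
  also have "g / (\<zeta> - z) - cnj g / (cnj \<zeta> - z)
      = (g - cnj g) / (\<zeta> - z) + cnj g * (cnj \<zeta> - \<zeta>) / ((\<zeta> - z) * (cnj \<zeta> - z))"
  proof -
    have "1 / (\<zeta> - z) - 1 / (cnj \<zeta> - z) = (cnj \<zeta> - \<zeta>) / ((\<zeta> - z) * (cnj \<zeta> - z))"
      using nz by (simp add: diff_frac_eq)
    then have "cnj g * (cnj \<zeta> - \<zeta>) / ((\<zeta> - z) * (cnj \<zeta> - z)) = cnj g * (1 / (\<zeta> - z) - 1 / (cnj \<zeta> - z))"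
      by simp
    then show ?thesis
      by (simp add: diff_divide_distrib right_diff_distrib)
  qed
  finally show ?thesis .
qed

text \<open>At \<open>z = \<i>\<close> the factor \<open>1 + z\<^sup>2\<close> of the decomposition
  vanishes.\<close>

lemma T_integrand_at_i:
  assumes "\<zeta> \<noteq> \<i>" "\<zeta> \<noteq> - \<i>"
  shows "T_integrand f \<i> \<zeta> = \<i> * (f \<zeta> / (\<zeta>\<^sup>2 + 1) - cnj (f \<zeta> / (\<zeta>\<^sup>2 + 1)))"
  using T_integrand_decomposition[of \<zeta> \<i> f] assms square_plus_1_eq_0_iff[of \<zeta>] by simp

text \<open>Two unknowns \<open>D\<close> and \<open>E\<close> determine the integrand for every
  \<open>z\<close>. The value at \<open>\<i>\<close> is \<open>\<i> * D\<close>; the value at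
  \<open>2 * \<i>\<close>, where \<open>1 + z\<^sup>2 = -3\<close> does not vanish, then yields
  \<open>E\<close>.\<close>

lemma T_integrand_far_bound:
  assumes R: "R \<ge> 2" and z: "norm z \<le> R" and \<zeta>: "norm \<zeta> > 2 * R"
  shows "norm (T_integrand f z \<zeta>)
    \<le> (R + 33 * (1 + R\<^sup>2)) * (norm (T_integrand f \<i> \<zeta>) + norm (T_integrand f (2 * \<i>) \<zeta>))"
proof -
  have big: "\<zeta> \<noteq> w" "\<zeta> \<noteq> cnj w" if "norm w \<le> R" for w
    using that \<zeta> R by auto
  have nz: "\<zeta>\<^sup>2 + 1 \<noteq> 0"
    using big[of \<i>] R square_plus_1_eq_0_iff[of \<zeta>] by auto
  define g where "g = f \<zeta> / (\<zeta>\<^sup>2 + 1)"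
  define D where "D = g - cnj g"
  define E where "E = cnj g * (cnj \<zeta> - \<zeta>)"
  have G: "T_integrand f w \<zeta> = w * D + (1 + w\<^sup>2) * (D / (\<zeta> - w) + E / ((\<zeta> - w) * (cnj \<zeta> - w)))"
    if "norm w \<le> R" for w
    unfolding D_def E_def g_def using T_integrand_decomposition[OF nz big[OF that]] by simp
  let ?G1 = "norm (T_integrand f \<i> \<zeta>)" and ?G2 = "norm (T_integrand f (2 * \<i>) \<zeta>)"
  have D: "norm D = ?G1"
    using G[of \<i>] R by (simp add: norm_mult)
  have far: "norm (\<zeta> - w) \<ge> norm \<zeta> / 2" "norm (cnj \<zeta> - w) \<ge> norm \<zeta> / 2" if "norm w \<le> R" for w
    using norm_triangle_ineq2[of \<zeta> w] norm_triangle_ineq2[of "cnj \<zeta>" w] that \<zeta> by auto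
  have Dw: "norm (D / (\<zeta> - w)) \<le> norm D" if "norm w \<le> R" for w
  proof -
    have "norm (\<zeta> - w) \<ge> 1"
      using far(1)[OF that] \<zeta> R by linarith
    then show ?thesis
      by (simp add: norm_divide divide_le_eq mult_le_cancel_left1)
  qed
  have E: "norm E \<le> 4 * (norm \<zeta>)\<^sup>2 * (?G2 + 2 * norm D)"
  proof -
    let ?w = "2 * \<i>"
    have w: "norm ?w \<le> R" using R by (simp add: norm_mult)
    let ?Q = "(\<zeta> - ?w) * (cnj \<zeta> - ?w)"
    have "T_integrand f ?w \<zeta> = ?w * D - 3 * (D / (\<zeta> - ?w)) - 3 * (E / ?Q)"
      unfolding G[OF w] by (simp add: power_mult_distrib right_diff_distrib)
    then have "3 * (E / ?Q) = ?w * D - 3 * (D / (\<zeta> - ?w)) - T_integrand f ?w \<zeta>"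
      by (simp only: algebra_simps)
    then have "norm (3 * (E / ?Q)) \<le> norm (?w * D) + norm (3 * (D / (\<zeta> - ?w))) + ?G2"
      by (metis norm_triangle_le_diff add_mono_thms_linordered_semiring(3) norm_triangle_ineq4)
    then have "3 * norm (E / ?Q) \<le> 2 * norm D + 3 * norm D + ?G2"
      using Dw[OF w] by (simp only: norm_mult norm_numeral) simp
    then have "norm (E / ?Q) \<le> ?G2 + 2 * norm D"
      using norm_ge_zero[of "T_integrand f ?w \<zeta>"] norm_ge_zero[of D] by linarith
    moreover have "norm ?Q \<le> 4 * (norm \<zeta>)\<^sup>2"
    proof -
      have "norm (\<zeta> - ?w) \<le> 2 * norm \<zeta>" "norm (cnj \<zeta> - ?w) \<le> 2 * norm \<zeta>"
        using norm_triangle_ineq4[of \<zeta> ?w] norm_triangle_ineq4[of "cnj \<zeta>" ?w] w \<zeta> R by auto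
      then have "norm ?Q \<le> (2 * norm \<zeta>) * (2 * norm \<zeta>)"
        unfolding norm_mult by (intro mult_mono) auto
      then show ?thesis by (simp add: power2_eq_square)
    qed
    moreover have "norm E = norm ?Q * norm (E / ?Q)"
    proof -
      have "?Q \<noteq> 0"
        using far[OF w] \<zeta> R by auto
      then show ?thesis by (simp add: norm_divide)
    qed
    ultimately show ?thesis
      using mult_mono[of "norm ?Q" "4 * (norm \<zeta>)\<^sup>2" "norm (E / ?Q)" "?G2 + 2 * norm D"] by simp
  qed
  have Ez: "norm (E / ((\<zeta> - z) * (cnj \<zeta> - z))) \<le> 16 * (?G2 + 2 * norm D)"
  proof -
    have pos: "norm (\<zeta> - z) > 0" "norm (cnj \<zeta> - z) > 0"
      using far[OF z] \<zeta> R by linarith+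
    have "(norm \<zeta> / 2) * (norm \<zeta> / 2) \<le> norm (\<zeta> - z) * norm (cnj \<zeta> - z)"
      using far[OF z] by (intro mult_mono) auto
    then have "norm (E / ((\<zeta> - z) * (cnj \<zeta> - z))) \<le> norm E / ((norm \<zeta> / 2) * (norm \<zeta> / 2))"
      unfolding norm_divide norm_mult using pos \<zeta> R by (intro divide_left_mono mult_pos_pos) auto
    also have "\<dots> \<le> 4 * (norm \<zeta>)\<^sup>2 * (?G2 + 2 * norm D) / ((norm \<zeta> / 2) * (norm \<zeta> / 2))"
      using E by (intro divide_right_mono) auto
    also have "\<dots> = 16 * (?G2 + 2 * norm D)"
    proof -
      have "norm \<zeta> > 0"
        using \<zeta> R by linarith
      then show ?thesis
        by (simp add: power2_eq_square)
    qed
    finally show ?thesis .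
  qed
  have "norm (T_integrand f z \<zeta>) \<le> norm (z * D) + norm (1 + z\<^sup>2) * norm (D / (\<zeta> - z) + E / ((\<zeta> - z) * (cnj \<zeta> - z)))"
    unfolding G[OF z] by (metis norm_mult norm_triangle_ineq)
  \<comment> \<open>The coefficient of \<open>norm D\<close> in the last factor is
    \<open>1 + 16 * 2 = 33\<close>. The 16 is the quotient of the upper bound
    \<open>4 * |\<zeta>|\<^sup>2\<close> and the lower bound \<open>|\<zeta>|\<^sup>2 / 4\<close>
    for products of two distances.\<close>
  also have "\<dots> \<le> R * norm D + (1 + R\<^sup>2) * (norm D + 16 * (?G2 + 2 * norm D))"
  proof (intro add_mono mult_mono)
    show "norm (z * D) \<le> R * norm D"
      using z by (simp add: norm_mult mult_right_mono)
    have "norm (1 + z\<^sup>2) \<le> 1 + (norm z)\<^sup>2"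
      using norm_triangle_ineq[of 1 "z\<^sup>2"] by (simp add: norm_power)
    also have "\<dots> \<le> 1 + R\<^sup>2"
      using z by (simp add: power_mono)
    finally show "norm (1 + z\<^sup>2) \<le> 1 + R\<^sup>2" .
    show "norm (D / (\<zeta> - z) + E / ((\<zeta> - z) * (cnj \<zeta> - z))) \<le> norm D + 16 * (?G2 + 2 * norm D)"
      using norm_triangle_mono[OF Dw[OF z] Ez] .
  qed auto
  also have "\<dots> \<le> (R + 33 * (1 + R\<^sup>2)) * (?G1 + ?G2)"
  proof -
    have "R * ?G2 \<ge> 0" "(1 + R\<^sup>2) * ?G2 \<ge> 0"
      using R by auto
    then show ?thesis
      unfolding D by (simp add: algebra_simps)
  qed
  finally show ?thesis .
qed

text \<open>The disks reach across the real line, so integrability holds up to the boundary, while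
  nothing is asked at infinity. Extension by zero lets all integrals run over the whole
  plane.\<close>

locale Lp_density =
  fixes p :: real and F :: "complex \<Rightarrow> complex"
  assumes p: "p > 2"
    and measurable_F: "F \<in> borel_measurable lebesgue"
    and zero_outside: "\<And>\<zeta>. \<zeta> \<notin> upper_hp \<Longrightarrow> F \<zeta> = 0"
    and Lp_bounded: "\<And>R. set_integrable lebesgue (cball 0 R) (\<lambda>\<zeta>. norm (F \<zeta>) powr p)"
begin

lemmas [measurable] = measurable_F

text \<open>Half of the critical exponent \<open>1 - 2 / p\<close>: for the exponent
  \<open>q\<close> conjugate to \<open>p\<close> this keeps \<open>(1 + \<alpha>) * q < 2\<close>,
  so the kernel of order \<open>1 + \<alpha>\<close> is locally q-integrable.\<close>

definition \<alpha> :: real where "\<alpha> = 1 / 2 - 1 / p"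

lemma \<alpha>: "0 < \<alpha>" "\<alpha> < 1"
  using p by (auto simp: \<alpha>_def field_simps)

lemma bounded_integrable: "set_integrable lebesgue (cball 0 R) (\<lambda>\<zeta>. norm (F \<zeta>))"
proof -
  have one: "set_integrable lebesgue (cball 0 R) (\<lambda>\<zeta>::complex. 1::real)"
    unfolding set_integrable_def using emeasure_bounded_finite[OF bounded_cball, of "0::complex" R] by simp
  show ?thesis
  proof (rule set_integrable_bound[OF set_integral_add(1)[OF Lp_bounded[of R] one]])
    show "set_borel_measurable lebesgue (cball 0 R) (\<lambda>\<zeta>. norm (F \<zeta>))"
      unfolding set_borel_measurable_def by (intro borel_measurable_scaleR borel_measurable_indicator) auto
    have "x \<le> x powr p + 1" if "x \<ge> 0" for x :: real
    proof (cases "x \<ge> 1")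
      case True
      then show ?thesis using powr_mono[of 1 p x] p by simp
    qed (use p in \<open>simp add: add_increasing\<close>)
    then show "AE \<zeta> in lebesgue. \<zeta> \<in> cball 0 R \<longrightarrow> norm (norm (F \<zeta>)) \<le> norm (norm (F \<zeta>) powr p + 1)"
      by simp
  qed
qed

definition riesz_kernel :: "real \<Rightarrow> complex \<Rightarrow> complex \<Rightarrow> real" where
  "riesz_kernel s z \<zeta> = norm (F \<zeta>) * norm (\<zeta> - z) powr (- s)"

text \<open>Young's inequality bounds the product pointwise by a sum; the first summand does not
  depend on \<open>z\<close>, and the integral of the second is bounded uniformly in
  \<open>z\<close>.\<close>

lemma bounded_riesz_kernel_integrable:
  assumes s: "0 < s" "s \<le> 1 + \<alpha>"
  obtains C where "\<And>z. set_integrable lebesgue (cball 0 R) (riesz_kernel s z)"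
    "\<And>z. (LINT \<zeta>:cball 0 R|lebesgue. riesz_kernel s z \<zeta>) \<le> C"
proof -
  define q where "q = p / (p - 1)"
  have q: "q > 1" "1 / p + 1 / q = 1" "(1 + \<alpha>) * q < 2"
    using p by (auto simp: q_def \<alpha>_def field_simps)
  have "s * q \<le> (1 + \<alpha>) * q"
    using s q(1) by (intro mult_right_mono) auto
  then have "s * q < 2"
    using q(3) by (rule le_less_trans)
  moreover have "0 < s * q"
    using s q(1) by simp
  ultimately obtain C where C: "\<And>z::complex. set_integrable lebesgue (cball 0 R) (\<lambda>\<zeta>. norm (\<zeta> - z) powr (- (s * q)))"
    "\<And>z::complex. (LINT \<zeta>:cball 0 R|lebesgue. norm (\<zeta> - z) powr (- (s * q))) \<le> C"
    using integral_norm_powr_bound[of "s * q" R] by blast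
  let ?b = "\<lambda>z \<zeta>. norm (F \<zeta>) powr p / p + norm (\<zeta> - z) powr (- (s * q)) / q"
  have young: "riesz_kernel s z \<zeta> \<le> ?b z \<zeta>" for z \<zeta>
    using Youngs_inequality[of p q "norm (F \<zeta>)" "norm (\<zeta> - z) powr (- s)"] p q
    by (simp add: riesz_kernel_def powr_powr)
  have bi: "set_integrable lebesgue (cball 0 R) (?b z)" for z
    by (intro set_integral_add(1) set_integrable_divide Lp_bounded C(1))
  have int: "set_integrable lebesgue (cball 0 R) (riesz_kernel s z)" for z
  proof (rule set_integrable_bound[OF bi[of z]])
    show "set_borel_measurable lebesgue (cball 0 R) (riesz_kernel s z)"
      unfolding set_borel_measurable_def riesz_kernel_def
      by (intro borel_measurable_scaleR borel_measurable_indicator borel_measurable_times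
          borel_measurable_norm measurable_F measurable_completion[OF powr_real_measurable]) auto
    show "AE \<zeta> in lebesgue. \<zeta> \<in> cball 0 R \<longrightarrow> norm (riesz_kernel s z \<zeta>) \<le> norm (?b z \<zeta>)"
      using young by (intro AE_I2) (auto simp: riesz_kernel_def intro: order_trans[OF _ abs_ge_self])
  qed
  show ?thesis
  proof (rule that[OF int])
    fix z
    have "(LINT \<zeta>:cball 0 R|lebesgue. riesz_kernel s z \<zeta>) \<le> (LINT \<zeta>:cball 0 R|lebesgue. ?b z \<zeta>)"
      by (rule set_integral_mono[OF int bi young])
    also have "\<dots> = (LINT \<zeta>:cball 0 R|lebesgue. norm (F \<zeta>) powr p) / p
        + (LINT \<zeta>:cball 0 R|lebesgue. norm (\<zeta> - z) powr (- (s * q))) / q"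
      by (simp add: set_integral_add Lp_bounded C(1))
    also have "\<dots> \<le> (LINT \<zeta>:cball 0 R|lebesgue. norm (F \<zeta>) powr p) / p + C / q"
      using C(2)[of z] q(1) by (simp add: divide_right_mono)
    finally show "(LINT \<zeta>:cball 0 R|lebesgue. riesz_kernel s z \<zeta>)
        \<le> (LINT \<zeta>:cball 0 R|lebesgue. norm (F \<zeta>) powr p) / p + C / q" .
  qed
qed

lemma measurable_kernel [measurable]: "(\<lambda>\<zeta>. F \<zeta> / (\<zeta> - z)) \<in> borel_measurable lebesgue"
proof -
  have "(\<lambda>\<zeta>. 1 / (\<zeta> - z)) \<in> borel_measurable lebesgue"
    by (rule measurable_completion) measurable
  then show ?thesis
    using borel_measurable_times[OF measurable_F, of "\<lambda>\<zeta>. 1 / (\<zeta> - z)"] by simp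
qed

lemma bounded_Cauchy_integrable:
  obtains C where "\<And>z. set_integrable lebesgue (cball 0 R) (\<lambda>\<zeta>. F \<zeta> / (\<zeta> - z))"
    "\<And>z. (LINT \<zeta>:cball 0 R|lebesgue. norm (F \<zeta> / (\<zeta> - z))) \<le> C"
proof -
  obtain C where C: "\<And>z. set_integrable lebesgue (cball 0 R) (riesz_kernel 1 z)"
    "\<And>z. (LINT \<zeta>:cball 0 R|lebesgue. riesz_kernel 1 z \<zeta>) \<le> C"
    using bounded_riesz_kernel_integrable[of 1 R] \<alpha> by auto
  \<comment> \<open>At \<open>\<zeta> = z\<close> both sides are 0 by the conventions for division
    by 0 and for \<open>powr\<close> at 0.\<close>
  have eq: "norm (F \<zeta> / (\<zeta> - z)) = riesz_kernel 1 z \<zeta>" for z \<zeta>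
    by (cases "\<zeta> = z") (auto simp: riesz_kernel_def norm_divide powr_minus_divide)
  have "set_integrable lebesgue (cball 0 R) (\<lambda>\<zeta>. F \<zeta> / (\<zeta> - z))" for z
  proof (rule set_integrable_bound[OF C(1)[of z]])
    show "set_borel_measurable lebesgue (cball 0 R) (\<lambda>\<zeta>. F \<zeta> / (\<zeta> - z))"
      unfolding set_borel_measurable_def by (intro borel_measurable_scaleR borel_measurable_indicator measurable_kernel) auto
    show "AE \<zeta> in lebesgue. \<zeta> \<in> cball 0 R \<longrightarrow> norm (F \<zeta> / (\<zeta> - z)) \<le> norm (riesz_kernel 1 z \<zeta>)"
      unfolding eq by (intro AE_I2) (simp add: abs_ge_self)
  qed
  then show ?thesis
    using that C(2) unfolding eq by blast
qed

lemma Cauchy_integrable: "set_integrable lebesgue (cball 0 R) (\<lambda>\<zeta>. F \<zeta> / (\<zeta> - z))"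
  by (rule bounded_Cauchy_integrable)

definition cauchy_part :: "real \<Rightarrow> complex \<Rightarrow> complex" where
  "cauchy_part R z = (LINT \<zeta>:cball 0 R|lebesgue. F \<zeta> / (\<zeta> - z))"

lemma AE_lebesgue_neq: "AE \<zeta> in lebesgue. \<zeta> \<noteq> (z::complex)"
  using AE_lborel_singleton[of z] by (rule AE_completion)

text \<open>Hoelder continuity of order \<open>\<alpha>\<close>: the difference of two kernels
  yields a factor \<open>|w - z| powr \<alpha>\<close> and leaves kernels of order
  \<open>1 + \<alpha>\<close>, whose integrals against \<open>|F|\<close> are bounded uniformly in
  \<open>z\<close>.\<close>

lemma continuous_cauchy_part: "continuous_on UNIV (cauchy_part R)"
proof -
  obtain C where C: "\<And>z. set_integrable lebesgue (cball 0 R) (riesz_kernel (1 + \<alpha>) z)"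
    "\<And>z. (LINT \<zeta>:cball 0 R|lebesgue. riesz_kernel (1 + \<alpha>) z \<zeta>) \<le> C"
    using bounded_riesz_kernel_integrable[of "1 + \<alpha>" R] \<alpha> by auto
  have hoelder: "norm (cauchy_part R w - cauchy_part R z) \<le> 2 * norm (w - z) powr \<alpha> * (C + C)" for z w
  proof -
    let ?b = "\<lambda>\<zeta>. 2 * norm (w - z) powr \<alpha> * (riesz_kernel (1 + \<alpha>) w \<zeta> + riesz_kernel (1 + \<alpha>) z \<zeta>)"
    have bi: "set_integrable lebesgue (cball 0 R) ?b"
      using C(1) by (intro set_integrable_mult_right set_integral_add(1))
    have di: "set_integrable lebesgue (cball 0 R) (\<lambda>\<zeta>. F \<zeta> / (\<zeta> - w) - F \<zeta> / (\<zeta> - z))"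
      by (intro set_integral_diff(1) Cauchy_integrable)
    have "norm (cauchy_part R w - cauchy_part R z)
        = norm (LINT \<zeta>:cball 0 R|lebesgue. F \<zeta> / (\<zeta> - w) - F \<zeta> / (\<zeta> - z))"
      unfolding cauchy_part_def by (simp add: set_integral_diff(2) Cauchy_integrable)
    also have "\<dots> \<le> (LINT \<zeta>:cball 0 R|lebesgue. norm (F \<zeta> / (\<zeta> - w) - F \<zeta> / (\<zeta> - z)))"
      using di by (rule set_integral_norm_bound)
    also have "\<dots> \<le> (LINT \<zeta>:cball 0 R|lebesgue. ?b \<zeta>)"
    proof (rule set_integral_mono_AE[OF set_integrable_norm[OF di] bi])
      show "AE \<zeta>\<in>cball 0 R in lebesgue. norm (F \<zeta> / (\<zeta> - w) - F \<zeta> / (\<zeta> - z)) \<le> ?b \<zeta>"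
        using AE_lebesgue_neq[of w] AE_lebesgue_neq[of z]
      proof eventually_elim
        case (elim \<zeta>)
        have "norm (F \<zeta> / (\<zeta> - w) - F \<zeta> / (\<zeta> - z)) = norm (F \<zeta>) * norm (1 / (\<zeta> - w) - 1 / (\<zeta> - z))"
          by (simp add: right_diff_distrib flip: norm_mult)
        also have "\<dots> \<le> norm (F \<zeta>) * (2 * norm ((\<zeta> - w) - (\<zeta> - z)) powr \<alpha>
            * (norm (\<zeta> - w) powr (- (1 + \<alpha>)) + norm (\<zeta> - z) powr (- (1 + \<alpha>))))"
          using elim \<alpha> by (intro mult_left_mono norm_inverse_diff_bound) auto
        also have "\<dots> = ?b \<zeta>"
          by (simp add: riesz_kernel_def norm_minus_commute algebra_simps)
        finally show ?case by simp
      qed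
    qed
    also have "\<dots> = 2 * norm (w - z) powr \<alpha> * ((LINT \<zeta>:cball 0 R|lebesgue. riesz_kernel (1 + \<alpha>) w \<zeta>) + (LINT \<zeta>:cball 0 R|lebesgue. riesz_kernel (1 + \<alpha>) z \<zeta>))"
      by (simp only: set_integral_mult_right set_integral_add(2)[OF C(1) C(1)])
    also have "\<dots> \<le> 2 * norm (w - z) powr \<alpha> * (C + C)"
      using C(2) by (intro mult_left_mono add_mono) auto
    finally show ?thesis .
  qed
  have "((cauchy_part R) \<longlongrightarrow> cauchy_part R z) (at z)" for z
  proof (rule LIM_zero_cancel, rule Lim_null_comparison)
    show "\<forall>\<^sub>F w in at z. norm (cauchy_part R w - cauchy_part R z) \<le> 2 * norm (w - z) powr \<alpha> * (C + C)"
      using hoelder by simp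
    have "((\<lambda>w. norm (w - z)) \<longlongrightarrow> 0) (at z)"
      using tendsto_norm_zero[OF LIM_zero[OF tendsto_ident_at]] .
    then have "((\<lambda>w. norm (w - z) powr \<alpha>) \<longlongrightarrow> 0 powr \<alpha>) (at z)"
      by (rule tendsto_powr2[OF _ tendsto_const]) (use \<alpha> in auto)
    then have "((\<lambda>w. 2 * norm (w - z) powr \<alpha> * (C + C)) \<longlongrightarrow> 2 * 0 powr \<alpha> * (C + C)) (at z)"
      by (intro tendsto_mult tendsto_const)
    then show "((\<lambda>w. 2 * norm (w - z) powr \<alpha> * (C + C)) \<longlongrightarrow> 0) (at z)"
      by simp
  qed
  then show ?thesis
    by (simp add: continuous_on_def)
qed

end

subsection \<open>The operator \<open>T\<close>\<close>

text \<open>\<open>g\<close> is bounded on the compact set of points above the support of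
  \<open>\<phi>\<close> with height at most 1, so dominated convergence applies.\<close>

lemma continuous_boundary_pairing:
  fixes \<phi> :: "real \<Rightarrow> complex"
  assumes g: "continuous_on UNIV g" and \<phi>: "\<phi> \<in> test_functions UNIV"
  shows "integrable lebesgue (\<lambda>t. g (Complex t s) * \<phi> t)"
    and "((\<lambda>s. LINT t|lebesgue. g (Complex t s) * \<phi> t) \<longlongrightarrow> (LINT t|lebesgue. g (of_real t) * \<phi> t)) (at_right 0)"
proof -
  obtain K where K: "compact K" "\<And>t. t \<notin> K \<Longrightarrow> \<phi> t = 0"
    using \<phi> by (auto simp: test_functions_def)
  have c: "continuous_on UNIV (\<lambda>t. g (Complex t s) * \<phi> t)" for s
    by (intro continuous_intros test_functions_continuous_on[OF \<phi>] continuous_on_compose2[OF g])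
      (auto simp: Complex_eq intro!: continuous_intros)
  show i: "integrable lebesgue (\<lambda>t. g (Complex t s) * \<phi> t)" for s
    by (rule integrable_lebesgue_compact_support[OF c K(1)]) (simp add: K)
  have \<phi>i: "integrable lebesgue \<phi>"
    by (rule integrable_lebesgue_compact_support[OF test_functions_continuous_on[OF \<phi>] K])
  have "compact ((\<lambda>(t, s). Complex t s) ` (K \<times> {0..1}))"
    by (intro compact_continuous_image compact_Times K(1))
      (auto simp: Complex_eq split_beta intro!: continuous_intros)
  then have "compact (g ` (\<lambda>(t, s). Complex t s) ` (K \<times> {0..1}))"
    using compact_continuous_image continuous_on_subset[OF g] by blast
  then obtain B where B: "\<And>y. y \<in> g ` (\<lambda>(t, s). Complex t s) ` (K \<times> {0..1}) \<Longrightarrow> norm y \<le> B"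
    using compact_imp_bounded bounded_iff by metis
  have bd: "norm (g (Complex t s) * \<phi> t) \<le> B * norm (\<phi> t)" if "0 \<le> s" "s \<le> 1" for t s
  proof (cases "t \<in> K")
    case True
    then have "norm (g (Complex t s)) \<le> B"
      using that by (intro B) force
    then show ?thesis
      by (simp add: norm_mult mult_right_mono)
  qed (simp add: K)
  show "((\<lambda>s. LINT t|lebesgue. g (Complex t s) * \<phi> t) \<longlongrightarrow> (LINT t|lebesgue. g (of_real t) * \<phi> t)) (at_right 0)"
  proof (rule tendsto_at_right_sequentially[of 0 1])
    fix S :: "nat \<Rightarrow> real" assume S: "\<And>n. 0 < S n" "\<And>n. S n < 1" "S \<longlonglongrightarrow> 0"
    show "(\<lambda>n. LINT t|lebesgue. g (Complex t (S n)) * \<phi> t) \<longlonglongrightarrow> (LINT t|lebesgue. g (of_real t) * \<phi> t)"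
    proof (rule integral_dominated_convergence[where w="\<lambda>t. B * norm (\<phi> t)"])
      show "AE t in lebesgue. norm (g (Complex t (S n)) * \<phi> t) \<le> B * norm (\<phi> t)" for n
        using bd[of "S n"] S(1,2)[of n] by simp
      have "(\<lambda>n. g (Complex t (S n))) \<longlonglongrightarrow> g (of_real t)" for t
      proof -
        have "(\<lambda>n. of_real t + \<i> * of_real (S n)) \<longlonglongrightarrow> of_real t + \<i> * of_real 0"
          by (intro tendsto_intros S)
        then show ?thesis
          using g by (intro isCont_tendsto_compose[of _ g]) (auto simp: continuous_on_eq_continuous_at Complex_eq)
      qed
      then show "AE t in lebesgue. (\<lambda>n. g (Complex t (S n)) * \<phi> t) \<longlonglongrightarrow> g (of_real t) * \<phi> t"
        by (intro AE_I2 tendsto_mult tendsto_const)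
      show "(\<lambda>t. g (of_real t) * \<phi> t) \<in> borel_measurable lebesgue"
        using borel_measurable_integrable[OF i[of 0]] by (simp add: Complex_eq)
      show "(\<lambda>t. g (Complex t (S n)) * \<phi> t) \<in> borel_measurable lebesgue" for n
        using borel_measurable_integrable[OF i] .
    qed (use \<phi>i in simp)
  qed simp
qed

lemma sigma_finite_lebesgue: "sigma_finite_measure (lebesgue :: 'a::euclidean_space measure)"
proof
  let ?A = "range (\<lambda>n. cball (0::'a) (real n))"
  have "\<Union>?A = space lebesgue"
    using real_arch_simple by auto
  moreover have "emeasure lebesgue a \<noteq> \<infinity>" if a: "a \<in> ?A" for a
  proof -
    obtain n where "a = cball 0 (real n)"
      using a by blast
    then show ?thesis
      using emeasure_bounded_finite[OF bounded_cball, of "0::'a" "real n"] by simp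
  qed
  ultimately show "\<exists>A. countable A \<and> A \<subseteq> sets (lebesgue :: 'a measure) \<and> \<Union>A = space lebesgue \<and> (\<forall>a\<in>A. emeasure lebesgue a \<noteq> \<infinity>)"
    by (intro exI[of _ ?A]) auto
qed

context Lp_density
begin

lemma measurable_T_integrand: "T_integrand F z \<in> borel_measurable lebesgue"
proof -
  have c: "cnj \<in> borel_measurable borel"
    by (intro borel_measurable_continuous_onI continuous_intros)
  have "(\<lambda>\<zeta>. 1 / (\<zeta> - w) - \<zeta> / (\<zeta>\<^sup>2 + 1)) \<in> borel_measurable lebesgue" for w :: complex
    by (rule measurable_completion) measurable
  then have m: "(\<lambda>\<zeta>. F \<zeta> * (1 / (\<zeta> - w) - \<zeta> / (\<zeta>\<^sup>2 + 1))) \<in> borel_measurable lebesgue" for w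
    by (intro borel_measurable_times measurable_F)
  show ?thesis
    unfolding T_integrand_eq[abs_def] by (intro borel_measurable_diff m measurable_compose[OF m c])
qed

text \<open>At \<open>\<i>\<close> only \<open>F \<zeta> / (\<zeta>\<^sup>2 + 1)\<close> and its
  conjugate occur; since \<open>|\<zeta> + \<i>| \<ge> 1\<close> on the upper half-plane, the Cauchy
  kernel at \<open>\<i>\<close> dominates both. The general \<open>z\<close> is then reduced to this
  one.\<close>

lemma near_T_integrand_i: "set_integrable lebesgue (cball 0 R) (T_integrand F \<i>)"
  unfolding set_integrable_def
proof (rule Bochner_Integration.integrable_bound)
  let ?q = "\<lambda>\<zeta>. indicat_real (cball 0 R) \<zeta> *\<^sub>R (F \<zeta> / (\<zeta> - \<i>))"
  show "integrable lebesgue (\<lambda>\<zeta>. 2 * norm (?q \<zeta>))"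
    by (intro integrable_mult_right integrable_norm Cauchy_integrable[unfolded set_integrable_def])
  show "(\<lambda>\<zeta>. indicat_real (cball 0 R) \<zeta> *\<^sub>R T_integrand F \<i> \<zeta>) \<in> borel_measurable lebesgue"
    by (intro borel_measurable_scaleR borel_measurable_indicator measurable_T_integrand) auto
  show "AE \<zeta> in lebesgue. norm (indicat_real (cball 0 R) \<zeta> *\<^sub>R T_integrand F \<i> \<zeta>) \<le> norm (2 * norm (?q \<zeta>))"
    using AE_lebesgue_neq[of \<i>] AE_lebesgue_neq[of "- \<i>"]
  proof eventually_elim
    case (elim \<zeta>)
    have "norm (F \<zeta> / (\<zeta>\<^sup>2 + 1)) \<le> norm (F \<zeta> / (\<zeta> - \<i>))"
    proof (cases "\<zeta> \<in> upper_hp")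
      case True
      then have "1 \<le> \<bar>Im (\<zeta> + \<i>)\<bar>"
        by (simp add: upper_hp_def)
      then have "1 \<le> norm (\<zeta> + \<i>)"
        using abs_Im_le_cmod order_trans by blast
      then have "norm (F \<zeta> / (\<zeta> - \<i>)) / norm (\<zeta> + \<i>) \<le> norm (F \<zeta> / (\<zeta> - \<i>)) / 1"
        by (intro divide_left_mono) auto
      moreover have "F \<zeta> / (\<zeta>\<^sup>2 + 1) = F \<zeta> / (\<zeta> - \<i>) / (\<zeta> + \<i>)"
        by (simp add: power2_eq_square algebra_simps)
      ultimately show ?thesis
        by (simp only: norm_divide[of _ "\<zeta> + \<i>"] div_by_1)
    qed (simp add: zero_outside)
    then have "norm (T_integrand F \<i> \<zeta>) \<le> 2 * norm (F \<zeta> / (\<zeta> - \<i>))"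
      unfolding T_integrand_at_i[OF elim] norm_mult
      using norm_triangle_ineq4[of "F \<zeta> / (\<zeta>\<^sup>2 + 1)" "cnj (F \<zeta> / (\<zeta>\<^sup>2 + 1))"]
      by (simp only: complex_mod_cnj norm_ii)
    then show ?case
      by (simp add: indicator_def)
  qed
qed

text \<open>The terms \<open>\<zeta> / (\<zeta>\<^sup>2 + 1)\<close> cancel in differences of values of the integrand.\<close>

lemma near_T_integrand:
  shows "set_integrable lebesgue (cball 0 R) (T_integrand F z)"
    and "\<exists>C. \<forall>z. (LINT \<zeta>:cball 0 R|lebesgue. norm (T_integrand F z \<zeta>)) \<le> C"
    and "(LINT \<zeta>:cball 0 R|lebesgue. T_integrand F z \<zeta>) = (LINT \<zeta>:cball 0 R|lebesgue. T_integrand F \<i> \<zeta>)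
      + (cauchy_part R z - cauchy_part R \<i>) - cnj (cauchy_part R (cnj z) - cauchy_part R (- \<i>))"
proof -
  obtain C where C: "\<And>z. (LINT \<zeta>:cball 0 R|lebesgue. norm (F \<zeta> / (\<zeta> - z))) \<le> C"
    using bounded_Cauchy_integrable by blast
  define d where "d w v \<zeta> = F \<zeta> / (\<zeta> - w) - F \<zeta> / (\<zeta> - v)" for w v \<zeta>
  have T: "T_integrand F z = (\<lambda>\<zeta>. T_integrand F \<i> \<zeta> + d z \<i> \<zeta> - cnj (d (cnj z) (- \<i>) \<zeta>))" for z
    by (simp add: T_integrand_eq d_def fun_eq_iff algebra_simps)
  have di: "set_integrable lebesgue (cball 0 R) (d w v)" for w v
    unfolding d_def by (intro set_integral_diff(1) Cauchy_integrable)
  have cdi: "set_integrable lebesgue (cball 0 R) (\<lambda>\<zeta>. cnj (d w v \<zeta>))" for w v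
    using integrable_cnj[OF di[unfolded set_integrable_def]] unfolding set_integrable_def by simp
  have cdL: "(LINT \<zeta>:cball 0 R|lebesgue. cnj (d w v \<zeta>)) = cnj (cauchy_part R w - cauchy_part R v)" for w v
  proof -
    have "(\<lambda>\<zeta>. indicat_real (cball 0 R) \<zeta> *\<^sub>R cnj (d w v \<zeta>)) = (\<lambda>\<zeta>. cnj (indicat_real (cball 0 R) \<zeta> *\<^sub>R d w v \<zeta>))"
      by simp
    then have "(LINT \<zeta>:cball 0 R|lebesgue. cnj (d w v \<zeta>)) = cnj (LINT \<zeta>:cball 0 R|lebesgue. d w v \<zeta>)"
      unfolding set_lebesgue_integral_def by (simp only: Bochner_Integration.integral_cnj)
    then show ?thesis
      unfolding d_def cauchy_part_def by (simp only: set_integral_diff(2)[OF Cauchy_integrable Cauchy_integrable])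
  qed
  note i = near_T_integrand_i[of R]
  have Ti: "set_integrable lebesgue (cball 0 R) (T_integrand F z)" for z
    unfolding T[of z] by (intro set_integral_diff(1) set_integral_add(1) i di cdi)
  show "set_integrable lebesgue (cball 0 R) (T_integrand F z)"
    by (rule Ti)
  show "(LINT \<zeta>:cball 0 R|lebesgue. T_integrand F z \<zeta>) = (LINT \<zeta>:cball 0 R|lebesgue. T_integrand F \<i> \<zeta>)
      + (cauchy_part R z - cauchy_part R \<i>) - cnj (cauchy_part R (cnj z) - cauchy_part R (- \<i>))"
    unfolding T[of z] set_integral_diff(2)[OF set_integral_add(1)[OF i di] cdi] set_integral_add(2)[OF i di] cdL
    unfolding d_def[abs_def] cauchy_part_def by (simp only: set_integral_diff(2)[OF Cauchy_integrable Cauchy_integrable])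
  let ?n = "\<lambda>w \<zeta>. norm (F \<zeta> / (\<zeta> - w))"
  let ?b = "\<lambda>z \<zeta>. norm (T_integrand F \<i> \<zeta>) + (?n z \<zeta> + ?n \<i> \<zeta>) + (?n (cnj z) \<zeta> + ?n (- \<i>) \<zeta>)"
  have ni: "set_integrable lebesgue (cball 0 R) (?n w)" for w
    by (intro set_integrable_norm Cauchy_integrable)
  have "(LINT \<zeta>:cball 0 R|lebesgue. norm (T_integrand F z \<zeta>))
      \<le> (LINT \<zeta>:cball 0 R|lebesgue. norm (T_integrand F \<i> \<zeta>)) + (C + C) + (C + C)" for z
  proof -
    have "norm (d w v \<zeta>) \<le> ?n w \<zeta> + ?n v \<zeta>" for w v \<zeta>
      unfolding d_def by (rule norm_triangle_ineq4)
    then have le: "norm (T_integrand F z \<zeta>) \<le> ?b z \<zeta>" for \<zeta>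
      unfolding T[of z] using norm_triangle_ineq4[of "T_integrand F \<i> \<zeta> + d z \<i> \<zeta>" "cnj (d (cnj z) (- \<i>) \<zeta>)"]
        norm_triangle_ineq[of "T_integrand F \<i> \<zeta>" "d z \<i> \<zeta>"] by (smt (verit) complex_mod_cnj)
    have "(LINT \<zeta>:cball 0 R|lebesgue. norm (T_integrand F z \<zeta>)) \<le> (LINT \<zeta>:cball 0 R|lebesgue. ?b z \<zeta>)"
      by (rule set_integral_mono[OF _ _ le]) (intro set_integrable_norm set_integral_add(1) ni Ti)+
    also have "\<dots> \<le> (LINT \<zeta>:cball 0 R|lebesgue. norm (T_integrand F \<i> \<zeta>)) + (C + C) + (C + C)"
      by (simp only: set_integral_add set_integrable_norm[OF i] ni) (intro add_mono C order_refl)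
    finally show ?thesis .
  qed
  then show "\<exists>C. \<forall>z. (LINT \<zeta>:cball 0 R|lebesgue. norm (T_integrand F z \<zeta>)) \<le> C"
    by blast
qed

lemma T_op_eq: "T_op F z = - of_real (1 / pi) * (LINT \<zeta>|lebesgue. T_integrand F z \<zeta>)"
proof -
  have "(\<lambda>\<zeta>. indicat_real upper_hp \<zeta> *\<^sub>R T_integrand F z \<zeta>) = T_integrand F z"
    using zero_outside by (auto simp: T_integrand_def indicator_def fun_eq_iff)
  then show ?thesis
    unfolding T_op_def set_lebesgue_integral_def by simp
qed

end

text \<open>The class preserved by \<open>T_op\<close> as long as the next integral exists.
  Existence is asked for \<open>z\<close> in the half-plane only, as in
  \<open>schwarz_formula_defined\<close>; it is extended to all \<open>z\<close> below.\<close>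

locale schwarz_density = Lp_density +
  assumes T_defined: "\<And>z. z \<in> upper_hp \<Longrightarrow> integrable lebesgue (T_integrand F z)"
begin

text \<open>Integrable because \<open>\<i>\<close> and \<open>2 * \<i>\<close> lie in the
  half-plane, where \<open>T_defined\<close> applies.\<close>

definition majorant :: "complex \<Rightarrow> real" where
  "majorant \<zeta> = norm (T_integrand F \<i> \<zeta>) + norm (T_integrand F (2 * \<i>) \<zeta>)"

lemma far_T_integrand:
  assumes "R \<ge> 2" "norm z \<le> R"
  shows "norm (indicat_real (- cball 0 (2 * R)) \<zeta> *\<^sub>R T_integrand F z \<zeta>)
      \<le> (R + 33 * (1 + R\<^sup>2)) * majorant \<zeta>"
  using T_integrand_far_bound[OF assms, of \<zeta> F] assms(1) by (auto simp: indicator_def majorant_def)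

lemma far_majorant_integrable:
  "integrable lebesgue (\<lambda>\<zeta>. c * majorant \<zeta>)"
  unfolding majorant_def by (intro integrable_mult_right Bochner_Integration.integrable_add integrable_norm T_defined)
    (auto simp: upper_hp_def)

lemma far_measurable:
  "(\<lambda>\<zeta>. indicat_real (- cball 0 r) \<zeta> *\<^sub>R T_integrand F z \<zeta>) \<in> borel_measurable lebesgue"
  by (intro borel_measurable_scaleR borel_measurable_indicator measurable_T_integrand) auto

lemma far_integrable:
  assumes "R \<ge> 2" "norm z \<le> R"
  shows "set_integrable lebesgue (- cball 0 (2 * R)) (T_integrand F z)"
  unfolding set_integrable_def
proof (rule Bochner_Integration.integrable_bound[OF far_majorant_integrable far_measurable], rule AE_I2)
  show "norm (indicat_real (- cball 0 (2 * R)) \<zeta> *\<^sub>R T_integrand F z \<zeta>)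
      \<le> norm ((R + 33 * (1 + R\<^sup>2)) * majorant \<zeta>)" for \<zeta>
    using far_T_integrand[OF assms, of \<zeta>] by (metis abs_ge_self order_trans real_norm_def)
qed

lemma T_integrand_split:
  assumes "R \<ge> 2" "norm z \<le> R"
  shows "integrable lebesgue (T_integrand F z)"
    and "(LINT \<zeta>|lebesgue. T_integrand F z \<zeta>)
      = (LINT \<zeta>:cball 0 (2 * R)|lebesgue. T_integrand F z \<zeta>) + (LINT \<zeta>:- cball 0 (2 * R)|lebesgue. T_integrand F z \<zeta>)"
    and "(LINT \<zeta>|lebesgue. norm (T_integrand F z \<zeta>))
      = (LINT \<zeta>:cball 0 (2 * R)|lebesgue. norm (T_integrand F z \<zeta>)) + (LINT \<zeta>:- cball 0 (2 * R)|lebesgue. norm (T_integrand F z \<zeta>))"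
proof -
  have near: "set_integrable lebesgue (cball 0 (2 * R)) (T_integrand F z)"
    by (rule near_T_integrand(1))
  note i = near[unfolded set_integrable_def] far_integrable[OF assms, unfolded set_integrable_def]
  note ni = set_integrable_norm[OF near, unfolded set_integrable_def]
    set_integrable_norm[OF far_integrable[OF assms], unfolded set_integrable_def]
  have eq: "g \<zeta> = indicat_real (cball 0 (2 * R)) \<zeta> *\<^sub>R g \<zeta> + indicat_real (- cball 0 (2 * R)) \<zeta> *\<^sub>R g \<zeta>"
    for g :: "complex \<Rightarrow> 'b::real_normed_vector" and \<zeta>
    by (auto simp: indicator_def)
  show "integrable lebesgue (T_integrand F z)"
    by (subst eq[abs_def]) (intro Bochner_Integration.integrable_add i)
  show "(LINT \<zeta>|lebesgue. T_integrand F z \<zeta>)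
      = (LINT \<zeta>:cball 0 (2 * R)|lebesgue. T_integrand F z \<zeta>) + (LINT \<zeta>:- cball 0 (2 * R)|lebesgue. T_integrand F z \<zeta>)"
    unfolding set_lebesgue_integral_def Bochner_Integration.integral_add[OF i, symmetric] eq[symmetric] ..
  show "(LINT \<zeta>|lebesgue. norm (T_integrand F z \<zeta>))
      = (LINT \<zeta>:cball 0 (2 * R)|lebesgue. norm (T_integrand F z \<zeta>)) + (LINT \<zeta>:- cball 0 (2 * R)|lebesgue. norm (T_integrand F z \<zeta>))"
    unfolding set_lebesgue_integral_def Bochner_Integration.integral_add[OF ni, symmetric]
    by (intro Bochner_Integration.integral_cong refl eq)
qed

text \<open>The near part converges for every \<open>Lp_density\<close>, and the far part is
  dominated by \<open>majorant\<close>. This includes the real \<open>z\<close>, at which the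
  boundary condition is read off.\<close>

lemma integrable_T_integrand: "integrable lebesgue (T_integrand F z)"
  by (rule T_integrand_split(1)[of "max 2 (norm z)"]) auto

text \<open>Local uniformity in \<open>z\<close> provides the integrability on the product space for
  Fubini's theorem.\<close>

lemma T_integrand_norm_bound:
  obtains C where "\<And>z. norm z \<le> R \<Longrightarrow> (LINT \<zeta>|lebesgue. norm (T_integrand F z \<zeta>)) \<le> C"
proof -
  define S where "S = max 2 R"
  have S: "S \<ge> 2" "R \<le> S" by (auto simp: S_def)
  obtain C where C: "\<And>z. (LINT \<zeta>:cball 0 (2 * S)|lebesgue. norm (T_integrand F z \<zeta>)) \<le> C"
    using near_T_integrand(2) by blast
  let ?w = "\<lambda>\<zeta>. (S + 33 * (1 + S\<^sup>2)) * majorant \<zeta>"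
  show ?thesis
  proof (rule that[of "C + (LINT \<zeta>|lebesgue. ?w \<zeta>)"])
    fix z :: complex assume "norm z \<le> R"
    then have z: "norm z \<le> S" using S by simp
    have "(LINT \<zeta>:- cball 0 (2 * S)|lebesgue. norm (T_integrand F z \<zeta>)) \<le> (LINT \<zeta>|lebesgue. ?w \<zeta>)"
      unfolding set_lebesgue_integral_def
    proof (rule integral_mono[OF _ far_majorant_integrable])
      show "integrable lebesgue (\<lambda>\<zeta>. indicat_real (- cball 0 (2 * S)) \<zeta> *\<^sub>R norm (T_integrand F z \<zeta>))"
        using set_integrable_norm[OF far_integrable[OF S(1) z]] unfolding set_integrable_def .
      show "indicat_real (- cball 0 (2 * S)) \<zeta> *\<^sub>R norm (T_integrand F z \<zeta>) \<le> ?w \<zeta>" for \<zeta>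
        using far_T_integrand[OF S(1) z, of \<zeta>] by simp
    qed
    then show "(LINT \<zeta>|lebesgue. norm (T_integrand F z \<zeta>)) \<le> C + (LINT \<zeta>|lebesgue. ?w \<zeta>)"
      unfolding T_integrand_split(3)[OF S(1) z] using C[of z] by linarith
  qed
qed

text \<open>For \<open>z\<close> in a fixed disk the near part is a constant plus Cauchy transforms
  and conjugates of such, and the far part has a majorant independent of \<open>z\<close>; the disks
  exhaust the plane.\<close>

lemma continuous_T_op: "continuous_on UNIV (T_op F)"
proof -
  have "continuous_on (ball 0 R) (\<lambda>z. LINT \<zeta>|lebesgue. T_integrand F z \<zeta>)" if R: "R \<ge> 2" for R
  proof -
    let ?near = "\<lambda>z. LINT \<zeta>:cball 0 (2 * R)|lebesgue. T_integrand F z \<zeta>"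
    let ?far = "\<lambda>z. LINT \<zeta>:- cball 0 (2 * R)|lebesgue. T_integrand F z \<zeta>"
    have "?near = (\<lambda>z. (LINT \<zeta>:cball 0 (2 * R)|lebesgue. T_integrand F \<i> \<zeta>)
      + (cauchy_part (2 * R) z - cauchy_part (2 * R) \<i>) - cnj (cauchy_part (2 * R) (cnj z) - cauchy_part (2 * R) (- \<i>)))"
      by (intro ext near_T_integrand(3))
    then have near: "continuous_on (ball 0 R) ?near"
      by (simp only:) (intro continuous_intros continuous_on_compose2[OF continuous_cauchy_part], auto)
    have far: "continuous_on (ball 0 R) ?far"
      unfolding continuous_on_sequentially o_def set_lebesgue_integral_def
    proof (intro allI ballI impI, elim conjE)
      fix x :: "nat \<Rightarrow> complex" and z assume z: "z \<in> ball 0 R" and x: "\<forall>n. x n \<in> ball 0 R" "x \<longlonglongrightarrow> z"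
      show "(\<lambda>n. LINT \<zeta>|lebesgue. indicat_real (- cball 0 (2 * R)) \<zeta> *\<^sub>R T_integrand F (x n) \<zeta>)
        \<longlonglongrightarrow> (LINT \<zeta>|lebesgue. indicat_real (- cball 0 (2 * R)) \<zeta> *\<^sub>R T_integrand F z \<zeta>)"
      proof (rule integral_dominated_convergence[OF far_measurable far_measurable far_majorant_integrable])
        show "AE \<zeta> in lebesgue. norm (indicat_real (- cball 0 (2 * R)) \<zeta> *\<^sub>R T_integrand F (x n) \<zeta>)
          \<le> (R + 33 * (1 + R\<^sup>2)) * majorant \<zeta>" for n
          using far_T_integrand[OF R, of "x n"] x by (auto simp: less_imp_le)
        show "AE \<zeta> in lebesgue. (\<lambda>n. indicat_real (- cball 0 (2 * R)) \<zeta> *\<^sub>R T_integrand F (x n) \<zeta>)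
          \<longlonglongrightarrow> indicat_real (- cball 0 (2 * R)) \<zeta> *\<^sub>R T_integrand F z \<zeta>"
        proof (rule AE_I2)
          fix \<zeta> :: complex
          show "(\<lambda>n. indicat_real (- cball 0 (2 * R)) \<zeta> *\<^sub>R T_integrand F (x n) \<zeta>)
            \<longlonglongrightarrow> indicat_real (- cball 0 (2 * R)) \<zeta> *\<^sub>R T_integrand F z \<zeta>"
          proof (cases "\<zeta> \<in> cball 0 (2 * R)")
            case False
            then have "norm \<zeta> > 2 * R"
              by simp
            then have "\<zeta> - z \<noteq> 0" "cnj \<zeta> - z \<noteq> 0"
              using z R by auto
            then show ?thesis
              unfolding T_integrand_def by (intro tendsto_intros x) auto
          qed (simp add: indicator_def)
        qed
      qed
    qed
    have "(\<lambda>z. LINT \<zeta>|lebesgue. T_integrand F z \<zeta>) z = ?near z + ?far z" if "z \<in> ball 0 R" for z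
      by (rule T_integrand_split(2)[OF R]) (use that in auto)
    then show ?thesis
      using continuous_on_add[OF near far] by (subst continuous_on_cong[OF refl]) auto
  qed
  then have "continuous_on (\<Union>R\<in>{2..}. ball 0 R) (\<lambda>z. LINT \<zeta>|lebesgue. T_integrand F z \<zeta>)"
    by (intro continuous_on_open_UN) auto
  moreover have "(\<Union>R\<in>{2..}. ball (0::complex) R) = UNIV"
  proof -
    have "z \<in> (\<Union>R\<in>{2..}. ball (0::complex) R)" for z
      by (rule UN_I[of "norm z + 2"]) auto
    then show ?thesis by blast
  qed
  ultimately show ?thesis
    unfolding T_op_eq[abs_def] by (intro continuous_intros) simp
qed

lemma Re_T_op_real:
  assumes "Im z = 0"
  shows "Re (T_op F z) = 0"
proof -
  have "cnj z = z"
    using assms by (simp add: complex_eq_iff)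
  moreover have "Re (w - cnj w) = 0" for w
    by simp
  ultimately have "Re (T_integrand F z \<zeta>) = 0" for \<zeta>
    unfolding T_integrand_eq by (simp only:)
  then have "Re (LINT \<zeta>|lebesgue. T_integrand F z \<zeta>) = 0"
    using integral_Re[OF integrable_T_integrand[of z]] by simp
  then show ?thesis
    by (simp add: T_op_eq)
qed

lemma Im_T_op_i: "Im (T_op F \<i>) = 0"
proof -
  have "(LINT \<zeta>|lebesgue. Im (T_integrand F \<i> \<zeta>)) = 0"
  proof (rule integral_eq_zero_AE)
    show "AE \<zeta> in lebesgue. Im (T_integrand F \<i> \<zeta>) = 0"
      using AE_lebesgue_neq[of \<i>] AE_lebesgue_neq[of "- \<i>"]
    proof eventually_elim
      case (elim \<zeta>)
      have "Im (\<i> * (w - cnj w)) = 0" for w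
        by simp
      then show ?case
        unfolding T_integrand_at_i[OF elim] .
    qed
  qed
  then have "Im (LINT \<zeta>|lebesgue. T_integrand F \<i> \<zeta>) = 0"
    using integral_Im[OF integrable_T_integrand[of \<i>]] by simp
  then show ?thesis
    by (simp add: T_op_eq)
qed

text \<open>Fubini's theorem and the Cauchy-Pompeiu formula; the conjugate kernel and the normalising
  terms do not contribute because \<open>\<phi>\<close> vanishes on the lower half-plane and \<open>dbar \<phi>\<close> has integral 0.\<close>

lemma integral_T_op_dbar:
  assumes \<phi>: "\<phi> \<in> test_functions upper_hp"
  shows "(LINT z|lebesgue. T_op F z * dbar \<phi> z) = - (LINT \<zeta>|lebesgue. F \<zeta> * \<phi> \<zeta>)"
proof -
  have \<phi>U: "\<phi> \<in> test_functions UNIV"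
    using \<phi> unfolding test_functions_def by blast
  obtain K where K: "compact K" "K \<subseteq> upper_hp" "\<And>z. z \<notin> K \<Longrightarrow> \<phi> z = 0"
    using test_functions_support[OF \<phi>] by metis
  have d\<phi>: "dbar \<phi> \<in> test_functions upper_hp"
    by (rule test_functions_dbar[OF \<phi>])
  obtain K' where K': "compact K'" "K' \<subseteq> upper_hp" "\<And>z. z \<notin> K' \<Longrightarrow> dbar \<phi> z = 0"
    using test_functions_support[OF d\<phi>] by metis
  have d\<phi>i: "integrable lebesgue (dbar \<phi>)"
    by (rule integrable_lebesgue_compact_support[OF test_functions_continuous_on[OF d\<phi>] K'(1,3)])
  have d\<phi>0: "(LINT z|lebesgue. dbar \<phi> z) = 0"
    by (rule integral_dbar_eq_0(2)[OF test_functions_has_derivative[OF \<phi>] _ _ K(1,3)])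
      (intro test_functions_continuous_on[OF test_functions_frechet_derivative[OF \<phi>]])+
  obtain R where R: "K' \<subseteq> cball 0 R"
    using bounded_subset_ballD[OF compact_imp_bounded[OF K'(1)], of 0] ball_subset_cball by blast
  obtain C where C: "\<And>z. norm z \<le> R \<Longrightarrow> (LINT \<zeta>|lebesgue. norm (T_integrand F z \<zeta>)) \<le> C"
    using T_integrand_norm_bound by blast
  interpret P: pair_sigma_finite "lebesgue :: complex measure" "lebesgue :: complex measure"
    by (intro pair_sigma_finite.intro sigma_finite_lebesgue)
  let ?H = "\<lambda>z \<zeta>. T_integrand F z \<zeta> * dbar \<phi> z"
  have Hm: "(\<lambda>(z, \<zeta>). ?H z \<zeta>) \<in> borel_measurable (lebesgue \<Otimes>\<^sub>M lebesgue)"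
  proof -
    have [measurable]: "fst \<in> borel_measurable (lebesgue \<Otimes>\<^sub>M lebesgue)" "snd \<in> borel_measurable (lebesgue \<Otimes>\<^sub>M lebesgue)"
      using measurable_compose[OF measurable_fst[of lebesgue lebesgue] measurable_completion[OF measurable_ident]]
        measurable_compose[OF measurable_snd[of lebesgue lebesgue] measurable_completion[OF measurable_ident]]
      by (simp_all add: measurable_cong_sets[OF refl sets_lborel])
    have [measurable]: "(\<lambda>x. F (snd x)) \<in> borel_measurable (lebesgue \<Otimes>\<^sub>M lebesgue)"
      by (rule measurable_compose[OF measurable_snd measurable_F])
    have c [measurable]: "cnj \<in> borel_measurable borel"
      by (intro borel_measurable_continuous_onI continuous_intros)
    have [measurable]: "dbar \<phi> \<in> borel_measurable borel"
      by (rule borel_measurable_continuous_onI[OF test_functions_continuous_on[OF d\<phi>]])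
    show ?thesis
      unfolding T_integrand_def split_beta by measurable
  qed
  \<comment> \<open>\<open>C\<close> bounds the inner integrals for \<open>z\<close> in the support
    of \<open>dbar \<phi>\<close>, so the integral of the norm over \<open>\<zeta>\<close> is at
    most \<open>C * norm (dbar \<phi> z)\<close>, which is integrable in \<open>z\<close>.\<close>
  have Hi: "integrable (lebesgue \<Otimes>\<^sub>M lebesgue) (\<lambda>(z, \<zeta>). ?H z \<zeta>)"
  proof (rule P.Fubini_integrable[OF Hm])
    show "AE z in lebesgue. integrable lebesgue (\<lambda>\<zeta>. case (z, \<zeta>) of (z, \<zeta>) \<Rightarrow> ?H z \<zeta>)"
      using integrable_T_integrand by auto
    have m: "(\<lambda>z. LINT \<zeta>|lebesgue. norm (?H z \<zeta>)) \<in> borel_measurable lebesgue"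
      using Hm by (intro sigma_finite_measure.borel_measurable_lebesgue_integral[OF sigma_finite_lebesgue]) (auto simp: split_beta intro!: borel_measurable_norm)
    show "integrable lebesgue (\<lambda>z. LINT \<zeta>|lebesgue. norm (case (z, \<zeta>) of (z, \<zeta>) \<Rightarrow> ?H z \<zeta>))"
    proof (rule Bochner_Integration.integrable_bound[of _ "\<lambda>z. C * norm (dbar \<phi> z)"])
      show "AE z in lebesgue. norm (LINT \<zeta>|lebesgue. norm (case (z, \<zeta>) of (z, \<zeta>) \<Rightarrow> ?H z \<zeta>)) \<le> norm (C * norm (dbar \<phi> z))"
      proof (rule AE_I2)
        fix z
        have "(LINT \<zeta>|lebesgue. norm (?H z \<zeta>)) = (LINT \<zeta>|lebesgue. norm (T_integrand F z \<zeta>)) * norm (dbar \<phi> z)"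
          by (simp add: norm_mult)
        also have "\<dots> \<le> C * norm (dbar \<phi> z)"
        proof (cases "z \<in> K'")
          case True
          then show ?thesis
            using R by (intro mult_right_mono C) auto
        qed (simp add: K')
        finally have "(LINT \<zeta>|lebesgue. norm (?H z \<zeta>)) \<le> C * norm (dbar \<phi> z)" .
        moreover have "(LINT \<zeta>|lebesgue. norm (?H z \<zeta>)) \<ge> 0"
          by (intro Bochner_Integration.integral_nonneg) auto
        ultimately show "norm (LINT \<zeta>|lebesgue. norm (case (z, \<zeta>) of (z, \<zeta>) \<Rightarrow> ?H z \<zeta>)) \<le> norm (C * norm (dbar \<phi> z))"
          by simp
      qed
    qed (use m d\<phi>i in \<open>auto\<close>)
  qed
  have inner: "(LINT z|lebesgue. ?H z \<zeta>) = of_real pi * (F \<zeta> * \<phi> \<zeta>)" for \<zeta>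
  proof -
    have CP: "integrable lebesgue (\<lambda>z. dbar \<phi> z * (1 / (w - z) - c))"
      "(LINT z|lebesgue. dbar \<phi> z * (1 / (w - z) - c)) = of_real pi * \<phi> w" for w c
      using Cauchy_Pompeiu_test_function[OF \<phi>U, of w] d\<phi>i d\<phi>0 by (simp_all add: right_diff_distrib)
    have "(LINT z|lebesgue. ?H z \<zeta>) = (LINT z|lebesgue.
        F \<zeta> * (dbar \<phi> z * (1 / (\<zeta> - z) - \<zeta> / (\<zeta>\<^sup>2 + 1)))
        - cnj (F \<zeta>) * (dbar \<phi> z * (1 / (cnj \<zeta> - z) - cnj \<zeta> / ((cnj \<zeta>)\<^sup>2 + 1))))"
      unfolding T_integrand_def by (intro Bochner_Integration.integral_cong refl) (simp add: algebra_simps)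
    also have "\<dots> = F \<zeta> * (of_real pi * \<phi> \<zeta>) - cnj (F \<zeta>) * (of_real pi * \<phi> (cnj \<zeta>))"
      by (subst Bochner_Integration.integral_diff)
        (simp_all only: CP integrable_mult_right integral_mult_right_zero simp_thms)
    also have "cnj (F \<zeta>) * (of_real pi * \<phi> (cnj \<zeta>)) = 0"
    proof (cases "\<zeta> \<in> upper_hp")
      case True
      then have "cnj \<zeta> \<notin> upper_hp"
        by (simp add: upper_hp_def)
      then have "\<phi> (cnj \<zeta>) = 0"
        using K by blast
      then show ?thesis by simp
    qed (simp add: zero_outside)
    finally show ?thesis by simp
  qed
  have "(LINT z|lebesgue. T_op F z * dbar \<phi> z) = - of_real (1 / pi) * (LINT z|lebesgue. (LINT \<zeta>|lebesgue. ?H z \<zeta>))"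
    by (simp add: T_op_eq mult.assoc)
  also have "(LINT z|lebesgue. (LINT \<zeta>|lebesgue. ?H z \<zeta>)) = (LINT \<zeta>|lebesgue. (LINT z|lebesgue. ?H z \<zeta>))"
    by (rule P.Fubini_integral[OF Hi, symmetric])
  also have "- of_real (1 / pi) * \<dots> = - (LINT \<zeta>|lebesgue. F \<zeta> * \<phi> \<zeta>)"
    unfolding inner by simp
  finally show ?thesis .
qed

end

subsection \<open>Densities in \<open>L\<^bsup>p,2\<^esup>\<close>\<close>

lemma lebesgue_measure_preserving:
  fixes T :: "'a::euclidean_space \<Rightarrow> 'b::euclidean_space"
  assumes T: "T \<in> borel_measurable borel" and lborel: "distr lborel borel T = lborel"
  shows "T \<in> lebesgue \<rightarrow>\<^sub>M lebesgue" and "distr lebesgue lebesgue T = lebesgue"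
proof -
  have T': "T \<in> lborel \<rightarrow>\<^sub>M lborel"
    using T by simp
  have "distr lebesgue lborel T = distr lborel lborel T"
    by (rule distr_completion[OF T'])
  also have "\<dots> = lborel"
    using lborel by (simp cong: distr_cong)
  finally have eq: "distr lebesgue lborel T = lborel" .
  show "T \<in> lebesgue \<rightarrow>\<^sub>M lebesgue"
    by (rule completion.measurable_completion2) (use T' eq in \<open>auto intro: measurable_completion\<close>)
  show "distr lebesgue lebesgue T = lebesgue"
    using completion.completion_distr_eq[OF measurable_completion[OF T']] eq by simp
qed

text \<open>The change of variables formula involves the determinant of a matrix, so the plane is
  identified with \<open>real ^ 2\<close>; the identification preserves Lebesgue measure.\<close>

definition complex_of_vec :: "real ^ 2 \<Rightarrow> complex" where
  "complex_of_vec v = Complex (v $ 1) (v $ 2)"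

definition vec_of_complex :: "complex \<Rightarrow> real ^ 2" where
  "vec_of_complex z = vector [Re z, Im z]"

lemma vec_of_complex_of_vec [simp]: "vec_of_complex (complex_of_vec v) = v"
  by (simp add: vec_of_complex_def complex_of_vec_def vec_eq_iff forall_2)

lemma complex_of_vec_of_complex [simp]: "complex_of_vec (vec_of_complex z) = z"
  by (simp add: vec_of_complex_def complex_of_vec_def)

lemma bounded_linear_complex_of_vec: "bounded_linear complex_of_vec"
  by (auto intro!: linear_conv_bounded_linear[THEN iffD1] linearI simp: complex_of_vec_def complex_eq_iff)

lemma bounded_linear_vec_of_complex: "bounded_linear vec_of_complex"
  by (auto intro!: linear_conv_bounded_linear[THEN iffD1] linearI simp: vec_of_complex_def vec_eq_iff forall_2)

lemma distr_complex_of_vec: "distr lborel borel complex_of_vec = lborel"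
proof (rule lborel_eqI[symmetric])
  fix l u :: complex
  assume *: "\<And>b. b \<in> Basis \<Longrightarrow> l \<bullet> b \<le> u \<bullet> b"
  have le: "Re l \<le> Re u" "Im l \<le> Im u"
    using *[of 1] *[of \<i>] by (simp_all add: Basis_complex_def)
  have m: "complex_of_vec \<in> borel_measurable borel"
    by (intro borel_measurable_continuous_onI linear_continuous_on bounded_linear_complex_of_vec)
  have "complex_of_vec -` box l u = box (vec_of_complex l) (vec_of_complex u)"
    by (auto simp: in_box_complex_iff mem_box_cart complex_of_vec_def vec_of_complex_def forall_2)
  then have "emeasure (distr lborel borel complex_of_vec) (box l u)
      = emeasure lborel (box (vec_of_complex l) (vec_of_complex u))"
    by (subst emeasure_distr) (auto simp: m)
  also have "\<dots> = emeasure lborel (cbox (vec_of_complex l) (vec_of_complex u))"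
    by (simp add: emeasure_lborel_box_eq emeasure_lborel_cbox_eq)
  also have "\<dots> = ennreal (measure lborel (cbox (vec_of_complex l) (vec_of_complex u)))"
    by (rule emeasure_eq_ennreal_measure)
      (use emeasure_bounded_finite[OF bounded_cbox, of "vec_of_complex l" "vec_of_complex u"] in \<open>simp add: less_top\<close>)
  also have "measure lborel (cbox (vec_of_complex l) (vec_of_complex u)) = (Re u - Re l) * (Im u - Im l)"
    using le by (subst content_cbox_cart)
      (auto simp: interval_ne_empty_cart vec_of_complex_def forall_2 UNIV_2)
  also have "\<dots> = (\<Prod>b\<in>Basis. (u - l) \<bullet> b)"
    by (simp add: Basis_complex_def)
  finally show "emeasure (distr lborel borel complex_of_vec) (box l u) = (\<Prod>b\<in>Basis. (u - l) \<bullet> b)" .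
qed simp

lemma distr_vec_of_complex: "distr lborel borel vec_of_complex = lborel"
proof -
  have "distr lborel borel vec_of_complex = distr (distr lborel borel complex_of_vec) borel vec_of_complex"
    by (simp add: distr_complex_of_vec)
  also have "\<dots> = distr lborel borel (\<lambda>v. v)"
    by (subst distr_distr)
      (auto simp: o_def intro!: borel_measurable_continuous_onI linear_continuous_on
        bounded_linear_complex_of_vec bounded_linear_vec_of_complex)
  finally show ?thesis
    by (simp add: distr_id2)
qed

lemma integrable_complex_of_vec:
  fixes h :: "complex \<Rightarrow> 'a::{banach, second_countable_topology}"
  assumes "integrable lebesgue h"
  shows "integrable lebesgue (\<lambda>v. h (complex_of_vec v))"
  using lebesgue_measure_preserving[OF _ distr_complex_of_vec] assms
    integrable_distr[of complex_of_vec lebesgue lebesgue h]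
  by (simp add: borel_measurable_continuous_onI linear_continuous_on bounded_linear_complex_of_vec)

lemma integrable_vec_of_complex:
  fixes h :: "real ^ 2 \<Rightarrow> 'a::{banach, second_countable_topology}"
  assumes "integrable lebesgue h"
  shows "integrable lebesgue (\<lambda>z. h (vec_of_complex z))"
  using lebesgue_measure_preserving[OF _ distr_vec_of_complex] assms
    integrable_distr[of vec_of_complex lebesgue lebesgue h]
  by (simp add: borel_measurable_continuous_onI linear_continuous_on bounded_linear_vec_of_complex)

text \<open>Multiplication by \<open>w\<close> is a rotation with a dilation by \<open>|w|\<close>;
  this is the real Jacobian of a holomorphic map with complex derivative \<open>w\<close>.\<close>

lemma det_complex_mult: "det (matrix (\<lambda>h. vec_of_complex (w * complex_of_vec h))) = (norm w)\<^sup>2"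
  unfolding det_2 matrix_def cmod_power2
  by (simp add: vec_of_complex_def complex_of_vec_def axis_def power2_eq_square)

text \<open>The complex derivative of the inversion is \<open>- (1 / z)\<^sup>2\<close>, so its
  Jacobian is the weight \<open>1 / norm z ^ 4\<close>.\<close>

lemma set_integrable_inversion:
  fixes u :: "complex \<Rightarrow> complex"
  assumes A: "A \<in> sets lebesgue" "0 \<notin> A"
    and int: "set_integrable lebesgue A (\<lambda>z. (1 / norm z ^ 4) *\<^sub>R u (1 / z))"
  shows "set_integrable lebesgue ((\<lambda>z. 1 / z) ` A) u"
proof -
  let ?c = complex_of_vec and ?d = vec_of_complex
  define S where "S = ?c -` A"
  define g where "g v = ?d (1 / ?c v)" for v
  define g' where "g' v h = ?d (- (1 / ?c v)\<^sup>2 * ?c h)" for v h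
  define f where "f v = ?d (u (?c v))" for v
  have "?c \<in> lebesgue \<rightarrow>\<^sub>M lebesgue"
    by (intro lebesgue_measure_preserving distr_complex_of_vec borel_measurable_continuous_onI
        linear_continuous_on bounded_linear_complex_of_vec)
  then have S: "S \<in> sets lebesgue"
    using A(1) measurable_sets[of ?c lebesgue lebesgue A] by (simp add: S_def)
  have der: "(g has_derivative g' v) (at v within S)" if "v \<in> S" for v
  proof -
    have nz: "?c v \<noteq> 0"
      using that A(2) by (auto simp: S_def)
    have "((\<lambda>v. 1 / ?c v) has_derivative (\<lambda>h. - (1 / ?c v)\<^sup>2 * ?c h)) (at v within S)"
      using nz by (auto intro!: derivative_eq_intros bounded_linear_imp_has_derivative
          bounded_linear_complex_of_vec simp: fun_eq_iff power2_eq_square divide_simps)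
    then show ?thesis
      unfolding g_def g'_def by (rule bounded_linear.has_derivative[OF bounded_linear_vec_of_complex])
  qed
  have inj: "inj_on g S"
    unfolding g_def by (intro inj_onI) (metis complex_of_vec_of_complex vec_of_complex_of_vec divide_divide_eq_right div_by_1 mult_1)
  have det: "det (matrix (g' v)) = 1 / norm (?c v) ^ 4" for v
  proof -
    let ?w = "- (1 / ?c v)\<^sup>2"
    have "det (matrix (g' v)) = (norm ?w)\<^sup>2"
      unfolding g'_def by (rule det_complex_mult)
    also have "\<dots> = 1 / norm (?c v) ^ 4"
      by (simp add: norm_power norm_divide power_divide)
    finally show ?thesis .
  qed
  have "integrable lebesgue (\<lambda>v. ?d (indicat_real A (?c v) *\<^sub>R ((1 / norm (?c v) ^ 4) *\<^sub>R u (1 / ?c v))))"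
    using integrable_complex_of_vec[OF int[unfolded set_integrable_def]]
    by (rule integrable_bounded_linear[OF bounded_linear_vec_of_complex])
  moreover have "?d (indicat_real A (?c v) *\<^sub>R ((1 / norm (?c v) ^ 4) *\<^sub>R u (1 / ?c v)))
      = indicat_real S v *\<^sub>R (\<bar>det (matrix (g' v))\<bar> *\<^sub>R f (g v))" for v
    unfolding det f_def g_def S_def
    by (simp add: linear_scale[OF bounded_linear.linear[OF bounded_linear_vec_of_complex]] indicator_def
        linear_0[OF bounded_linear.linear[OF bounded_linear_vec_of_complex]])
  ultimately have "(\<lambda>v. \<bar>det (matrix (g' v))\<bar> *\<^sub>R f (g v)) absolutely_integrable_on S"
    unfolding set_integrable_def by simp
  then have "f absolutely_integrable_on g ` S"
    using absolutely_integrable_change_of_variables[OF S der inj] by blast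
  then have "integrable lebesgue (\<lambda>z. ?c (indicat_real (g ` S) (?d z) *\<^sub>R f (?d z)))"
    unfolding set_integrable_def
    by (intro integrable_bounded_linear[OF bounded_linear_complex_of_vec] integrable_vec_of_complex)
  moreover have "?c (indicat_real (g ` S) (?d z) *\<^sub>R f (?d z)) = indicat_real ((\<lambda>z. 1 / z) ` A) z *\<^sub>R u z" for z
  proof -
    have "?d z \<in> g ` S \<longleftrightarrow> z \<in> (\<lambda>z. 1 / z) ` A"
    proof
      assume "?d z \<in> g ` S"
      then obtain v where "v \<in> S" "?d z = ?d (1 / ?c v)"
        by (auto simp: g_def)
      then have "z = 1 / ?c v" "?c v \<in> A"
        by (metis complex_of_vec_of_complex, simp add: S_def)
      then show "z \<in> (\<lambda>z. 1 / z) ` A"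
        by blast
    next
      assume "z \<in> (\<lambda>z. 1 / z) ` A"
      then obtain a where "a \<in> A" "z = 1 / a"
        by blast
      then have "?d a \<in> S" "?d z = g (?d a)"
        by (auto simp: S_def g_def)
      then show "?d z \<in> g ` S"
        by blast
    qed
    then show ?thesis
      by (simp add: f_def indicator_def linear_0[OF bounded_linear.linear[OF bounded_linear_complex_of_vec]])
  qed
  ultimately show ?thesis
    unfolding set_integrable_def by simp
qed

text \<open>By completeness every subset of a null set is measurable. This serves for the unit
  circle, on which membership in \<open>Lp_nu\<close> says nothing about the function.\<close>

lemma borel_measurable_lebesgue_null_support:
  fixes h :: "'a::euclidean_space \<Rightarrow> 'b::real_normed_vector"
  assumes "N \<in> null_sets lebesgue" "\<And>x. x \<notin> N \<Longrightarrow> h x = 0"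
  shows "h \<in> borel_measurable lebesgue"
proof (rule measurableI)
  fix B :: "'b set"
  have sub: "C \<in> sets lebesgue" if "C \<subseteq> N" for C
    using completion.complete2[OF that assms(1)] by (simp add: null_sets_def)
  show "h -` B \<inter> space lebesgue \<in> sets lebesgue"
  proof (cases "0 \<in> B")
    case True
    then have "- (h -` B) \<subseteq> N"
      using assms(2) by auto
    from sets.compl_sets[OF sub[OF this]] show ?thesis
      by (simp add: Diff_eq)
  next
    case False
    have "x \<in> N" if "h x \<in> B" for x
      using assms(2)[of x] that False by metis
    then have "h -` B \<subseteq> N"
      by blast
    then show ?thesis
      using sub by simp
  qed
qed simp

text \<open>Values off the half-plane are irrelevant in the statement, but not for measurability and
  for integrals over the plane; \<open>T_op\<close> does not see the difference.\<close>

definition on_upper :: "(complex \<Rightarrow> complex) \<Rightarrow> complex \<Rightarrow> complex" where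
  "on_upper f \<zeta> = (if \<zeta> \<in> upper_hp then f \<zeta> else 0)"

lemma T_integrand_on_upper: "T_integrand (on_upper f) z \<zeta> = indicat_real upper_hp \<zeta> *\<^sub>R T_integrand f z \<zeta>"
  by (simp add: T_integrand_def on_upper_def indicator_def)

lemma T_defined_iff: "T_defined f z \<longleftrightarrow> integrable lebesgue (T_integrand (on_upper f) z)"
  unfolding T_defined_def set_integrable_def T_integrand_on_upper[symmetric] ..

lemma T_op_cong:
  assumes "\<And>\<zeta>. \<zeta> \<in> upper_hp \<Longrightarrow> f \<zeta> = g \<zeta>"
  shows "T_op f = T_op g" "T_defined f = T_defined g"
proof -
  have "(\<lambda>\<zeta>. indicat_real upper_hp \<zeta> *\<^sub>R T_integrand f z \<zeta>) = (\<lambda>\<zeta>. indicat_real upper_hp \<zeta> *\<^sub>R T_integrand g z \<zeta>)" for z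
  proof (rule ext)
    show "indicat_real upper_hp \<zeta> *\<^sub>R T_integrand f z \<zeta> = indicat_real upper_hp \<zeta> *\<^sub>R T_integrand g z \<zeta>" for \<zeta>
      by (cases "\<zeta> \<in> upper_hp") (simp_all add: T_integrand_def assms)
  qed
  note eq = this
  show "T_op f = T_op g" "T_defined f = T_defined g"
    unfolding T_op_def[abs_def] T_defined_def[abs_def] set_lebesgue_integral_def set_integrable_def eq
    by (rule refl)+
qed

lemma T_op_on_upper: "T_op (on_upper f) = T_op f"
  by (rule T_op_cong) (simp add: on_upper_def)

text \<open>The subtracted term \<open>\<zeta> / (\<zeta>\<^sup>2 + 1)\<close> cancels the leading
  term \<open>1 / \<zeta>\<close> at infinity. The 4 comes from the lower bounds
  \<open>|\<zeta>| / 2\<close> and \<open>|\<zeta>|\<^sup>2 / 2\<close> for the two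
  denominators.\<close>

lemma schwarz_kernel_decay:
  fixes z \<zeta> :: complex
  assumes R: "R \<ge> 2" and z: "norm z \<le> R" and \<zeta>: "norm \<zeta> > 2 * R"
  shows "norm (1 / (\<zeta> - z) - \<zeta> / (\<zeta>\<^sup>2 + 1)) \<le> 4 * (1 + R) / (norm \<zeta>)\<^sup>2"
proof -
  have n: "norm \<zeta> \<ge> 4"
    using R \<zeta> by simp
  have 1: "norm (\<zeta> - z) \<ge> norm \<zeta> / 2"
    using norm_triangle_ineq2[of \<zeta> z] z \<zeta> by linarith
  have 16: "norm \<zeta> * norm \<zeta> \<ge> 4 * 4"
    using n by (intro mult_mono) auto
  then have 2: "norm (\<zeta>\<^sup>2 + 1) \<ge> (norm \<zeta>)\<^sup>2 / 2"
    using norm_triangle_ineq2[of "\<zeta>\<^sup>2" "- 1"] by (simp add: norm_mult power2_eq_square)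
  have nz: "\<zeta> - z \<noteq> 0" "\<zeta>\<^sup>2 + 1 \<noteq> 0"
  proof -
    have "norm (\<zeta> - z) > 0"
      using 1 n by linarith
    moreover have "norm (\<zeta>\<^sup>2 + 1) > 0"
      using 2 16 unfolding power2_eq_square[of "norm \<zeta>"] by linarith
    ultimately show "\<zeta> - z \<noteq> 0" "\<zeta>\<^sup>2 + 1 \<noteq> 0"
      by auto
  qed
  have gen: "1 / A - c / B = (B - c * A) / (A * B)" if "A \<noteq> 0" "B \<noteq> 0" for A B c :: complex
    using that by (simp add: field_simps)
  have "1 / (\<zeta> - z) - \<zeta> / (\<zeta>\<^sup>2 + 1) = (1 + \<zeta> * z) / ((\<zeta> - z) * (\<zeta>\<^sup>2 + 1))"
    unfolding gen[OF nz] by (simp add: power2_eq_square algebra_simps)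
  then have "norm (1 / (\<zeta> - z) - \<zeta> / (\<zeta>\<^sup>2 + 1)) = norm (1 + \<zeta> * z) / (norm (\<zeta> - z) * norm (\<zeta>\<^sup>2 + 1))"
    by (simp add: norm_divide norm_mult)
  also have "\<dots> \<le> (norm \<zeta> * (1 + R)) / (norm \<zeta> / 2 * ((norm \<zeta>)\<^sup>2 / 2))"
  proof (intro frac_le mult_mono)
    have "norm (1 + \<zeta> * z) \<le> 1 + norm \<zeta> * norm z"
      using norm_triangle_ineq[of 1 "\<zeta> * z"] by (simp add: norm_mult)
    also have "\<dots> \<le> norm \<zeta> * (1 + R)"
      using z n mult_left_mono[of "norm z" R "norm \<zeta>"] by (simp add: distrib_left)
    finally show "norm (1 + \<zeta> * z) \<le> norm \<zeta> * (1 + R)" .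
    show "0 < norm \<zeta> / 2 * ((norm \<zeta>)\<^sup>2 / 2)"
      using n by (intro mult_pos_pos divide_pos_pos zero_less_power) auto
  qed (use 1 2 n R in auto)
  also have "\<dots> = 4 * (1 + R) / (norm \<zeta>)\<^sup>2"
  proof -
    have "norm \<zeta> \<noteq> 0" using n by auto
    then show ?thesis by (simp add: field_simps)
  qed
  finally show ?thesis .
qed

text \<open>Entry point for the data themselves: here convergence of the integral is derived from
  the quadratic decay of the kernel.\<close>

lemma (in Lp_density) schwarz_density_if_decay:
  assumes dec: "set_integrable lebesgue (- cball 0 1) (\<lambda>\<zeta>. F \<zeta> / of_real ((norm \<zeta>)\<^sup>2))"
  shows "schwarz_density p F"
proof unfold_locales
  fix z :: complex
  define R where "R = max 2 (norm z)"
  have R: "R \<ge> 2" "norm z \<le> R" "norm (cnj z) \<le> R"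
    by (auto simp: R_def)
  \<comment> \<open>The factor 8 is twice the 4 of the kernel estimate, once for the kernel at
    \<open>z\<close> and once for the kernel at \<open>cnj z\<close>.\<close>
  let ?b = "\<lambda>\<zeta>. 8 * (1 + R) * norm (indicat_real (- cball 0 1) \<zeta> *\<^sub>R (F \<zeta> / of_real ((norm \<zeta>)\<^sup>2)))"
  have "integrable lebesgue (\<lambda>\<zeta>. indicat_real (- cball 0 (2 * R)) \<zeta> *\<^sub>R T_integrand F z \<zeta>)"
  proof (rule Bochner_Integration.integrable_bound)
    show "integrable lebesgue ?b"
      by (intro integrable_mult_right integrable_norm dec[unfolded set_integrable_def])
    show "(\<lambda>\<zeta>. indicat_real (- cball 0 (2 * R)) \<zeta> *\<^sub>R T_integrand F z \<zeta>) \<in> borel_measurable lebesgue"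
      by (intro borel_measurable_scaleR borel_measurable_indicator measurable_T_integrand) auto
    show "AE \<zeta> in lebesgue. norm (indicat_real (- cball 0 (2 * R)) \<zeta> *\<^sub>R T_integrand F z \<zeta>) \<le> norm (?b \<zeta>)"
    proof (rule AE_I2)
      fix \<zeta> :: complex
      show "norm (indicat_real (- cball 0 (2 * R)) \<zeta> *\<^sub>R T_integrand F z \<zeta>) \<le> norm (?b \<zeta>)"
      proof (cases "norm \<zeta> > 2 * R")
        case True
        let ?K = "4 * (1 + R) / (norm \<zeta>)\<^sup>2"
        have "norm (T_integrand F z \<zeta>) \<le> norm (F \<zeta> * (1 / (\<zeta> - z) - \<zeta> / (\<zeta>\<^sup>2 + 1)))
            + norm (F \<zeta> * (1 / (\<zeta> - cnj z) - \<zeta> / (\<zeta>\<^sup>2 + 1)))"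
          unfolding T_integrand_eq by (metis complex_mod_cnj norm_triangle_ineq4)
        also have "\<dots> \<le> norm (F \<zeta>) * ?K + norm (F \<zeta>) * ?K"
          unfolding norm_mult using schwarz_kernel_decay[OF R(1) _ True] R
          by (intro add_mono mult_left_mono) auto
        also have "\<dots> = ?b \<zeta>"
          using True R by (simp add: indicator_def norm_divide norm_power)
        finally have "norm (T_integrand F z \<zeta>) \<le> ?b \<zeta>" .
        moreover have "indicat_real (- cball 0 (2 * R)) \<zeta> = 1"
          using True by simp
        ultimately have "norm (indicat_real (- cball 0 (2 * R)) \<zeta> *\<^sub>R T_integrand F z \<zeta>) \<le> ?b \<zeta>"
          by (simp only: scaleR_one)
        then show ?thesis
          unfolding real_norm_def by (rule order_trans[OF _ abs_ge_self])
      qed (auto simp: indicator_def)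
    qed
  qed
  then have "integrable lebesgue (\<lambda>\<zeta>. indicat_real (cball 0 (2 * R)) \<zeta> *\<^sub>R T_integrand F z \<zeta>
      + indicat_real (- cball 0 (2 * R)) \<zeta> *\<^sub>R T_integrand F z \<zeta>)"
    using near_T_integrand(1)[of "2 * R" z] unfolding set_integrable_def
    by (intro Bochner_Integration.integrable_add)
  moreover have "indicat_real (cball 0 (2 * R)) \<zeta> *\<^sub>R T_integrand F z \<zeta>
      + indicat_real (- cball 0 (2 * R)) \<zeta> *\<^sub>R T_integrand F z \<zeta> = T_integrand F z \<zeta>" for \<zeta>
    by (auto simp: indicator_def)
  ultimately show "integrable lebesgue (T_integrand F z)"
    by simp
qed

lemma inversion_image_disk: "(\<lambda>z. 1 / z) ` (ball 0 1 \<inter> lower_hp) = upper_hp - cball 0 1"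
proof -
  have im: "Im (1 / z) = - Im z / (norm z)\<^sup>2" for z
    by (simp add: Im_divide cmod_power2)
  have to_upper: "1 / z \<in> upper_hp - cball 0 1" if "z \<in> ball 0 1 \<inter> lower_hp" for z
  proof -
    have "Im z < 0" "norm z < 1" "norm z > 0"
      using that by (auto simp: lower_hp_def)
    then show ?thesis
      using divide_neg_pos[of "Im z" "(norm z)\<^sup>2"] by (simp add: upper_hp_def im norm_divide)
  qed
  have from_upper: "1 / \<zeta> \<in> ball 0 1 \<inter> lower_hp" if "\<zeta> \<in> upper_hp - cball 0 1" for \<zeta>
  proof -
    have "Im \<zeta> > 0" "norm \<zeta> > 1"
      using that by (auto simp: upper_hp_def)
    moreover from this have "\<zeta> \<noteq> 0"
      by auto
    ultimately show ?thesis
      by (simp add: lower_hp_def im norm_divide)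
  qed
  have "\<zeta> \<in> (\<lambda>z. 1 / z) ` (ball 0 1 \<inter> lower_hp)" if "\<zeta> \<in> upper_hp - cball 0 1" for \<zeta>
    using imageI[OF from_upper[OF that], of "\<lambda>z. 1 / z"] by simp
  then show ?thesis
    using to_upper by blast
qed

text \<open>For the weight 2, \<open>g z\<close> is the Jacobian \<open>1 / norm z ^ 4\<close> times
  the value of \<open>f \<zeta> / |\<zeta>|\<^sup>2\<close> at \<open>\<zeta> = 1 / z\<close>.
  Integrability of \<open>g\<close> on a bounded set is thus the decay at infinity under which the
  integrals converge.\<close>

lemma Lp_nu_schwarz_density:
  assumes p: "p > 2" and f: "f \<in> Lp_nu p 2"
  shows "schwarz_density p (on_upper f)"
proof -
  let ?D = "ball 0 1 \<inter> upper_hp" and ?A = "ball 0 1 \<inter> lower_hp" and ?E = "upper_hp - cball 0 1"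
  define g where "g z = of_real (1 / norm z powr 2) * f (1 / z)" for z
  have A: "?A \<in> sets lebesgue" "0 \<notin> ?A"
    by (auto simp: lower_hp_def open_halfspace_Im_lt intro!: borel_open open_Int)
  have D: "?D \<in> sets lebesgue" "?E \<in> sets lebesgue"
    using open_upper_hp by (auto intro!: borel_open open_Int sets.Diff)
  have fD: "set_borel_measurable lebesgue ?D f" "set_integrable lebesgue ?D (\<lambda>z. norm (f z) powr p)"
    and gA: "set_borel_measurable lebesgue ?A g" "set_integrable lebesgue ?A (\<lambda>z. norm (g z) powr p)"
    using f unfolding Lp_nu_def Lp_on_def g_def by auto
  have g_eq: "g z = (1 / norm z ^ 4) *\<^sub>R (f (1 / z) / of_real ((norm (1 / z))\<^sup>2))" if "z \<noteq> 0" for z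
    using that by (simp add: g_def norm_divide power_divide scaleR_conv_of_real power4_eq_xxxx power2_eq_square)
  have gi: "set_integrable lebesgue ?A g"
  proof (rule set_integrable_bound[OF set_integral_add(1)[OF gA(2)] gA(1)])
    show "set_integrable lebesgue ?A (\<lambda>_. 1 :: real)"
    proof -
      have "?A \<in> sets lborel"
        by (auto simp: lower_hp_def open_halfspace_Im_lt intro!: borel_open open_Int)
      then show ?thesis
        unfolding set_integrable_def using emeasure_bounded_finite[of ?A]
        by (auto intro!: integrable_real_indicator simp: bounded_Int)
    qed
    have "x \<le> x powr p + 1" if "x \<ge> 0" for x :: real
    proof (cases "x \<ge> 1")
      case True
      then show ?thesis using powr_mono[of 1 p x] p by simp
    qed (use p in \<open>simp add: add_increasing\<close>)
    then show "AE z in lebesgue. z \<in> ?A \<longrightarrow> norm (g z) \<le> norm (norm (g z) powr p + 1)"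
      by simp
  qed
  have "set_integrable lebesgue ?A (\<lambda>z. (1 / norm z ^ 4) *\<^sub>R (f (1 / z) / of_real ((norm (1 / z))\<^sup>2)))"
  proof -
    have eq: "g z = (1 / norm z ^ 4) *\<^sub>R (f (1 / z) / of_real ((norm (1 / z))\<^sup>2))" if "z \<in> ?A" for z
      by (rule g_eq) (use that A(2) in blast)
    show ?thesis
      using set_integrable_cong[where M=lebesgue, OF refl refl eq] gi by (rule iffD1)
  qed
  then have far: "set_integrable lebesgue ?E (\<lambda>\<zeta>. f \<zeta> / of_real ((norm \<zeta>)\<^sup>2))"
    using set_integrable_inversion[OF A, of "\<lambda>\<zeta>. f \<zeta> / of_real ((norm \<zeta>)\<^sup>2)"]
    unfolding inversion_image_disk by blast
  have "set_integrable lebesgue ?A (\<lambda>z. (1 / norm z ^ 4) *\<^sub>R of_real (norm (f (1 / z)) powr p) :: complex)"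
  proof (rule set_integrable_bound[OF gA(2)])
    \<comment> \<open>Since \<open>p > 2\<close> the exponent \<open>2 * p - 4\<close> is positive,
      and \<open>|z| < 1\<close> makes the weighted power at most \<open>norm (g z) powr p\<close>.
      So \<open>f\<close> is p-integrable on the whole exterior of the disk.\<close>
    have *: "(1 / norm z ^ 4) * norm (f (1 / z)) powr p = norm z powr (2 * p - 4) * norm (g z) powr p"
      if "z \<in> ?A" for z
    proof -
      have nz: "norm z > 0" using that A(2) by auto
      then have "norm (f (1 / z)) = norm z powr 2 * norm (g z)"
        by (simp add: g_def norm_mult norm_divide norm_power)
      then have "norm (f (1 / z)) powr p = norm z powr (2 * p) * norm (g z) powr p"
        by (simp only: powr_mult powr_powr powr_ge_zero norm_ge_zero)
      then show ?thesis
        using nz by (simp add: powr_diff)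
    qed
    show "set_borel_measurable lebesgue ?A (\<lambda>z. (1 / norm z ^ 4) *\<^sub>R of_real (norm (f (1 / z)) powr p) :: complex)"
    proof -
      have "(\<lambda>z. indicat_real ?A z *\<^sub>R ((1 / norm z ^ 4) *\<^sub>R of_real (norm (f (1 / z)) powr p)) :: complex)
          = (\<lambda>z. of_real (norm z powr (2 * p - 4) * (indicat_real ?A z *\<^sub>R norm (g z) powr p)))"
      proof (rule ext)
        fix z
        show "indicat_real ?A z *\<^sub>R ((1 / norm z ^ 4) *\<^sub>R complex_of_real (norm (f (1 / z)) powr p))
            = complex_of_real (norm z powr (2 * p - 4) * (indicat_real ?A z *\<^sub>R norm (g z) powr p))"
        proof (cases "z \<in> ?A")
          case True
          then show ?thesis
            using arg_cong[OF *[OF True], of complex_of_real] by (simp add: scaleR_conv_of_real)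
        qed simp
      qed
      moreover have "(\<lambda>z::complex. norm z powr (2 * p - 4)) \<in> borel_measurable lebesgue"
        by (rule measurable_completion) measurable
      ultimately show ?thesis
        unfolding set_borel_measurable_def
        using borel_measurable_integrable[OF gA(2)[unfolded set_integrable_def]]
        by (auto intro!: borel_measurable_times measurable_compose[OF _ borel_measurable_continuous_onI[of complex_of_real]]
            continuous_intros simp del: of_real_mult)
    qed
    show "AE z in lebesgue. z \<in> ?A \<longrightarrow>
        norm ((1 / norm z ^ 4) *\<^sub>R of_real (norm (f (1 / z)) powr p) :: complex) \<le> norm (norm (g z) powr p)"
    proof (intro AE_I2 impI)
      fix z assume z: "z \<in> ?A"
      have "norm z powr (2 * p - 4) \<le> 1 powr (2 * p - 4)"
        using z p by (intro powr_mono2) auto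
      then have "norm z powr (2 * p - 4) * norm (g z) powr p \<le> 1 * norm (g z) powr p"
        by (intro mult_right_mono) auto
      then show "norm ((1 / norm z ^ 4) *\<^sub>R of_real (norm (f (1 / z)) powr p) :: complex) \<le> norm (norm (g z) powr p)"
        using *[OF z] by simp
    qed
  qed
  then have "set_integrable lebesgue ?E (\<lambda>\<zeta>. of_real (norm (f \<zeta>) powr p) :: complex)"
    using set_integrable_inversion[OF A, of "\<lambda>\<zeta>. of_real (norm (f \<zeta>) powr p)"]
    unfolding inversion_image_disk by blast
  then have fE: "set_integrable lebesgue ?E (\<lambda>\<zeta>. norm (f \<zeta>) powr p)"
    using integrable_norm unfolding set_integrable_def by fastforce
  have sphere: "sphere 0 1 \<in> null_sets (lebesgue :: complex measure)"
    using negligible_sphere negligible_iff_null_sets by blast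
  have split: "on_upper f \<zeta> = indicat_real ?D \<zeta> *\<^sub>R f \<zeta> + indicat_real ?E \<zeta> *\<^sub>R f \<zeta>
      + indicat_real (sphere 0 1) \<zeta> *\<^sub>R on_upper f \<zeta>" for \<zeta>
    by (auto simp: on_upper_def indicator_def)
  interpret Lp_density p "on_upper f"
  proof
    have "(\<lambda>\<zeta>. indicat_real ?E \<zeta> *\<^sub>R f \<zeta>) \<in> borel_measurable lebesgue"
    proof -
      have "(\<lambda>\<zeta>. of_real ((norm \<zeta>)\<^sup>2) * (indicat_real ?E \<zeta> *\<^sub>R (f \<zeta> / of_real ((norm \<zeta>)\<^sup>2)))) \<in> borel_measurable lebesgue"
        by (intro borel_measurable_times borel_measurable_integrable[OF far[unfolded set_integrable_def]]
            measurable_completion) measurable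
      moreover have "(\<lambda>\<zeta>. of_real ((norm \<zeta>)\<^sup>2) * (indicat_real ?E \<zeta> *\<^sub>R (f \<zeta> / of_real ((norm \<zeta>)\<^sup>2))))
          = (\<lambda>\<zeta>. indicat_real ?E \<zeta> *\<^sub>R f \<zeta>)"
        by (auto simp: fun_eq_iff indicator_def)
      ultimately show ?thesis by simp
    qed
    moreover have "(\<lambda>\<zeta>. indicat_real (sphere 0 1) \<zeta> *\<^sub>R on_upper f \<zeta>) \<in> borel_measurable lebesgue"
      by (rule borel_measurable_lebesgue_null_support[OF sphere]) simp
    ultimately show "on_upper f \<in> borel_measurable lebesgue"
      by (subst split[abs_def]) (intro borel_measurable_add fD(1)[unfolded set_borel_measurable_def])
    then have m: "(\<lambda>\<zeta>. norm (on_upper f \<zeta>) powr p) \<in> borel_measurable lebesgue"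
      by measurable
    have "integrable lebesgue (\<lambda>\<zeta>. norm (on_upper f \<zeta>) powr p)"
    proof (rule integrable_cong_AE_imp[OF _ m])
      show "integrable lebesgue (\<lambda>\<zeta>. indicat_real ?D \<zeta> *\<^sub>R norm (f \<zeta>) powr p + indicat_real ?E \<zeta> *\<^sub>R norm (f \<zeta>) powr p)"
        using fD(2) fE unfolding set_integrable_def by (rule Bochner_Integration.integrable_add)
      have "AE \<zeta> in lebesgue. \<zeta> \<notin> sphere (0 :: complex) 1"
        by (rule AE_not_in[OF sphere])
      then show "AE \<zeta> in lebesgue. indicat_real ?D \<zeta> *\<^sub>R norm (f \<zeta>) powr p + indicat_real ?E \<zeta> *\<^sub>R norm (f \<zeta>) powr p
          = norm (on_upper f \<zeta>) powr p"
        by eventually_elim (use p in \<open>auto simp: on_upper_def indicator_def\<close>)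
    qed
    then show "set_integrable lebesgue (cball 0 R) (\<lambda>\<zeta>. norm (on_upper f \<zeta>) powr p)" for R
      unfolding set_integrable_def by (intro integrable_mult_indicator) auto
  qed (use p in \<open>auto simp: on_upper_def\<close>)
  have "set_integrable lebesgue (- cball 0 1) (\<lambda>\<zeta>. on_upper f \<zeta> / of_real ((norm \<zeta>)\<^sup>2))"
  proof -
    have "indicat_real (- cball 0 1) \<zeta> *\<^sub>R (on_upper f \<zeta> / of_real ((norm \<zeta>)\<^sup>2))
        = indicat_real ?E \<zeta> *\<^sub>R (f \<zeta> / of_real ((norm \<zeta>)\<^sup>2))" for \<zeta>
      by (auto simp: on_upper_def indicator_def)
    then show ?thesis
      using far unfolding set_integrable_def by simp
  qed
  then show ?thesis
    by (rule schwarz_density_if_decay)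
qed

subsection \<open>Weak derivatives and the boundary value problem\<close>

lemma integrable_on_compact_continuous:
  fixes g :: "complex \<Rightarrow> complex"
  assumes "continuous_on U g" "compact K" "K \<subseteq> U"
  shows "set_integrable lebesgue K g"
proof -
  have K [measurable]: "K \<in> sets borel"
    using assms(2) borel_compact by blast
  have "set_integrable lborel K g"
    by (rule borel_integrable_compact[unfolded set_integrable_def[symmetric]])
      (use assms continuous_on_subset in auto)
  then have "integrable lborel (\<lambda>z. indicat_real K z *\<^sub>R g z)"
    by (simp add: set_integrable_def)
  then show ?thesis
    unfolding set_integrable_def by (subst integrable_completion) auto
qed

lemma locally_integrable_on_continuous:
  assumes "continuous_on U g"
  shows "locally_integrable_on U g"
  unfolding locally_integrable_on_def using integrable_on_compact_continuous[OF assms] by blast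

lemma locally_integrable_on_add:
  assumes "locally_integrable_on U f" "locally_integrable_on U g"
  shows "locally_integrable_on U (\<lambda>z. f z + g z)"
  using assms unfolding locally_integrable_on_def by (auto intro: set_integral_add(1))

lemma test_function_integrable_mult:
  assumes g: "locally_integrable_on upper_hp g" and \<phi>: "\<phi> \<in> test_functions upper_hp"
  shows "set_integrable lebesgue upper_hp (\<lambda>z. g z * \<phi> z)"
proof -
  obtain K where K: "compact K" "K \<subseteq> upper_hp" "\<And>z. z \<notin> K \<Longrightarrow> \<phi> z = 0"
    using test_functions_support[OF \<phi>] by metis
  obtain B where B: "B > 0" "\<And>z. norm (\<phi> z) \<le> B"
    using bounded_compact_support[OF test_functions_continuous_on[OF \<phi>] K(1,3)] by blast
  have gi: "integrable lebesgue (\<lambda>z. indicat_real K z *\<^sub>R g z)"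
    using g K unfolding locally_integrable_on_def set_integrable_def by blast
  have "\<phi> \<in> borel_measurable lebesgue"
    using borel_measurable_continuous_onI[OF test_functions_continuous_on[OF \<phi>]] by (simp add: measurable_completion)
  moreover have "norm ((indicat_real K z *\<^sub>R g z) * \<phi> z) \<le> norm (norm (indicat_real K z *\<^sub>R g z) * B)" for z
    unfolding norm_mult[of _ "\<phi> z"] using B by (simp add: abs_mult mult_left_mono)
  ultimately have "integrable lebesgue (\<lambda>z. (indicat_real K z *\<^sub>R g z) * \<phi> z)"
    by (intro Bochner_Integration.integrable_bound[OF integrable_mult_left[OF integrable_norm[OF gi], of B]]
        borel_measurable_times borel_measurable_integrable[OF gi] AE_I2)
  moreover have "(\<lambda>z. (indicat_real K z *\<^sub>R g z) * \<phi> z) = (\<lambda>z. indicat_real upper_hp z *\<^sub>R (g z * \<phi> z))"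
    using K by (auto simp: fun_eq_iff indicator_def)
  ultimately show ?thesis
    unfolding set_integrable_def by simp
qed

lemma funpow_dbar_test_functions:
  assumes "\<phi> \<in> test_functions U"
  shows "(dbar ^^ k) \<phi> \<in> test_functions U"
  by (induction k) (auto intro: test_functions_dbar assms)

lemma has_weak_dbar_0:
  assumes "locally_integrable_on upper_hp w"
  shows "has_weak_dbar 0 w w"
  using assms by (simp add: has_weak_dbar_def)

text \<open>\<open>dbar \<phi>\<close> is again a test function, so the hypothesis of order
  \<open>k\<close> can be used for it and the one of order 1 for \<open>\<phi>\<close>.\<close>

lemma has_weak_dbar_Suc:
  assumes "has_weak_dbar k w g" "has_weak_dbar 1 g f"
  shows "has_weak_dbar (Suc k) w f"
  unfolding has_weak_dbar_def
proof (intro conjI ballI)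
  fix \<phi> :: "complex \<Rightarrow> complex" assume \<phi>: "\<phi> \<in> test_functions upper_hp"
  have "(LINT z:upper_hp|lebesgue. w z * (dbar ^^ Suc k) \<phi> z) = (LINT z:upper_hp|lebesgue. w z * (dbar ^^ k) (dbar \<phi>) z)"
    by (simp only: funpow_Suc_right o_apply)
  also have "\<dots> = (-1) ^ k * (LINT z:upper_hp|lebesgue. g z * dbar \<phi> z)"
    using assms(1) test_functions_dbar[OF \<phi>] unfolding has_weak_dbar_def by blast
  also have "(LINT z:upper_hp|lebesgue. g z * dbar \<phi> z) = - (LINT z:upper_hp|lebesgue. f z * \<phi> z)"
    using assms(2) \<phi> unfolding has_weak_dbar_def by simp
  finally show "(LINT z:upper_hp|lebesgue. w z * (dbar ^^ Suc k) \<phi> z)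
      = (-1) ^ Suc k * (LINT z:upper_hp|lebesgue. f z * \<phi> z)"
    by simp
qed (use assms in \<open>auto simp: has_weak_dbar_def\<close>)

lemma has_weak_dbar_add:
  assumes "has_weak_dbar k w f" "has_weak_dbar k v g"
  shows "has_weak_dbar k (\<lambda>z. w z + v z) (\<lambda>z. f z + g z)"
  unfolding has_weak_dbar_def
proof (intro conjI ballI)
  show "locally_integrable_on upper_hp (\<lambda>z. w z + v z)" "locally_integrable_on upper_hp (\<lambda>z. f z + g z)"
    using assms by (auto simp: has_weak_dbar_def intro: locally_integrable_on_add)
  fix \<phi> :: "complex \<Rightarrow> complex" assume \<phi>: "\<phi> \<in> test_functions upper_hp"
  have li: "locally_integrable_on upper_hp w" "locally_integrable_on upper_hp v"
    "locally_integrable_on upper_hp f" "locally_integrable_on upper_hp g"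
    using assms by (auto simp: has_weak_dbar_def)
  have "(LINT z:upper_hp|lebesgue. (w z + v z) * (dbar ^^ k) \<phi> z)
      = (LINT z:upper_hp|lebesgue. w z * (dbar ^^ k) \<phi> z) + (LINT z:upper_hp|lebesgue. v z * (dbar ^^ k) \<phi> z)"
    unfolding distrib_right
    by (intro set_integral_add(2) test_function_integrable_mult li funpow_dbar_test_functions \<phi>)
  also have "\<dots> = (-1) ^ k * ((LINT z:upper_hp|lebesgue. f z * \<phi> z) + (LINT z:upper_hp|lebesgue. g z * \<phi> z))"
    using assms \<phi> by (simp add: has_weak_dbar_def distrib_left)
  also have "(LINT z:upper_hp|lebesgue. f z * \<phi> z) + (LINT z:upper_hp|lebesgue. g z * \<phi> z)
      = (LINT z:upper_hp|lebesgue. (f z + g z) * \<phi> z)"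
    unfolding distrib_right
    by (intro set_integral_add(2)[symmetric] test_function_integrable_mult li \<phi>)
  finally show "(LINT z:upper_hp|lebesgue. (w z + v z) * (dbar ^^ k) \<phi> z)
      = (-1) ^ k * (LINT z:upper_hp|lebesgue. (f z + g z) * \<phi> z)" .
qed

lemma has_weak_dbar_sum:
  assumes "finite I" "\<And>i. i \<in> I \<Longrightarrow> has_weak_dbar k (w i) (f i)"
  shows "has_weak_dbar k (\<lambda>z. \<Sum>i\<in>I. w i z) (\<lambda>z. \<Sum>i\<in>I. f i z)"
  using assms
proof (induction I rule: finite_induct)
  case empty
  then show ?case
    by (simp add: has_weak_dbar_def locally_integrable_on_continuous)
next
  case (insert i I)
  then show ?case
    by (simp add: has_weak_dbar_add)
qed

lemma has_weak_dbar_cong: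
  assumes "\<And>z. z \<in> upper_hp \<Longrightarrow> w z = w' z" "\<And>z. z \<in> upper_hp \<Longrightarrow> g z = g' z"
  shows "has_weak_dbar k w g \<longleftrightarrow> has_weak_dbar k w' g'"
proof -
  have *: "locally_integrable_on upper_hp f = locally_integrable_on upper_hp f'"
    if "\<And>z. z \<in> upper_hp \<Longrightarrow> f z = f' z" for f f'
    unfolding locally_integrable_on_def using that
    by (intro all_cong1 imp_cong refl set_integrable_cong) auto
  have **: "(LINT z:upper_hp|lebesgue. f z * \<phi> z) = (LINT z:upper_hp|lebesgue. f' z * \<phi> z)"
    if "\<And>z. z \<in> upper_hp \<Longrightarrow> f z = f' z" for f f' \<phi> :: "complex \<Rightarrow> complex"
    unfolding set_lebesgue_integral_def
  proof (rule Bochner_Integration.integral_cong[OF refl])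
    show "indicat_real upper_hp z *\<^sub>R (f z * \<phi> z) = indicat_real upper_hp z *\<^sub>R (f' z * \<phi> z)" for z
      by (cases "z \<in> upper_hp") (simp_all add: that)
  qed
  show ?thesis
    unfolding has_weak_dbar_def using *[OF assms(1)] *[OF assms(2)] **[OF assms(1)] **[OF assms(2)] by simp
qed

text \<open>Cauchy-Riemann in weak form: \<open>h * \<phi>\<close>, extended by zero, is
  continuously differentiable on the plane and its \<open>dbar\<close> is
  \<open>h * dbar \<phi>\<close>, which therefore has integral zero.\<close>

lemma holomorphic_has_weak_dbar_0:
  assumes h: "h holomorphic_on upper_hp"
  shows "has_weak_dbar 1 h (\<lambda>_. 0)"
  unfolding has_weak_dbar_def
proof (intro conjI ballI)
  show "locally_integrable_on upper_hp h" "locally_integrable_on upper_hp (\<lambda>_. 0)"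
    by (auto intro!: locally_integrable_on_continuous holomorphic_on_imp_continuous_on h)
  fix \<phi> :: "complex \<Rightarrow> complex" assume \<phi>: "\<phi> \<in> test_functions upper_hp"
  obtain K where K: "compact K" "K \<subseteq> upper_hp" "\<And>z. z \<notin> K \<Longrightarrow> \<phi> z = 0"
    using test_functions_support[OF \<phi>] by metis
  let ?\<phi>' = "\<lambda>z v. frechet_derivative \<phi> (at z) v"
  have \<phi>'0: "?\<phi>' z v = 0" if "z \<notin> K" for z v
    using has_derivative_eq_0_outside_support[OF test_functions_has_derivative[OF \<phi>] K(1,3) that] by simp
  define \<psi> where "\<psi> z = on_upper h z * \<phi> z" for z
  define D where "D z v = on_upper h z * ?\<phi>' z v + (on_upper (deriv h) z * v) * \<phi> z" for z v
  \<comment> \<open>The half-plane and the complement of the support are open and cover the plane;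
    on the second the product vanishes.\<close>
  have zero_off: "continuous_on UNIV (\<lambda>z. on_upper f z * \<eta> z)"
    if f: "continuous_on upper_hp f" and \<eta>: "continuous_on UNIV \<eta>" "\<And>z. z \<notin> K \<Longrightarrow> \<eta> z = 0" for f \<eta>
  proof -
    have "continuous_on upper_hp (\<lambda>z. on_upper f z * \<eta> z)"
      by (rule continuous_on_eq[of _ "\<lambda>z. f z * \<eta> z"])
        (auto intro!: continuous_intros f continuous_on_subset[OF \<eta>(1)] simp: on_upper_def)
    moreover have "continuous_on (- K) (\<lambda>z. on_upper f z * \<eta> z)"
      by (rule continuous_on_eq[of _ "\<lambda>z. 0"]) (auto simp: \<eta>)
    ultimately have "continuous_on (upper_hp \<union> - K) (\<lambda>z. on_upper f z * \<eta> z)"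
      using open_upper_hp compact_imp_closed[OF K(1)] by (intro continuous_on_open_Un) auto
    moreover have "upper_hp \<union> - K = UNIV"
      using K(2) by auto
    ultimately show ?thesis by simp
  qed
  have der: "(\<psi> has_derivative D z) (at z)" for z
  proof (cases "z \<in> upper_hp")
    case True
    have "(h has_field_derivative deriv h z) (at z)"
      by (rule holomorphic_derivI[OF h open_upper_hp True])
    then have "((\<lambda>z. h z * \<phi> z) has_derivative (\<lambda>v. h z * ?\<phi>' z v + (deriv h z * v) * \<phi> z)) (at z)"
      using has_derivative_mult[OF _ test_functions_has_derivative[OF \<phi>]] unfolding has_field_derivative_def by blast
    moreover have "D z = (\<lambda>v. h z * ?\<phi>' z v + (deriv h z * v) * \<phi> z)"
      using True by (simp add: D_def on_upper_def fun_eq_iff)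
    ultimately have "((\<lambda>z. h z * \<phi> z) has_derivative D z) (at z)"
      by simp
    then show ?thesis
      by (rule has_derivative_transform_within_open[OF _ open_upper_hp True]) (simp add: \<psi>_def on_upper_def)
  next
    case False
    then have z: "z \<in> - K"
      using K by auto
    have "(\<psi> has_derivative (\<lambda>_. 0)) (at z)"
      by (rule has_derivative_transform_within_open[of "\<lambda>_. 0" _ _ _ "- K", OF _ _ z])
        (use K compact_imp_closed in \<open>auto simp: \<psi>_def\<close>)
    moreover have "D z = (\<lambda>_. 0)"
      using z K by (auto simp: D_def \<phi>'0)
    ultimately show ?thesis by simp
  qed
  have cont: "continuous_on UNIV (\<lambda>z. D z v)" for v
  proof -
    have "continuous_on UNIV (\<lambda>z. on_upper h z * ?\<phi>' z v)"
      by (intro zero_off holomorphic_on_imp_continuous_on h \<phi>'0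
          test_functions_continuous_on[OF test_functions_frechet_derivative[OF \<phi>]])
    moreover have "continuous_on UNIV (\<lambda>z. on_upper (deriv h) z * (v * \<phi> z))"
      by (intro zero_off holomorphic_on_imp_continuous_on[OF holomorphic_deriv[OF h open_upper_hp]]
          continuous_intros test_functions_continuous_on[OF \<phi>]) (simp add: K)
    ultimately show ?thesis
      unfolding D_def using continuous_on_add by (fastforce simp: mult.assoc)
  qed
  have "(LINT z|lebesgue. dbar \<psi> z) = 0"
    by (rule integral_dbar_eq_0(2)[OF der cont cont K(1)]) (simp add: \<psi>_def K)
  moreover have "dbar \<psi> z = indicat_real upper_hp z *\<^sub>R (h z * dbar \<phi> z)" for z
    by (subst dbar_eq_has_derivative[OF der])
      (auto simp: D_def dbar_def on_upper_def indicator_def algebra_simps add_divide_distrib)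
  ultimately show "(LINT z:upper_hp|lebesgue. h z * (dbar ^^ 1) \<phi> z) = (-1) ^ 1 * (LINT z:upper_hp|lebesgue. 0 * \<phi> z)"
    by (simp add: set_lebesgue_integral_def)
qed

lemma T_op_has_weak_dbar:
  assumes "schwarz_density p (on_upper f)"
  shows "has_weak_dbar 1 (T_op f) f"
proof -
  interpret schwarz_density p "on_upper f"
    by (rule assms)
  have li: "locally_integrable_on upper_hp f"
    unfolding locally_integrable_on_def
  proof (intro allI impI, elim conjE)
    fix K :: "complex set" assume K: "compact K" "K \<subseteq> upper_hp"
    obtain R where R: "K \<subseteq> cball 0 R"
      using bounded_subset_ballD[OF compact_imp_bounded[OF K(1)], of 0] ball_subset_cball by blast
    have Kb: "K \<in> sets lebesgue"
      using borel_compact[OF K(1)] by (simp add: sets_completionI_sets)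
    have "integrable lebesgue (\<lambda>z. indicat_real K z *\<^sub>R (indicat_real (cball 0 R) z *\<^sub>R norm (on_upper f z)))"
      using bounded_integrable[of R] unfolding set_integrable_def by (rule integrable_mult_indicator[OF Kb])
    then have "integrable lebesgue (\<lambda>z. indicat_real K z *\<^sub>R on_upper f z)"
      by (rule Bochner_Integration.integrable_bound)
        (use Kb measurable_F in \<open>auto simp: indicator_def dest!: subsetD[OF R] intro!: AE_I2 borel_measurable_scaleR borel_measurable_indicator\<close>)
    moreover have "(\<lambda>z. indicat_real K z *\<^sub>R on_upper f z) = (\<lambda>z. indicat_real K z *\<^sub>R f z)"
      using K by (auto simp: fun_eq_iff indicator_def on_upper_def)
    ultimately show "set_integrable lebesgue K f"
      by (simp add: set_integrable_def)
  qed
  show ?thesis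
    unfolding has_weak_dbar_def
  proof (intro conjI ballI li)
    show "locally_integrable_on upper_hp (T_op f)"
      using continuous_T_op by (auto simp: T_op_on_upper intro!: locally_integrable_on_continuous intro: continuous_on_subset)
    fix \<phi> :: "complex \<Rightarrow> complex" assume \<phi>: "\<phi> \<in> test_functions upper_hp"
    have off: "\<eta> z = 0" if "\<eta> \<in> test_functions upper_hp" "z \<notin> upper_hp" for \<eta> :: "complex \<Rightarrow> complex" and z
      using test_functions_support[OF that(1)] that(2) by (metis subsetD)
    have "(\<lambda>z. indicat_real upper_hp z *\<^sub>R (T_op f z * dbar \<phi> z)) = (\<lambda>z. T_op f z * dbar \<phi> z)"
      using off[OF test_functions_dbar[OF \<phi>]] by (auto simp: fun_eq_iff indicator_def)
    moreover have "(\<lambda>z. indicat_real upper_hp z *\<^sub>R (f z * \<phi> z)) = (\<lambda>z. on_upper f z * \<phi> z)"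
      by (auto simp: fun_eq_iff indicator_def on_upper_def)
    ultimately show "(LINT z:upper_hp|lebesgue. T_op f z * (dbar ^^ 1) \<phi> z) = (-1) ^ 1 * (LINT z:upper_hp|lebesgue. f z * \<phi> z)"
      using integral_T_op_dbar[OF \<phi>] by (simp add: set_lebesgue_integral_def T_op_on_upper)
  qed
qed

section \<open>Iterates of the operator and their boundary values\<close>

lemma T_op_schwarz_density:
  assumes F: "schwarz_density p (on_upper f)" and T: "\<And>z. z \<in> upper_hp \<Longrightarrow> T_defined (T_op f) z"
  shows "schwarz_density p (on_upper (T_op f))"
proof -
  interpret schwarz_density p "on_upper f"
    by (rule F)
  have c: "continuous_on UNIV (T_op f)"
    using continuous_T_op by (simp add: T_op_on_upper)
  show ?thesis
  proof
    have U: "upper_hp \<in> sets lebesgue"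
      using open_upper_hp by (auto intro!: borel_open)
    have eq: "on_upper (T_op f) = (\<lambda>\<zeta>. indicat_real upper_hp \<zeta> *\<^sub>R T_op f \<zeta>)"
      by (auto simp: on_upper_def indicator_def fun_eq_iff)
    show m: "on_upper (T_op f) \<in> borel_measurable lebesgue"
      unfolding eq using borel_measurable_continuous_onI[OF c] U
      by (intro borel_measurable_scaleR borel_measurable_indicator) (auto intro: measurable_completion)
    fix R :: real
    have "bounded (T_op f ` cball 0 R)"
      by (intro compact_imp_bounded compact_continuous_image continuous_on_subset[OF c]) auto
    then obtain B where B: "\<And>y. y \<in> T_op f ` cball 0 R \<Longrightarrow> norm y \<le> B"
      unfolding bounded_iff by blast
    show "set_integrable lebesgue (cball 0 R) (\<lambda>\<zeta>. norm (on_upper (T_op f) \<zeta>) powr p)"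
      unfolding set_integrable_def
    proof (rule Bochner_Integration.integrable_bound)
      show "integrable lebesgue (\<lambda>\<zeta>. \<bar>B\<bar> powr p * indicat_real (cball (0::complex) R) \<zeta>)"
        using emeasure_bounded_finite[OF bounded_cball, of "0::complex" R]
        by (intro integrable_mult_right integrable_real_indicator) auto
      show "(\<lambda>\<zeta>. indicat_real (cball 0 R) \<zeta> *\<^sub>R norm (on_upper (T_op f) \<zeta>) powr p) \<in> borel_measurable lebesgue"
        using m by (intro borel_measurable_scaleR borel_measurable_indicator) auto
      have "norm (on_upper (T_op f) \<zeta>) powr p \<le> \<bar>B\<bar> powr p" if "\<zeta> \<in> cball 0 R" for \<zeta>
      proof (rule powr_mono2)
        show "norm (on_upper (T_op f) \<zeta>) \<le> \<bar>B\<bar>"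
          using B[of "T_op f \<zeta>"] that by (auto simp: on_upper_def)
      qed (use p in auto)
      then show "AE \<zeta> in lebesgue. norm (indicat_real (cball 0 R) \<zeta> *\<^sub>R norm (on_upper (T_op f) \<zeta>) powr p)
          \<le> norm (\<bar>B\<bar> powr p * indicat_real (cball 0 R) \<zeta>)"
        by (intro AE_I2) (auto simp: indicator_def)
    qed
  qed (use p T in \<open>auto simp: on_upper_def T_defined_iff\<close>)
qed

lemma funpow_T_op_schwarz_density:
  assumes "schwarz_density p (on_upper f)"
    and "\<And>j z. 1 \<le> j \<Longrightarrow> j \<le> k \<Longrightarrow> z \<in> upper_hp \<Longrightarrow> T_defined ((T_op ^^ j) f) z"
  shows "schwarz_density p (on_upper ((T_op ^^ k) f))"
  using assms(2)
proof (induction k)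
  case 0
  then show ?case using assms(1) by simp
next
  case (Suc k)
  then have "schwarz_density p (on_upper ((T_op ^^ k) f))"
    by auto
  then show ?case
    using T_op_schwarz_density[of p "(T_op ^^ k) f"] Suc.prems[of "Suc k"] by simp
qed

lemma T_op_boundary_properties:
  assumes "schwarz_density p (on_upper f)"
  shows "continuous_on UNIV (T_op f)" "\<And>t. Re (T_op f (of_real t)) = 0" "Im (T_op f \<i>) = 0"
proof -
  interpret schwarz_density p "on_upper f"
    by (rule assms)
  show "continuous_on UNIV (T_op f)" "\<And>t. Re (T_op f (of_real t)) = 0" "Im (T_op f \<i>) = 0"
    using continuous_T_op Re_T_op_real Im_T_op_i by (auto simp: T_op_on_upper)
qed

lemma test_functions_of_real:
  assumes "\<phi> \<in> test_functions U"
  shows "(\<lambda>t. complex_of_real (\<phi> t)) \<in> test_functions U"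
  by (rule test_functions_bounded_linear[OF bounded_linear_of_real assms])

text \<open>The pairing of \<open>g\<close> tends to its integral against \<open>\<phi>\<close> over
  the real line, which is imaginary for real \<open>\<phi>\<close>. The slices at positive height
  see \<open>W\<close> on the half-plane only.\<close>

lemma boundary_value_add_imaginary:
  assumes h: "has_boundary_value h" and g: "continuous_on UNIV g" "\<And>t. Re (g (of_real t)) = 0"
    and W: "\<And>z. z \<in> upper_hp \<Longrightarrow> W z = h z + g z"
  shows "has_boundary_value W"
    and "\<phi> \<in> test_functions UNIV \<Longrightarrow> Re_distr (boundary_pairing W) \<phi> = Re_distr (boundary_pairing h) \<phi>"
proof -
  have ev: "\<forall>\<^sub>F s in at_right 0. integrable lebesgue (\<lambda>t. W (Complex t s) * \<phi> t)"
    and lim: "((\<lambda>s. LINT t|lebesgue. W (Complex t s) * \<phi> t)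
      \<longlongrightarrow> boundary_pairing h \<phi> + (LINT t|lebesgue. g (of_real t) * \<phi> t)) (at_right 0)"
    if \<phi>: "\<phi> \<in> test_functions UNIV" for \<phi> :: "real \<Rightarrow> complex"
  proof -
    obtain L where hi: "\<forall>\<^sub>F s in at_right 0. integrable lebesgue (\<lambda>t. h (Complex t s) * \<phi> t)"
      and L: "((\<lambda>s. LINT t|lebesgue. h (Complex t s) * \<phi> t) \<longlongrightarrow> L) (at_right 0)"
      using h \<phi> unfolding has_boundary_value_def boundary_pairing_exists_def by blast
    have L': "boundary_pairing h \<phi> = L"
      unfolding boundary_pairing_def by (rule tendsto_Lim[OF _ L]) simp
    have Weq: "(\<lambda>t. W (Complex t s) * \<phi> t) = (\<lambda>t. h (Complex t s) * \<phi> t + g (Complex t s) * \<phi> t)" if "s > 0" for s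
      using W that by (simp add: upper_hp_def fun_eq_iff distrib_right)
    have pos: "\<forall>\<^sub>F s in at_right (0::real). s > 0"
      by (rule eventually_at_right_less)
    show "\<forall>\<^sub>F s in at_right 0. integrable lebesgue (\<lambda>t. W (Complex t s) * \<phi> t)"
      using hi pos
    proof eventually_elim
      case (elim s)
      show ?case
        unfolding Weq[OF elim(2)]
        by (rule Bochner_Integration.integrable_add[OF elim(1) continuous_boundary_pairing(1)[OF g(1) \<phi>]])
    qed
    have "\<forall>\<^sub>F s in at_right 0. (LINT t|lebesgue. h (Complex t s) * \<phi> t) + (LINT t|lebesgue. g (Complex t s) * \<phi> t)
        = (LINT t|lebesgue. W (Complex t s) * \<phi> t)"
      using hi pos
    proof eventually_elim
      case (elim s)
      show ?case
        unfolding Weq[OF elim(2)]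
        by (rule Bochner_Integration.integral_add[OF elim(1) continuous_boundary_pairing(1)[OF g(1) \<phi>], symmetric])
    qed
    then show "((\<lambda>s. LINT t|lebesgue. W (Complex t s) * \<phi> t)
      \<longlongrightarrow> boundary_pairing h \<phi> + (LINT t|lebesgue. g (of_real t) * \<phi> t)) (at_right 0)"
      unfolding L' by (rule Lim_transform_eventually[OF tendsto_add[OF L continuous_boundary_pairing(2)[OF g(1) \<phi>]]])
  qed
  show "has_boundary_value W"
    unfolding has_boundary_value_def boundary_pairing_exists_def using ev lim by blast
  assume \<phi>: "\<phi> \<in> test_functions UNIV"
  let ?\<phi> = "\<lambda>t. complex_of_real (\<phi> t)"
  have \<phi>': "?\<phi> \<in> test_functions UNIV"
    by (rule test_functions_of_real[OF \<phi>])
  have "boundary_pairing W ?\<phi> = boundary_pairing h ?\<phi> + (LINT t|lebesgue. g (of_real t) * ?\<phi> t)"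
    unfolding boundary_pairing_def[of W] by (rule tendsto_Lim[OF _ lim[OF \<phi>']]) simp
  moreover have "Re (LINT t|lebesgue. g (of_real t) * ?\<phi> t) = 0"
  proof -
    have "integrable lebesgue (\<lambda>t. g (of_real t) * ?\<phi> t)"
      using continuous_boundary_pairing(1)[OF g(1) \<phi>', of 0] by (simp add: Complex_eq)
    from integral_Re[OF this] show ?thesis
      using g(2) by simp
  qed
  ultimately show "Re_distr (boundary_pairing W) \<phi> = Re_distr (boundary_pairing h) \<phi>"
    by (simp add: Re_distr_def)
qed

text \<open>For \<open>j = 0\<close> the two functions may differ off the half-plane; one
  application of \<open>T_op\<close> already makes them equal everywhere.\<close>

lemma funpow_T_op_cong:
  assumes "\<And>\<zeta>. \<zeta> \<in> upper_hp \<Longrightarrow> f \<zeta> = g \<zeta>" "j \<ge> 1"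
  shows "(T_op ^^ j) f = (T_op ^^ j) g"
proof -
  obtain i where "j = Suc i"
    using assms(2) by (cases j) auto
  then show ?thesis
    by (simp only: funpow_Suc_right o_apply T_op_cong(1)[OF assms(1)])
qed

theorem theorem3p19:
  fixes n :: nat and p c :: real
    and f :: "complex \<Rightarrow> complex" and h :: "nat \<Rightarrow> complex \<Rightarrow> complex"
  assumes "n > 0" and "p > 2"
    and "f \<in> Lp_nu p 2"
    and "h 0 \<in> H_tg"
    and "\<And>k. 1 \<le> k \<Longrightarrow> k \<le> n - 1 \<Longrightarrow> h k \<in> H_tg0 \<inter> Lp_nu p 2"
    \<comment> \<open>The integrals in the second and later applications of the operator are defined; for the
        first application this is part of the conclusion.\<close>
    and "\<And>j z. 1 \<le> j \<Longrightarrow> j < n \<Longrightarrow> z \<in> upper_hp \<Longrightarrow> T_defined ((T_op ^^ j) f) z"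
    and "\<And>k j z. 1 \<le> k \<Longrightarrow> k \<le> n - 1 \<Longrightarrow> 1 \<le> j \<Longrightarrow> j < k \<Longrightarrow> z \<in> upper_hp \<Longrightarrow>
           T_defined ((T_op ^^ j) (poisson_ext (h k))) z"
  shows "schwarz_formula_defined n f h \<and> solves_schwarz n f h c (schwarz_formula n f h c)"
proof -
  note n = assms(1) and p = assms(2) and f = assms(3) and h0 = assms(4) and hk = assms(5)
    and Tf = assms(6) and Th = assms(7)
  have htg: "h k \<in> H_tg" if "k < n" for k
    using h0 hk[of k] that by (cases "k = 0") (auto simp: H_tg0_def)
  have hol: "h k holomorphic_on upper_hp" if "k < n" for k
    by (rule H_tg_holomorphic[OF htg[OF that]])
  have ext: "poisson_ext (h k) \<zeta> = h k \<zeta>" if "k < n" "\<zeta> \<in> upper_hp" for k \<zeta>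
    unfolding poisson_ext_def boundary_pairing_poisson(2)[OF htg[OF that(1)] that(2)] by simp
  have pow_ext: "(T_op ^^ j) (poisson_ext (h k)) = (T_op ^^ j) (h k)" if "k < n" "1 \<le> j" for j k
    by (rule funpow_T_op_cong) (use ext that in auto)
  \<comment> \<open>A common name for the densities: \<open>f\<close> takes the place of index
    \<open>n\<close>, so the operator terms of the formula are \<open>(T_op ^^ k) (u k)\<close> for
    \<open>k\<close> from 1 to \<open>n\<close>.\<close>
  define u where "u k = (if k = n then f else h k)" for k
  have dens: "schwarz_density p (on_upper ((T_op ^^ j) (u k)))" if k: "1 \<le> k" "k \<le> n" "j < k" for j k
  proof (rule funpow_T_op_schwarz_density)
    show "schwarz_density p (on_upper (u k))"
      by (rule Lp_nu_schwarz_density[OF p]) (use f hk k in \<open>auto simp: u_def\<close>)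
    show "T_defined ((T_op ^^ i) (u k)) z" if "1 \<le> i" "i \<le> j" "z \<in> upper_hp" for i z
      using Tf[of i z] Th[of k i z] that k pow_ext[of k i] by (cases "k = n") (auto simp: u_def)
  qed
  have dens_def: "T_defined g z" if "schwarz_density p (on_upper g)" "z \<in> upper_hp" for g z
    using schwarz_density.T_defined[OF that] by (simp add: T_defined_iff)
  have defined: "schwarz_formula_defined n f h"
    unfolding schwarz_formula_defined_def
  proof (intro conjI allI ballI impI)
    show "boundary_pairing_exists (h k) (poisson_at z)" if "k < n" "z \<in> upper_hp" for k z
      by (rule boundary_pairing_poisson(1)[OF htg[OF that(1)] that(2)])
    show "boundary_pairing_exists (\<lambda>\<zeta>. of_real (Im (h 0 \<zeta>))) (\<lambda>t. of_real (poisson_P t 1))"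
      by (rule boundary_pairing_Im_poisson(1)[OF h0])
    show "T_defined ((T_op ^^ j) (poisson_ext (h k))) z" if "k \<in> {1..n - 1}" "j < k" "z \<in> upper_hp" for k j z
    proof (cases "j = 0")
      case True
      \<comment> \<open>With \<open>j = 0\<close> no application of \<open>T_op\<close> has erased
        the values off the half-plane, so the passage to \<open>h k\<close> needs the congruence
        rule for \<open>T_defined\<close>.\<close>
      have "T_defined (poisson_ext (h k)) = T_defined (h k)"
        by (rule T_op_cong(2)) (use ext that in auto)
      moreover have "u k = h k"
        using that n by (auto simp: u_def)
      ultimately show ?thesis
        using True dens_def[OF dens[of k 0] that(3)] that by simp
    next
      case False
      then show ?thesis
        using Th that by auto
    qed
    show "T_defined ((T_op ^^ j) f) z" if "j < n" "z \<in> upper_hp" for j z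
      using dens_def[OF dens[of n j] that(2)] that n by (simp add: u_def)
  qed
  \<comment> \<open>The formula contributes \<open>\<i> * c\<close> and subtracts
    \<open>\<i> * Im (h 0 \<i>)\<close>; with this constant added, the holomorphic part has
    imaginary part \<open>c\<close> at \<open>\<i>\<close>.\<close>
  define h' where "h' k = (if k = 0 then (\<lambda>z. \<i> * of_real (c - Im (h 0 \<i>)) + h 0 z) else h k)" for k
  \<comment> \<open>What is left of the operator terms after \<open>k\<close> derivatives: each
    application of \<open>dbar\<close> undoes one \<open>T_op\<close>.\<close>
  define g where "g k z = (\<Sum>j=k+1..n. (T_op ^^ (j - k)) (u j) z)" for k z
  \<comment> \<open>\<open>W 0\<close> has to be the formula itself, off the half-plane too, and
    \<open>W n = f\<close> lets a single induction reach the differential equation.\<close>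
  define W where "W k = (if k = 0 then schwarz_formula n f h c else if k = n then f else (\<lambda>z. h k z + g k z))" for k
  have pow_Suc: "(T_op ^^ (j - k)) (u j) = T_op ((T_op ^^ (j - Suc k)) (u j))"
    and pow_dens: "schwarz_density p (on_upper ((T_op ^^ (j - Suc k)) (u j)))" if "j \<in> {k+1..n}" for j k
  proof -
    have "j - k = Suc (j - Suc k)"
      using that by auto
    then show "(T_op ^^ (j - k)) (u j) = T_op ((T_op ^^ (j - Suc k)) (u j))"
      by simp
    show "schwarz_density p (on_upper ((T_op ^^ (j - Suc k)) (u j)))"
      by (rule dens) (use that in auto)
  qed
  have g_prop: "continuous_on UNIV (g k)" "Re (g k (of_real t)) = 0" "Im (g k \<i>) = 0" for k t
    using T_op_boundary_properties[OF pow_dens] unfolding g_def[abs_def]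
    by (auto simp: pow_Suc intro!: continuous_on_sum sum.neutral)
  have W_eq: "W k z = h' k z + g k z" if "k < n" "z \<in> upper_hp" for k z
  proof (cases "k = 0")
    case True
    have "schwarz_formula n f h c z = \<i> * of_real c + h 0 z - \<i> * of_real (Im (h 0 \<i>)) + g 0 z"
    proof -
      have "{1..n} = insert n {1..n-1}"
        using n by auto
      moreover have "(\<Sum>k=1..n - 1. (T_op ^^ k) (poisson_ext (h k)) z) = (\<Sum>j=1..n-1. (T_op ^^ j) (u j) z)"
        by (intro sum.cong) (use pow_ext in \<open>auto simp: u_def\<close>)
      ultimately show ?thesis
        using n unfolding schwarz_formula_def g_def boundary_pairing_Im_poisson(2)[OF h0]
          boundary_pairing_poisson(2)[OF h0 that(2)] by (simp add: u_def)
    qed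
    then show ?thesis
      using True by (simp add: W_def h'_def algebra_simps)
  qed (use that in \<open>auto simp: W_def h'_def\<close>)
  have h'_hol: "h' k holomorphic_on upper_hp" if "k < n" for k
    unfolding h'_def using hol[OF that] hol[of 0] n by (auto intro!: holomorphic_intros)
  have W_cont: "continuous_on upper_hp (W k)" if "k < n" for k
  proof -
    have "continuous_on upper_hp (\<lambda>z. h' k z + g k z)"
      by (intro continuous_on_add holomorphic_on_imp_continuous_on[OF h'_hol[OF that]]
          continuous_on_subset[OF g_prop(1)]) auto
    then show ?thesis
      by (rule continuous_on_eq) (simp add: W_eq[OF that])
  qed
  have W_dbar1: "has_weak_dbar 1 (W k) (W (Suc k))" if k: "k < n" for k
  proof -
    \<comment> \<open>\<open>dbar\<close> annihilates \<open>h' k\<close> and removes one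
      \<open>T_op\<close> from every term. The term \<open>j = k + 1\<close> is left with exponent 0
      and becomes \<open>u (k + 1)\<close>: the holomorphic part of the next stage, or
      \<open>f\<close> at the end.\<close>
    let ?v = "\<lambda>z. \<Sum>j=k+1..n. (T_op ^^ (j - Suc k)) (u j) z"
    have "has_weak_dbar 1 (g k) ?v"
      unfolding g_def[abs_def]
      by (intro has_weak_dbar_sum) (simp_all add: pow_Suc T_op_has_weak_dbar[OF pow_dens, simplified])
    from has_weak_dbar_add[OF holomorphic_has_weak_dbar_0[OF h'_hol[OF k]] this]
    have "has_weak_dbar 1 (\<lambda>z. h' k z + g k z) (\<lambda>z. 0 + ?v z)" .
    moreover have "0 + ?v z = W (Suc k) z" for z
    proof -
      have "{k+1..n} = insert (Suc k) {Suc k+1..n}"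
        using k by auto
      then show ?thesis
        by (simp add: W_def g_def u_def)
    qed
    ultimately show ?thesis
      using has_weak_dbar_cong[of "W k" "\<lambda>z. h' k z + g k z" "W (Suc k)" "\<lambda>z. 0 + ?v z" 1] W_eq[OF k] by simp
  qed
  have W_dbar: "has_weak_dbar k (W 0) (W k)" if "k \<le> n" for k
    using that
  proof (induction k)
    case 0
    show ?case
      by (intro has_weak_dbar_0 locally_integrable_on_continuous W_cont n)
  next
    case (Suc k)
    then show ?case
      using has_weak_dbar_Suc W_dbar1[of k] by auto
  qed
  have W_bv: "has_boundary_value (W k)"
    "\<phi> \<in> test_functions UNIV \<Longrightarrow> Re_distr (boundary_pairing (W k)) \<phi> = Re_distr (boundary_pairing (h k)) \<phi>"
    if k: "k < n" for k and \<phi> :: "real \<Rightarrow> real"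
  proof -
    \<comment> \<open>For \<open>k = 0\<close> the imaginary constant in \<open>h' 0\<close> is
      moved to the continuous part, as boundary values are compared with those of \<open>h 0\<close>
      itself.\<close>
    define q where "q z = g k z + (if k = 0 then \<i> * of_real (c - Im (h 0 \<i>)) else 0)" for z
    have q: "continuous_on UNIV q" "Re (q (of_real t)) = 0" for t
      unfolding q_def using g_prop by (auto intro!: continuous_intros)
    have Wq: "W k z = h k z + q z" if "z \<in> upper_hp" for z
      unfolding W_eq[OF k that] by (auto simp: h'_def q_def)
    show "has_boundary_value (W k)"
      by (rule boundary_value_add_imaginary(1)[OF H_tg_has_boundary_value[OF htg[OF k]] q Wq])
    show "Re_distr (boundary_pairing (W k)) \<phi> = Re_distr (boundary_pairing (h k)) \<phi>"
      if "\<phi> \<in> test_functions UNIV"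
      by (rule boundary_value_add_imaginary(2)[OF H_tg_has_boundary_value[OF htg[OF k]] q Wq that])
  qed
  have i: "\<i> \<in> upper_hp"
    by (simp add: upper_hp_def)
  have "solves_schwarz n f h c (schwarz_formula n f h c)"
    unfolding solves_schwarz_def
  proof (intro conjI exI[of _ W] allI impI ballI)
    show "W 0 = schwarz_formula n f h c"
      by (simp add: W_def)
    then show "has_weak_dbar n (schwarz_formula n f h c) f"
      using W_dbar[of n] n by (simp add: W_def)
    show "has_weak_dbar k (schwarz_formula n f h c) (W k)" if "k < n" for k
      using W_dbar[of k] that \<open>W 0 = schwarz_formula n f h c\<close> by simp
    show "Im (schwarz_formula n f h c \<i>) = c"
      using W_eq[OF n i] g_prop(3) by (simp add: \<open>W 0 = schwarz_formula n f h c\<close> h'_def)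
    show "Im (W k \<i>) = 0" if "k \<in> {1..n - 1}" for k
    proof -
      have "k < n" "h k \<in> H_tg0"
        using that hk by auto
      then show ?thesis
        using W_eq[OF _ i, of k] g_prop(3) that by (simp add: h'_def H_tg0_def)
    qed
  qed (use W_cont W_bv H_tg_has_boundary_value htg in auto)
  with defined show ?thesis ..
qed

end
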